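(* Let $p,q\in\mathbb{N}$ with $\frac1p+\frac1q<\frac12$ and $q$ even, and consider the hyperbolic $(p,q)$-tiling. Given a base tile, there is a bijection between admissible word classes of length $n$ and tiles of tiling distance $n$ away from the base tile.
   Context: A hyperbolic $(p,q)$-tiling is a tiling of the hyperbolic plane by regular $p$-gons, $q$ meeting at each vertex. A tiling path is a sequence of tiles in which consecutive tiles share an edge; the length of a finite tiling path is one fewer than its number of tiles; the tiling distance between two tiles is the minimal length of a tiling path joining them. Label the edges of the base tile cyclically by $1,\dots,p$; since $q$ is even this extends to a labelling of all edges consistent under reflections over edges. The word associated to a tiling path $(A_0,\dots,A_n)$ is $a_1\cdots a_n$ where $a_i$ is the label of the edge between $A_{i-1}$ and $A_i$; words in the letters $1,\dots,p$ correspond bijectively to tiling paths starting at the base tile. A vertex sequence is a tiling subpath traversing $\frac q2+1$ successive tiles around a vertex $v$ (equivalently a subword of length $\frac q2$ of alternating letters $k,k+1$, or $p,1$, in either order). Two vertex sequences are vertex sequence equivalent if they have the same starting and ending tiles and traverse $\frac q2+1$ successive tiles in opposite directions around $v$ (on words: the roles of $k$ and $k+1$ are interchanged). Two finite words (or tiling paths) are word equivalent if they differ by finitely many exchanges of vertex sequences with their vertex sequence equivalents. A word is admissible if it satisfies: [E1] it contains no two-letter subword $kk$, $k\in\{1,\dots,p\}$; [E2] it contains no subword of length greater than $\frac q2$ consisting of alternating letters $k$ and $k+1$ (or $p$ and $1$). An admissible word class is a word equivalence class all of whose words are admissible. *)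

theory Defs
  imports "HOL-Analysis.Analysis" "HOL-Library.Sublist"
begin

section \<open>The hyperbolic plane\<close>

text \<open>
  We use the Klein (projective) model: the points are those of the open unit disc, and the
  geodesic segments, lines and convex sets are exactly the Euclidean ones inside the disc.
  Hence convex hulls, faces and edges of polygons can be taken from the Euclidean library.
  Distances and angles, however, are not Euclidean (the model is not conformal).
\<close>

definition hplane :: "complex set" where
  "hplane = ball 0 1"

definition hdist :: "complex \<Rightarrow> complex \<Rightarrow> real" where
  "hdist x y = arcosh ((1 - x \<bullet> y) / sqrt ((1 - x \<bullet> x) * (1 - y \<bullet> y)))"

text \<open>The Riemannian metric of the Klein model at the point \<open>x\<close>, on tangent vectors \<open>u\<close>, \<open>v\<close>.\<close>

definition hmetric :: "complex \<Rightarrow> complex \<Rightarrow> complex \<Rightarrow> real" where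
  "hmetric x u v = (u \<bullet> v) / (1 - x \<bullet> x) + (x \<bullet> u) * (x \<bullet> v) / (1 - x \<bullet> x)\<^sup>2"

text \<open>The angle at \<open>b\<close> between the geodesic segments from \<open>b\<close> to \<open>a\<close> and from \<open>b\<close> to \<open>c\<close>;
  these are chords, so their initial directions are \<open>a - b\<close> and \<open>c - b\<close>.\<close>

definition hangle :: "complex \<Rightarrow> complex \<Rightarrow> complex \<Rightarrow> real" where
  "hangle a b c = arccos (hmetric b (a - b) (c - b) /
     sqrt (hmetric b (a - b) (a - b) * hmetric b (c - b) (c - b)))"

text \<open>Reflection over the line spanned by a segment \<open>e\<close>: the isometry of the plane whose
  fixed points are exactly the points of that line.\<close>

definition hreflection :: "complex set \<Rightarrow> (complex \<Rightarrow> complex) \<Rightarrow> bool" where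
  "hreflection e r \<longleftrightarrow>
     bij_betw r hplane hplane \<and>
     (\<forall>x\<in>hplane. \<forall>y\<in>hplane. hdist (r x) (r y) = hdist x y) \<and>
     {x \<in> hplane. r x = x} = affine hull e \<inter> hplane"


section \<open>Regular polygons and tilings\<close>

text \<open>\<open>v 0, \<dots>, v (p - 1)\<close> are the vertices of the convex \<open>p\<close>-gon \<open>A\<close> in cyclic order;
  \<open>side p v i\<close> is the side from \<open>v i\<close> to its successor.\<close>

definition side :: "nat \<Rightarrow> (nat \<Rightarrow> complex) \<Rightarrow> nat \<Rightarrow> complex set" where
  "side p v i = closed_segment (v i) (v (Suc i mod p))"

definition cyclic_vertices :: "nat \<Rightarrow> (nat \<Rightarrow> complex) \<Rightarrow> complex set \<Rightarrow> bool" where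
  "cyclic_vertices p v A \<longleftrightarrow>
     3 \<le> p \<and> inj_on v {..<p} \<and> v ` {..<p} \<subseteq> hplane \<and>
     A = convex hull (v ` {..<p}) \<and>
     {e. e edge_of A} = side p v ` {..<p}"

definition regular_polygon :: "nat \<Rightarrow> real \<Rightarrow> real \<Rightarrow> complex set \<Rightarrow> bool" where
  "regular_polygon p s \<alpha> A \<longleftrightarrow>
     (\<exists>v. cyclic_vertices p v A \<and>
        (\<forall>i<p. hdist (v i) (v (Suc i mod p)) = s) \<and>
        (\<forall>i<p. hangle (v i) (v (Suc i mod p)) (v (Suc (Suc i) mod p)) = \<alpha>))"

text \<open>A locally finite, edge-to-edge tiling of the plane by congruent regular \<open>p\<close>-gons
  (common side length \<open>s\<close> and interior angle \<open>\<alpha>\<close>), \<open>q\<close> of them meeting at each vertex.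
  For distinct tiles, the condition that their intersection is a face of both (possibly empty)
  says that they are disjoint or share exactly a vertex or exactly an edge.\<close>

definition hyperbolic_tiling :: "nat \<Rightarrow> nat \<Rightarrow> complex set set \<Rightarrow> bool" where
  "hyperbolic_tiling p q T \<longleftrightarrow>
     (\<exists>s \<alpha>. \<forall>A\<in>T. regular_polygon p s \<alpha> A) \<and>
     \<Union>T = hplane \<and>
     (\<forall>A\<in>T. \<forall>B\<in>T. A \<noteq> B \<longrightarrow> interior A \<inter> interior B = {}) \<and>
     (\<forall>A\<in>T. \<forall>B\<in>T. (A \<inter> B) face_of A \<and> (A \<inter> B) face_of B) \<and>
     (\<forall>K. compact K \<and> K \<subseteq> hplane \<longrightarrow> finite {A \<in> T. A \<inter> K \<noteq> {}}) \<and>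
     (\<forall>A\<in>T. \<forall>x. x extreme_point_of A \<longrightarrow> card {B \<in> T. x \<in> B} = q)"

definition tiling_edges :: "complex set set \<Rightarrow> complex set set" where
  "tiling_edges T = {e. \<exists>A\<in>T. e edge_of A}"

definition share_edge :: "complex set \<Rightarrow> complex set \<Rightarrow> bool" where
  "share_edge A B \<longleftrightarrow> A \<noteq> B \<and> (A \<inter> B) edge_of A \<and> (A \<inter> B) edge_of B"

definition tiling_path :: "complex set set \<Rightarrow> complex set list \<Rightarrow> bool" where
  "tiling_path T P \<longleftrightarrow> P \<noteq> [] \<and> set P \<subseteq> T \<and> successively share_edge P"

definition tiling_dist :: "complex set set \<Rightarrow> complex set \<Rightarrow> complex set \<Rightarrow> nat" where
  "tiling_dist T A B =
     (LEAST n. \<exists>P. tiling_path T P \<and> hd P = A \<and> last P = B \<and> length P - 1 = n)"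


section \<open>Edge labellings and the words of tiling paths\<close>

text \<open>The sides of the base tile \<open>A0\<close> carry the labels \<open>1, \<dots>, p\<close> in cyclic order, and the
  labelling of all edges is invariant under the reflections over edges.\<close>

definition edge_labelling ::
    "nat \<Rightarrow> complex set set \<Rightarrow> complex set \<Rightarrow> (complex set \<Rightarrow> nat) \<Rightarrow> bool" where
  "edge_labelling p T A0 lab \<longleftrightarrow>
     (\<exists>v. cyclic_vertices p v A0 \<and> (\<forall>i<p. lab (side p v i) = Suc i)) \<and>
     (\<forall>e\<in>tiling_edges T. \<forall>r. hreflection e r \<longrightarrow>
        (\<forall>f\<in>tiling_edges T. lab (r ` f) = lab f))"

definition path_word :: "(complex set \<Rightarrow> nat) \<Rightarrow> complex set list \<Rightarrow> nat list" where
  "path_word lab P = map (\<lambda>(A, B). lab (A \<inter> B)) (zip P (tl P))"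

definition word_leads_to ::
    "complex set set \<Rightarrow> (complex set \<Rightarrow> nat) \<Rightarrow> complex set \<Rightarrow> nat list \<Rightarrow> complex set \<Rightarrow> bool" where
  "word_leads_to T lab A0 w B \<longleftrightarrow>
     (\<exists>P. tiling_path T P \<and> hd P = A0 \<and> last P = B \<and> path_word lab P = w)"


section \<open>Words, word equivalence and admissibility\<close>

definition words :: "nat \<Rightarrow> nat list set" where
  "words p = lists {1..p}"

text \<open>Two letters are \<open>k, k + 1\<close> or \<open>p, 1\<close>, in either order.\<close>

definition consecutive_letters :: "nat \<Rightarrow> nat \<Rightarrow> nat \<Rightarrow> bool" where
  "consecutive_letters p a b \<longleftrightarrow>
     a \<in> {1..p} \<and> b \<in> {1..p} \<and>
     (b = a + 1 \<or> a = b + 1 \<or> (a = p \<and> b = 1) \<or> (a = 1 \<and> b = p))"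

text \<open>The word \<open>abab\<dots>\<close> of length \<open>m\<close>.\<close>

definition alternating :: "nat \<Rightarrow> nat \<Rightarrow> nat \<Rightarrow> nat list" where
  "alternating m a b = map (\<lambda>i. if even i then a else b) [0..<m]"

definition exchange :: "nat \<Rightarrow> nat \<Rightarrow> nat list \<Rightarrow> nat list \<Rightarrow> bool" where
  "exchange p q w w' \<longleftrightarrow>
     (\<exists>x y a b. consecutive_letters p a b \<and>
        w = x @ alternating (q div 2) a b @ y \<and>
        w' = x @ alternating (q div 2) b a @ y)"

definition word_equiv :: "nat \<Rightarrow> nat \<Rightarrow> (nat list \<times> nat list) set" where
  "word_equiv p q = {(w, w'). w \<in> words p \<and> w' \<in> words p \<and> (exchange p q)\<^sup>*\<^sup>* w w'}"

definition admissible :: "nat \<Rightarrow> nat \<Rightarrow> nat list \<Rightarrow> bool" where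
  "admissible p q w \<longleftrightarrow>
     (\<forall>k\<in>{1..p}. \<not> sublist [k, k] w) \<and>
     (\<forall>a b m. consecutive_letters p a b \<and> m > q div 2 \<longrightarrow> \<not> sublist (alternating m a b) w)"

text \<open>Exchanges preserve the length, so all words of a class have the same length.\<close>

definition admissible_word_classes :: "nat \<Rightarrow> nat \<Rightarrow> nat \<Rightarrow> nat list set set" where
  "admissible_word_classes p q n =
     {C \<in> words p // word_equiv p q. \<forall>w\<in>C. admissible p q w \<and> length w = n}"

lemma exchange_sym: "exchange p q w w' \<Longrightarrow> exchange p q w' w"
  unfolding exchange_def consecutive_letters_def by blast

lemma equiv_word_equiv: "equiv (words p) (word_equiv p q)"
proof (rule equivI)
  have "symp (exchange p q)"
    by (auto intro: sympI exchange_sym)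
  then show "sym (word_equiv p q)"
    unfolding word_equiv_def by (auto intro!: symI dest: sympD[OF symp_rtranclp])
qed (auto simp: word_equiv_def refl_on_def intro!: transI)

end

(*
Reflections over tiling edges map neighbouring tiles onto each other, since a regular polygon is
determined by a side and the half plane it lies in. Hence they preserve the whole tiling and, by
assumption, the labels, and no line through an edge (a wall) cuts a tile. Reflecting the tail of a
shortest path shows that crossing an edge lowers the distance to the base tile exactly when the wall
of that edge separates the tile from the base tile.

The lines of two nonadjacent sides of a tile never meet in the plane: otherwise there are sides e, g, f
of a tile, consecutive in this order, with the lines of e and f meeting beyond g; the next tile lies
inside the triangle cut off there, and the same situation recurs inside that triangle, contradicting
local finiteness. So if two neighbours of a tile are closer to the base tile, the two edges share a
vertex v. Around v the distance has a unique local minimum, so it decreases along both ways of walking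
q/2 steps around v, and these ways lead to the same tile.

This makes Matsumoto's argument work: geodesic words with the same end tile are word equivalent. Tits'
argument then shows that a word that is not geodesic is equivalent to one containing kk.
*)
theory Submission
  imports Defs
begin

section \<open>Reflections of the Klein model\<close>

text \<open>In the Klein model a reflection is a projective map that comes from a Lorentz
  reflection. It carries segments to segments, so hulls, faces and edges move along with it; the
  price is that invariance of distances and angles has to be computed, which is done through Lorentz
  products. Afterwards the metric is used only to compare congruent polygons, and the rest argues
  with half planes, convexity and local finiteness. The reflection group itself is never
  constructed. Tiles stand for its elements, crossing the edge labelled \<open>k\<close> is an
  involution \<open>nb _ k\<close> on tiles, and \<open>tdist\<close> plays the role of the length
  function. Reflections preserve labels, hence commute with these crossings. This makes the tiles
  around a vertex a cycle traversed by two alternating involutions, and it is the reason why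
  exchanging vertex sequences does not change the end tile of a word.\<close>

lemma hplane_iff: "x \<in> hplane \<longleftrightarrow> x \<bullet> x < 1"
  unfolding hplane_def by (simp add: norm_eq_sqrt_inner real_sqrt_lt_1_iff)

lemma convex_hplane: "convex hplane" and open_hplane: "open hplane"
  unfolding hplane_def by auto

definition hden :: "complex \<Rightarrow> real \<Rightarrow> complex \<Rightarrow> real" where
  "hden n c x = n \<bullet> n + c\<^sup>2 - 2 * c * (n \<bullet> x)"

text \<open>The Lorentz reflection \<open>X - 2 \<langle>X, N\<rangle> / \<langle>N, N\<rangle> N\<close> of \<open>X = (1, x)\<close>, where \<open>N = (c, n)\<close>, read in
  homogeneous coordinates; \<open>hden\<close> is its first coordinate, scaled by \<open>\<langle>N, N\<rangle>\<close>.\<close>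

definition hrefl :: "complex \<Rightarrow> real \<Rightarrow> complex \<Rightarrow> complex" where
  "hrefl n c x = ((n \<bullet> n - c\<^sup>2) *\<^sub>R x - (2 * (n \<bullet> x - c)) *\<^sub>R n) /\<^sub>R hden n c x"

text \<open>Minus the Lorentz product of \<open>(1, x)\<close> and \<open>(1, y)\<close>. Distances
  and angles are both expressed through it, so their invariance reduces to
  \<open>lform_hrefl\<close>.\<close>

definition lform :: "complex \<Rightarrow> complex \<Rightarrow> real" where
  "lform x y = 1 - x \<bullet> y"

context
  fixes n :: complex and c :: real
  assumes nc: "c\<^sup>2 < n \<bullet> n"
begin

text \<open>The reflected vector still has positive first coordinate, so it may be scaled back to
  first coordinate one. The estimate compares \<open>hden\<close> with a perfect square, using
  \<open>x \<bullet> x < 1\<close>.\<close>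

lemma hden_pos:
  assumes "x \<in> hplane"
  shows "hden n c x > 0"
proof -
  have n0: "n \<bullet> n > 0" using nc by (smt (verit) zero_le_power2)
  have "0 \<le> (c *\<^sub>R n - (n \<bullet> n) *\<^sub>R x) \<bullet> (c *\<^sub>R n - (n \<bullet> n) *\<^sub>R x)" by simp
  also have "\<dots> = (n \<bullet> n) * (c\<^sup>2 - 2 * c * (n \<bullet> x) + (n \<bullet> n) * (x \<bullet> x))"
    by (simp add: inner_diff inner_commute algebra_simps power2_eq_square)
  finally have "0 \<le> c\<^sup>2 - 2 * c * (n \<bullet> x) + (n \<bullet> n) * (x \<bullet> x)"
    using n0 by (simp add: zero_le_mult_iff)
  moreover have "(n \<bullet> n) * (x \<bullet> x) < n \<bullet> n" using assms n0 by (simp add: hplane_iff)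
  ultimately show ?thesis unfolding hden_def by linarith
qed

text \<open>A Lorentz reflection preserves the product; the factors come from scaling the first
  coordinates back to one.\<close>

lemma lform_hrefl:
  assumes "x \<in> hplane" "y \<in> hplane"
  shows "lform (hrefl n c x) (hrefl n c y) = (n \<bullet> n - c\<^sup>2)\<^sup>2 * lform x y / (hden n c x * hden n c y)"
proof -
  have p: "hden n c x > 0" "hden n c y > 0" using assms hden_pos by auto
  have "hden n c x * hden n c y * (hrefl n c x \<bullet> hrefl n c y)
     = ((n \<bullet> n - c\<^sup>2) *\<^sub>R x - (2 * (n \<bullet> x - c)) *\<^sub>R n) \<bullet> ((n \<bullet> n - c\<^sup>2) *\<^sub>R y - (2 * (n \<bullet> y - c)) *\<^sub>R n)"
    using p unfolding hrefl_def inner_scaleR_left inner_scaleR_right by simp (simp add: field_simps)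
  also have "\<dots> = hden n c x * hden n c y - (n \<bullet> n - c\<^sup>2)\<^sup>2 * (1 - x \<bullet> y)"
    unfolding hden_def by (simp add: inner_diff inner_commute algebra_simps power2_eq_square)
  finally show ?thesis using p unfolding lform_def by (simp add: field_simps)
qed

lemma hrefl_in_hplane: "x \<in> hplane \<Longrightarrow> hrefl n c x \<in> hplane"
  using lform_hrefl[of x x] hden_pos[of x] nc unfolding lform_def hplane_iff
  by (smt (verit) divide_pos_pos mult_pos_pos zero_less_power)

text \<open>\<open>n \<bullet> x - c\<close> is the Lorentz product of \<open>(1, x)\<close> with
  the normal \<open>(c, n)\<close>, which the reflection negates. Thus the two sides of the line are
  swapped.\<close>

lemma inner_hrefl:
  assumes "x \<in> hplane"
  shows "n \<bullet> hrefl n c x - c = - (n \<bullet> n - c\<^sup>2) * (n \<bullet> x - c) / hden n c x"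
proof -
  have p: "hden n c x > 0" using assms hden_pos by auto
  have "hden n c x * (n \<bullet> hrefl n c x) = n \<bullet> ((n \<bullet> n - c\<^sup>2) *\<^sub>R x - (2 * (n \<bullet> x - c)) *\<^sub>R n)"
    using p unfolding hrefl_def inner_scaleR_left inner_scaleR_right by simp
  also have "\<dots> = hden n c x * c - (n \<bullet> n - c\<^sup>2) * (n \<bullet> x - c)"
    unfolding hden_def by (simp add: inner_diff inner_commute algebra_simps power2_eq_square)
  finally show ?thesis using p by (simp add: field_simps)
qed

lemma hden_hrefl:
  assumes "x \<in> hplane"
  shows "hden n c (hrefl n c x) = (n \<bullet> n - c\<^sup>2)\<^sup>2 / hden n c x"
proof -
  have p: "hden n c x > 0" using assms hden_pos by auto
  have "hden n c (hrefl n c x) = n \<bullet> n - c\<^sup>2 - 2 * c * (n \<bullet> hrefl n c x - c)"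
    unfolding hden_def by (simp add: algebra_simps power2_eq_square)
  also have "\<dots> = (n \<bullet> n - c\<^sup>2)\<^sup>2 / hden n c x"
    unfolding inner_hrefl[OF assms] using p
    by (simp add: field_simps) (simp add: hden_def algebra_simps power2_eq_square)
  finally show ?thesis .
qed

lemma hrefl_hrefl:
  assumes "x \<in> hplane"
  shows "hrefl n c (hrefl n c x) = x"
proof -
  define D where "D = n \<bullet> n - c\<^sup>2"
  define l where "l = hden n c x"
  define h where "h = n \<bullet> x - c"
  have p: "l > 0" using assms hden_pos l_def by auto
  have D: "D > 0" using nc D_def by simp
  have 1: "hrefl n c x = (D *\<^sub>R x - (2 * h) *\<^sub>R n) /\<^sub>R l"
    unfolding hrefl_def D_def l_def h_def ..
  have 2: "hden n c (hrefl n c x) = D\<^sup>2 / l" using hden_hrefl[OF assms] D_def l_def by simp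
  have 3: "n \<bullet> hrefl n c x - c = - D * h / l" using inner_hrefl[OF assms] D_def l_def h_def by simp
  have "hrefl n c (hrefl n c x) = (D *\<^sub>R hrefl n c x - (2 * (n \<bullet> hrefl n c x - c)) *\<^sub>R n) /\<^sub>R hden n c (hrefl n c x)"
    unfolding hrefl_def[of n c "hrefl n c x"] D_def ..
  also have "\<dots> = (D *\<^sub>R ((D *\<^sub>R x - (2 * h) *\<^sub>R n) /\<^sub>R l) - (2 * (- D * h / l)) *\<^sub>R n) /\<^sub>R (D\<^sup>2 / l)"
    unfolding 2 3 unfolding 1 ..
  also have "\<dots> = x"
    using p D by (simp add: scaleR_diff_right scaleR_diff_left divide_inverse mult.assoc power2_eq_square mult.left_commute)
       (simp add: field_simps)
  finally show ?thesis .
qed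

lemma hrefl_eq_iff:
  assumes "x \<in> hplane"
  shows "hrefl n c x = x \<longleftrightarrow> n \<bullet> x = c"
proof
  assume "n \<bullet> x = c"
  then have "hden n c x = n \<bullet> n - c\<^sup>2" by (simp add: hden_def power2_eq_square)
  then show "hrefl n c x = x" using nc \<open>n \<bullet> x = c\<close> by (simp add: hrefl_def)
next
  assume *: "hrefl n c x = x"
  then have "n \<bullet> x - c = - (n \<bullet> n - c\<^sup>2) * (n \<bullet> x - c) / hden n c x" using inner_hrefl[OF assms] by simp
  moreover have "hden n c x > 0" using assms hden_pos by auto
  ultimately have "(n \<bullet> x - c) * (hden n c x + (n \<bullet> n - c\<^sup>2)) = 0" by (simp add: field_simps)
  then show "n \<bullet> x = c" using nc \<open>hden n c x > 0\<close> by simp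
qed

lemma bij_betw_hrefl: "bij_betw (hrefl n c) hplane hplane"
  by (rule bij_betw_byWitness[where f'="hrefl n c"]) (auto simp: hrefl_hrefl hrefl_in_hplane)

text \<open>The numerator is multiplied by \<open>k\<close> and the product under the root by the
  square of \<open>k\<close>, so the quotient is unchanged.\<close>

lemma hdist_hrefl:
  assumes "x \<in> hplane" "y \<in> hplane"
  shows "hdist (hrefl n c x) (hrefl n c y) = hdist x y"
proof -
  define D where "D = n \<bullet> n - c\<^sup>2"
  have p: "hden n c x > 0" "hden n c y > 0" "D > 0" using assms hden_pos nc D_def by auto
  have g: "lform x x > 0" "lform y y > 0" using assms by (auto simp: lform_def hplane_iff)
  have f: "hdist x y = arcosh (lform x y / sqrt (lform x x * lform y y))" for x y
    unfolding hdist_def lform_def ..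
  define k where "k = D\<^sup>2 / (hden n c x * hden n c y)"
  have k: "k > 0" using p k_def by simp
  have e: "D\<^sup>2 * lform x x / (hden n c x * hden n c x) * (D\<^sup>2 * lform y y / (hden n c y * hden n c y))
     = k\<^sup>2 * (lform x x * lform y y)" by (simp add: k_def power2_eq_square mult_ac)
  have "sqrt (D\<^sup>2 * lform x x / (hden n c x * hden n c x) * (D\<^sup>2 * lform y y / (hden n c y * hden n c y)))
     = D\<^sup>2 / (hden n c x * hden n c y) * sqrt (lform x x * lform y y)"
    unfolding e using k p by (simp add: real_sqrt_mult k_def)
  then have "lform (hrefl n c x) (hrefl n c y) / sqrt (lform (hrefl n c x) (hrefl n c x) * lform (hrefl n c y) (hrefl n c y))
     = lform x y / sqrt (lform x x * lform y y)"
    unfolding lform_hrefl[OF assms] lform_hrefl[OF assms(1) assms(1)] lform_hrefl[OF assms(2) assms(2)]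
      D_def[symmetric] using p g by (simp add: field_simps)
  then show ?thesis unfolding f by simp
qed

end

text \<open>Up to a factor this is the Lorentz product of the components of \<open>(1, a)\<close>
  and \<open>(1, d)\<close> orthogonal to \<open>(1, b)\<close>. Every term scales in the same way
  under \<open>lform_hrefl\<close>, hence angles are invariant.\<close>

lemma hmetric_lform:
  assumes "b \<in> hplane"
  shows "hmetric b (a - b) (d - b) = (lform a b * lform b d - lform a d * lform b b) / (lform b b)\<^sup>2"
proof -
  have "1 - b \<bullet> b > 0" using assms by (simp add: hplane_iff)
  then show ?thesis unfolding hmetric_def lform_def
    by (simp add: divide_simps power2_eq_square) (simp add: inner_diff inner_commute algebra_simps)
qed

lemma hangle_hrefl:
  assumes nc: "c\<^sup>2 < n \<bullet> n" and "x \<in> hplane" "y \<in> hplane" "z \<in> hplane"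
  shows "hangle (hrefl n c x) (hrefl n c y) (hrefl n c z) = hangle x y z"
proof -
  define D where "D = n \<bullet> n - c\<^sup>2"
  define s where "s u = D / hden n c u" for u
  note h = hrefl_in_hplane[OF nc]
  have p: "s x > 0" "s y > 0" "s z > 0" using assms hden_pos nc by (auto simp: s_def D_def)
  have g: "lform y y > 0" using assms by (auto simp: lform_def hplane_iff)
  have f: "lform (hrefl n c u) (hrefl n c v) = s u * s v * lform u v" if "u \<in> hplane" "v \<in> hplane" for u v
    using lform_hrefl[OF nc that] unfolding s_def D_def by (simp add: power2_eq_square)
  have m: "hmetric (hrefl n c y) (hrefl n c u - hrefl n c y) (hrefl n c v - hrefl n c y)
     = s u * s v / (s y)\<^sup>2 * hmetric y (u - y) (v - y)" if "u \<in> hplane" "v \<in> hplane" for u v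
    unfolding hmetric_lform[OF h[OF assms(3)]] hmetric_lform[OF assms(3)]
    using that assms f p g by (simp add: divide_simps power2_eq_square) (simp add: algebra_simps)
  define k where "k = s x * s z / (s y)\<^sup>2"
  have k: "k > 0" using p k_def by simp
  have "sqrt (s x * s x / (s y)\<^sup>2 * A * (s z * s z / (s y)\<^sup>2 * B)) = k * sqrt (A * B)" for A B
  proof -
    have "s x * s x / (s y)\<^sup>2 * A * (s z * s z / (s y)\<^sup>2 * B) = k\<^sup>2 * (A * B)"
      unfolding k_def by (simp add: power2_eq_square field_simps)
    then show ?thesis using k by (simp add: real_sqrt_mult)
  qed
  then have q: "sqrt (s x * s x / (s y)\<^sup>2 * A * (s z * s z / (s y)\<^sup>2 * B)) = k * sqrt (A * B)" for A B .
  have "hmetric (hrefl n c y) (hrefl n c x - hrefl n c y) (hrefl n c z - hrefl n c y) /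
      sqrt (hmetric (hrefl n c y) (hrefl n c x - hrefl n c y) (hrefl n c x - hrefl n c y) *
            hmetric (hrefl n c y) (hrefl n c z - hrefl n c y) (hrefl n c z - hrefl n c y))
    = k * hmetric y (x - y) (z - y) / (k * sqrt (hmetric y (x - y) (x - y) * hmetric y (z - y) (z - y)))"
    unfolding m[OF assms(2,4)] m[OF assms(2,2)] m[OF assms(4,4)] q unfolding k_def ..
  then show ?thesis unfolding hangle_def using k by simp
qed

lemma hangle_commute: "hangle a b d = hangle d b a"
  unfolding hangle_def hmetric_def by (simp add: inner_commute mult.commute)

lemma hdist_commute: "hdist a b = hdist b a"
  unfolding hdist_def by (simp add: inner_commute mult.commute)


lemma hplane_segment: "x \<in> hplane \<Longrightarrow> y \<in> hplane \<Longrightarrow> closed_segment x y \<subseteq> hplane"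
  using convex_hplane by (simp add: closed_segment_subset)

context
  fixes n :: complex and c :: real
  assumes nc: "c\<^sup>2 < n \<bullet> n"
begin

text \<open>The map is a quotient of affine functions with positive denominator, so a convex
  combination stays one; its weights are rescaled by the values of \<open>hden\<close>.\<close>

lemma hrefl_convex_comb:
  assumes "x \<in> hplane" "y \<in> hplane" "0 < t" "t < 1"
  shows "\<exists>s. 0 < s \<and> s < 1 \<and> hrefl n c ((1 - t) *\<^sub>R x + t *\<^sub>R y) = (1 - s) *\<^sub>R hrefl n c x + s *\<^sub>R hrefl n c y"
proof -
  define z where "z = (1 - t) *\<^sub>R x + t *\<^sub>R y"
  define s where "s = t * hden n c y / hden n c z"
  have p: "hden n c x > 0" "hden n c y > 0" using assms hden_pos[OF nc] by auto
  have l: "hden n c z = (1 - t) * hden n c x + t * hden n c y"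
    unfolding z_def hden_def by (simp add: inner_add algebra_simps)
  then have lz: "hden n c z > 0" using p assms by (simp add: add_pos_pos)
  have 1: "1 - s = (1 - t) * hden n c x / hden n c z" unfolding s_def using lz l by (simp add: field_simps)
  have s: "0 < s" "s < 1" using p assms lz 1 by (simp add: s_def, smt (verit) divide_pos_pos mult_pos_pos)
  have L: "hden n c w *\<^sub>R hrefl n c w = (n \<bullet> n - c\<^sup>2) *\<^sub>R w - (2 * (n \<bullet> w - c)) *\<^sub>R n" if "hden n c w > 0" for w
    using that unfolding hrefl_def by simp
  have "hden n c z *\<^sub>R hrefl n c z = ((1 - t) * hden n c x) *\<^sub>R hrefl n c x + (t * hden n c y) *\<^sub>R hrefl n c y"
    unfolding scaleR_scaleR[symmetric] L[OF p(1)] L[OF p(2)] L[OF lz] unfolding z_def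
    by (simp add: inner_add algebra_simps)
  then have "hrefl n c z = (((1 - t) * hden n c x) *\<^sub>R hrefl n c x + (t * hden n c y) *\<^sub>R hrefl n c y) /\<^sub>R hden n c z"
    using lz by (metis scaleR_scaleR left_inverse scaleR_one less_irrefl)
  also have "\<dots> = (1 - s) *\<^sub>R hrefl n c x + s *\<^sub>R hrefl n c y"
    unfolding 1 unfolding s_def by (simp add: scaleR_add_right divide_inverse mult.commute)
  finally show ?thesis using s unfolding z_def by blast
qed

lemma hrefl_inj: "x \<in> hplane \<Longrightarrow> y \<in> hplane \<Longrightarrow> hrefl n c x = hrefl n c y \<longleftrightarrow> x = y"
  by (metis hrefl_hrefl[OF nc])

lemma hrefl_image_hrefl: "S \<subseteq> hplane \<Longrightarrow> hrefl n c ` hrefl n c ` S = S"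
  using hrefl_hrefl[OF nc] by (force simp: image_image)

lemma hrefl_image_hplane: "S \<subseteq> hplane \<Longrightarrow> hrefl n c ` S \<subseteq> hplane"
  using hrefl_in_hplane[OF nc] by blast

lemma hrefl_open_segment_subset:
  assumes "x \<in> hplane" "y \<in> hplane"
  shows "hrefl n c ` open_segment x y \<subseteq> open_segment (hrefl n c x) (hrefl n c y)"
proof
  fix u assume "u \<in> hrefl n c ` open_segment x y"
  then obtain t where "x \<noteq> y" "0 < t" "t < 1" "u = hrefl n c ((1 - t) *\<^sub>R x + t *\<^sub>R y)"
    by (auto simp: in_segment)
  then show "u \<in> open_segment (hrefl n c x) (hrefl n c y)"
    using hrefl_convex_comb[OF assms, of t] hrefl_inj[OF assms] unfolding in_segment by auto
qed

lemma hrefl_open_segment: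
  assumes "x \<in> hplane" "y \<in> hplane"
  shows "hrefl n c ` open_segment x y = open_segment (hrefl n c x) (hrefl n c y)"
proof
  show "hrefl n c ` open_segment x y \<subseteq> open_segment (hrefl n c x) (hrefl n c y)"
    by (rule hrefl_open_segment_subset[OF assms])
  have h: "hrefl n c x \<in> hplane" "hrefl n c y \<in> hplane" using assms hrefl_in_hplane[OF nc] by auto
  have "open_segment (hrefl n c x) (hrefl n c y) \<subseteq> hplane"
    using hplane_segment[OF h] segment_open_subset_closed by blast
  then show "open_segment (hrefl n c x) (hrefl n c y) \<subseteq> hrefl n c ` open_segment x y"
    using hrefl_open_segment_subset[OF h] hrefl_hrefl[OF nc] assms
    by (metis image_mono hrefl_image_hrefl)
qed

lemma hrefl_closed_segment:
  assumes "x \<in> hplane" "y \<in> hplane"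
  shows "hrefl n c ` closed_segment x y = closed_segment (hrefl n c x) (hrefl n c y)"
  unfolding closed_segment_eq_open image_Un hrefl_open_segment[OF assms] by auto

lemma convex_hrefl_image:
  assumes "convex S" "S \<subseteq> hplane"
  shows "convex (hrefl n c ` S)"
  unfolding convex_contains_segment
proof (intro ballI)
  fix a b assume "a \<in> hrefl n c ` S" "b \<in> hrefl n c ` S"
  then obtain x y where xy: "x \<in> S" "y \<in> S" "a = hrefl n c x" "b = hrefl n c y" by blast
  then have "closed_segment a b = hrefl n c ` closed_segment x y"
    using hrefl_closed_segment[of x y] assms(2) by blast
  moreover have "closed_segment x y \<subseteq> S" using xy assms(1) by (simp add: closed_segment_subset)
  ultimately show "closed_segment a b \<subseteq> hrefl n c ` S" by blast
qed

lemma hrefl_convex_hull: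
  assumes "S \<subseteq> hplane"
  shows "hrefl n c ` (convex hull S) = convex hull (hrefl n c ` S)"
proof
  have *: "convex hull (hrefl n c ` S) \<subseteq> hrefl n c ` (convex hull S)" if "S \<subseteq> hplane" for S
  proof (rule hull_minimal)
    show "hrefl n c ` S \<subseteq> hrefl n c ` (convex hull S)" by (simp add: hull_subset image_mono)
    show "convex (hrefl n c ` (convex hull S))"
      by (rule convex_hrefl_image) (auto simp: convex_convex_hull hull_minimal that convex_hplane)
  qed
  show "convex hull (hrefl n c ` S) \<subseteq> hrefl n c ` (convex hull S)" using *[OF assms] .
  have "convex hull S \<subseteq> hrefl n c ` (convex hull (hrefl n c ` S))"
    using *[OF hrefl_image_hplane[OF assms]] hrefl_image_hrefl[OF assms] by simp
  moreover have "convex hull (hrefl n c ` S) \<subseteq> hplane"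
    by (rule hull_minimal) (auto simp: hrefl_image_hplane assms convex_hplane)
  ultimately show "hrefl n c ` (convex hull S) \<subseteq> convex hull (hrefl n c ` S)"
    by (metis image_mono hrefl_image_hrefl)
qed

lemma hrefl_face_of:
  assumes "F face_of S" "S \<subseteq> hplane"
  shows "(hrefl n c ` F) face_of (hrefl n c ` S)"
  unfolding face_of_def
proof (intro conjI ballI impI)
  have FS: "F \<subseteq> S" using assms face_of_imp_subset by blast
  show "hrefl n c ` F \<subseteq> hrefl n c ` S" using FS by blast
  show "convex (hrefl n c ` F)" using assms FS face_of_imp_convex convex_hrefl_image by blast
  fix a b x assume "a \<in> hrefl n c ` S" "b \<in> hrefl n c ` S" "x \<in> hrefl n c ` F" and xab: "x \<in> open_segment a b"
  then obtain a' b' x' where o: "a' \<in> S" "b' \<in> S" "x' \<in> F" "a = hrefl n c a'" "b = hrefl n c b'" "x = hrefl n c x'"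
    by blast
  then have "x \<in> hrefl n c ` open_segment a' b'" using xab hrefl_open_segment assms(2) by blast
  then obtain y where "y \<in> open_segment a' b'" "hrefl n c y = x" by blast
  moreover have "y \<in> hplane" using calculation o assms(2) hplane_segment segment_open_subset_closed by blast
  ultimately have "x' \<in> open_segment a' b'" using o FS assms(2) hrefl_inj by (metis subsetD)
  then have "a' \<in> F \<and> b' \<in> F" using assms(1) o unfolding face_of_def by blast
  then show "a \<in> hrefl n c ` F" "b \<in> hrefl n c ` F" using o by auto
qed

lemma continuous_hrefl: "continuous_on hplane (hrefl n c)"
  unfolding hrefl_def hden_def
  by (intro continuous_intros) (use hden_pos[OF nc] in \<open>force simp: hden_def\<close>)

lemma open_hrefl_image:
  assumes "open S" "S \<subseteq> hplane"
  shows "open (hrefl n c ` S)"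
proof -
  have "hrefl n c ` S = {x \<in> hplane. hrefl n c x \<in> S}"
    using assms hrefl_hrefl[OF nc] hrefl_in_hplane[OF nc] by (force simp: image_iff)
  also have "\<dots> = hplane \<inter> hrefl n c -` S" by auto
  finally show ?thesis
    using continuous_open_preimage[OF continuous_hrefl open_hplane assms(1)] by simp
qed

lemma hrefl_interior_subset: "S \<subseteq> hplane \<Longrightarrow> hrefl n c ` interior S \<subseteq> interior (hrefl n c ` S)"
  by (meson image_mono interior_maximal interior_subset open_interior open_hrefl_image order_trans)

lemma hreflection_hrefl:
  assumes "affine hull e = {x. n \<bullet> x = c}"
  shows "hreflection e (hrefl n c)"
  unfolding hreflection_def using bij_betw_hrefl[OF nc] hdist_hrefl[OF nc] hrefl_eq_iff[OF nc] assms by auto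

end

section \<open>The next vertex of a regular polygon\<close>

definition cross :: "complex \<Rightarrow> complex \<Rightarrow> real" where
  "cross u v = Re u * Im v - Im u * Re v"

lemma inner_Re_Im: "x \<bullet> y = Re x * Re y + Im x * Im y"
  by (simp add: inner_complex_def)

lemma inner_ii_mult: "(\<i> * u) \<bullet> v = cross u v"
  by (simp add: inner_Re_Im cross_def)

text \<open>\<open>arcosh\<close> is invertible only from 1 on; the reversed Cauchy-Schwarz
  inequality for the Lorentz product puts both quotients there. Squaring then removes the
  roots.\<close>

lemma hdist_eq_lform:
  assumes "x \<in> hplane" "y \<in> hplane" "z \<in> hplane" "hdist x y = hdist x z"
  shows "(lform x y)\<^sup>2 * lform z z = (lform x z)\<^sup>2 * lform y y"
proof -
  have g: "lform u u > 0" if "u \<in> hplane" for u using that by (auto simp: lform_def hplane_iff)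
  have ge: "(lform x u)\<^sup>2 \<ge> lform x x * lform u u" "lform x u > 0" if "u \<in> hplane" for u
  proof -
    have "x \<bullet> u \<le> norm x * norm u" by (rule norm_cauchy_schwarz)
    also have "\<dots> < 1" using that assms(1) unfolding hplane_def
      by (simp add: dist_norm) (smt (verit) mult_left_le_one_le norm_ge_zero)
    finally show "lform x u > 0" by (simp add: lform_def)
    have cs: "(x \<bullet> (u - x))\<^sup>2 \<le> (x \<bullet> x) * ((u - x) \<bullet> (u - x))" by (rule Cauchy_Schwarz_ineq)
    have "(lform x u)\<^sup>2 - lform x x * lform u u = ((x \<bullet> (u - x))\<^sup>2 + (1 - x \<bullet> x) * ((u - x) \<bullet> (u - x)))"
      unfolding lform_def by (simp add: inner_diff inner_commute algebra_simps power2_eq_square)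
    moreover have "(1 - x \<bullet> x) * ((u - x) \<bullet> (u - x)) \<ge> 0" using assms(1) by (simp add: hplane_iff)
    ultimately show "(lform x u)\<^sup>2 \<ge> lform x x * lform u u" by (smt (verit) zero_le_power2)
  qed
  have 1: "lform x u / sqrt (lform x x * lform u u) \<ge> 1" if "u \<in> hplane" for u
    using ge[OF that] g[OF that] g[OF assms(1)] by (simp add: real_le_lsqrt)
  have "arcosh (lform x y / sqrt (lform x x * lform y y)) = arcosh (lform x z / sqrt (lform x x * lform z z))"
    using assms(4) unfolding hdist_def lform_def by simp
  then have "lform x y / sqrt (lform x x * lform y y) = lform x z / sqrt (lform x x * lform z z)"
    using 1 assms by (metis cosh_arcosh_real)
  then have "(lform x y)\<^sup>2 / (lform x x * lform y y) = (lform x z)\<^sup>2 / (lform x x * lform z z)"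
    using g[OF assms(1)] g[OF assms(2)] g[OF assms(3)] by (metis power_divide real_sqrt_pow2 less_imp_le mult_pos_pos)
  then show ?thesis using g[OF assms(1)] g[OF assms(2)] g[OF assms(3)] by (simp add: field_simps)
qed

lemma hdist_eq_on_ray:
  assumes "b \<in> hplane" "b + t *\<^sub>R w \<in> hplane" "b + t' *\<^sub>R w \<in> hplane" "t > 0" "t' > 0" "w \<noteq> 0"
    and "hdist b (b + t *\<^sub>R w) = hdist b (b + t' *\<^sub>R w)"
  shows "t = t'"
proof (rule ccontr)
  assume "t \<noteq> t'"
  define g \<beta> \<omega> where "g = 1 - b \<bullet> b" and "\<beta> = b \<bullet> w" and "\<omega> = w \<bullet> w"
  have g: "g > 0" using assms(1) by (simp add: g_def hplane_iff)
  have w: "\<omega> > 0" using assms(6) by (simp add: \<omega>_def)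
  have l1: "lform b (b + s *\<^sub>R w) = g - s * \<beta>" for s
    by (simp add: lform_def g_def \<beta>_def inner_add algebra_simps)
  have l2: "lform (b + s *\<^sub>R w) (b + s *\<^sub>R w) = g - 2 * s * \<beta> - s\<^sup>2 * \<omega>" for s
    by (simp add: lform_def g_def \<beta>_def \<omega>_def inner_add inner_commute algebra_simps power2_eq_square)
  have pos: "g - 2 * t * \<beta> - t\<^sup>2 * \<omega> > 0" "g - 2 * t' * \<beta> - t'\<^sup>2 * \<omega> > 0"
    using assms(2,3) unfolding l2[symmetric] by (auto simp: hplane_iff lform_def)
  have "(g - t * \<beta>)\<^sup>2 * (g - 2 * t' * \<beta> - t'\<^sup>2 * \<omega>) = (g - t' * \<beta>)\<^sup>2 * (g - 2 * t * \<beta> - t\<^sup>2 * \<omega>)"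
    using hdist_eq_lform[OF assms(1,2,3,7)] unfolding l1 l2 .
  \<comment> \<open>The difference of the two sides factors. The last factor cannot vanish either,
    because \<open>b + t' w\<close> lies in the disc, which forces
    \<open>g > 2 * t' * \<beta>\<close>.\<close>
  then have "(\<beta>\<^sup>2 + g * \<omega>) * (t - t') * (g * (t + t') - 2 * t * t' * \<beta>) = 0"
    by (simp add: algebra_simps power2_eq_square)
  moreover have "\<beta>\<^sup>2 + g * \<omega> > 0" using g w by (simp add: add_nonneg_pos)
  ultimately have e: "g * (t + t') = 2 * t * t' * \<beta>" using \<open>t \<noteq> t'\<close> by auto
  then have b: "\<beta> > 0" using g assms(4,5)
    by (smt (verit) mult_pos_pos zero_less_mult_pos)
  have "t * g > 2 * t * t' * \<beta>"
  proof -
    have "g > 2 * t' * \<beta>" using pos(2) w assms(5) by (smt (verit) mult_nonneg_nonneg zero_le_power2)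
    then show ?thesis using assms(4) by (simp add: mult.assoc mult.left_commute)
  qed
  then show False using e g assms(5) by (smt (verit) distrib_left mult.commute mult_pos_pos)
qed

text \<open>Side length and angle leave two candidates, mirror images in the line through
  \<open>a\<close> and \<open>b\<close>, and the sign of the cross product picks one. The directions
  are compared as unit vectors of the metric at \<open>b\<close>; \<open>hdist_eq_on_ray\<close>
  then fixes the length.\<close>

lemma next_vertex_unique:
  assumes h: "a \<in> hplane" "b \<in> hplane" "x \<in> hplane" "y \<in> hplane" and "a \<noteq> b"
    and d: "hdist b x = hdist b y" and an: "hangle a b x = hangle a b y"
    and s: "cross (b - a) (x - b) * cross (b - a) (y - b) > 0"
  shows "x = y"
proof -
  define u v w where "u = a - b" and "v = x - b" and "w = y - b"
  have b1: "1 - b \<bullet> b > 0" using h by (simp add: hplane_iff)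
  define m where "m = hmetric b"
  have uvw: "u \<noteq> 0" "v \<noteq> 0" "w \<noteq> 0" using s \<open>a \<noteq> b\<close> by (auto simp: u_def v_def w_def cross_def)
  have mpos: "m z z > 0" if "z \<noteq> 0" for z
    unfolding m_def hmetric_def using b1 that by (intro add_pos_nonneg) auto
  have ladd: "m r (s *\<^sub>R z + s' *\<^sub>R z') = s * m r z + s' * m r z'" for r s z s' z'
    unfolding m_def hmetric_def by (simp add: inner_add algebra_simps add_divide_distrib)
  have sym: "m r z = m z r" for r z unfolding m_def hmetric_def by (simp add: inner_commute mult.commute)
  have sc: "m (s *\<^sub>R r) z = s * m r z" "m r (s *\<^sub>R z) = s * m r z" for s r z
    using ladd[of r s z 0 z] sym ladd[of z s r 0 r] by auto
  define v' w' where "v' = v /\<^sub>R sqrt (m v v)" and "w' = w /\<^sub>R sqrt (m w w)"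
  have r: "sqrt (m v v) > 0" "sqrt (m w w) > 0" "sqrt (m u u) > 0" using mpos uvw by auto
  have n: "m v' v' = 1" "m w' w' = 1" unfolding v'_def w'_def sc using r by (simp_all add: field_simps)
  have cs: "(m r z)\<^sup>2 \<le> m r r * m z z" for r z
  proof (cases "r = 0")
    case False
    have "0 \<le> m (m r r *\<^sub>R z + (- m r z) *\<^sub>R r) (m r r *\<^sub>R z + (- m r z) *\<^sub>R r)"
      using mpos by (cases "m r r *\<^sub>R z + (- m r z) *\<^sub>R r = 0") (auto simp: less_imp_le m_def hmetric_def)
    also have "\<dots> = m r r * (m r r * m z z - (m r z)\<^sup>2)"
      unfolding ladd unfolding sym[of "_ + _"] ladd by (simp add: sym[of z r] algebra_simps power2_eq_square)
    finally show ?thesis using mpos[OF False] by (simp add: zero_le_mult_iff)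
  qed (simp add: m_def hmetric_def)
  \<comment> \<open>Needed because \<open>arccos\<close> is injective only on the interval from -1
    to 1.\<close>
  have cs': "\<bar>m u z / sqrt (m u u * m z z)\<bar> \<le> 1" if "z \<noteq> 0" for z
    unfolding abs_square_le_1[symmetric] power_divide
    using cs[of u z] mpos[OF that] mpos[OF uvw(1)] by (simp add: less_imp_le)
  have "arccos (m u v / sqrt (m u u * m v v)) = arccos (m u w / sqrt (m u u * m w w))"
    using an unfolding hangle_def u_def v_def w_def m_def .
  then have "m u v / sqrt (m u u * m v v) = m u w / sqrt (m u u * m w w)"
    using cs'[OF uvw(2)] cs'[OF uvw(3)] by (metis arccos_eq_iff)
  then have "m u v' = m u w'" unfolding v'_def w'_def sc using r by (simp add: real_sqrt_mult field_simps)
  moreover define z where "z = v' - w'"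
  ultimately have uz: "m u z = 0" using ladd[of u 1 v' "-1" w'] by simp
  have vwz: "m (v' + w') z = 0"
  proof -
    have "m (v' + w') z = m v' v' - m w' w'"
      unfolding z_def using ladd[of "v' + w'" 1 v' "-1" w'] ladd[of v' 1 v' 1 w'] ladd[of w' 1 v' 1 w'] sym by simp
    then show ?thesis using n by simp
  qed
  have cr: "cross u v' * cross u w' > 0"
  proof -
    have "cross u (k *\<^sub>R z) = k * cross u z" for k z by (simp add: cross_def algebra_simps)
    then have "cross u v' * cross u w' = (cross u v * cross u w) / (sqrt (m v v) * sqrt (m w w))"
      unfolding v'_def w'_def by (simp add: divide_inverse mult_ac)
    moreover have "cross u v * cross u w = cross (b - a) (x - b) * cross (b - a) (y - b)"
      unfolding u_def v_def w_def cross_def by (simp add: algebra_simps)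
    ultimately show ?thesis using s r by simp
  qed
  have "z = 0"
  proof (rule ccontr)
    assume "z \<noteq> 0"
    \<comment> \<open>both \<open>u\<close> and \<open>v' + w'\<close> are orthogonal to \<open>z\<close>, hence parallel\<close>
    define f where "f = (z /\<^sub>R (1 - b \<bullet> b)) + ((b \<bullet> z) / (1 - b \<bullet> b)\<^sup>2) *\<^sub>R b"
    have f: "m r z = r \<bullet> f" for r unfolding m_def hmetric_def f_def
      by (simp add: inner_add inner_commute divide_inverse)
    have "f \<noteq> 0" using f[of z] mpos[OF \<open>z \<noteq> 0\<close>] by auto
    have "Re u * Re f + Im u * Im f = 0" "Re (v' + w') * Re f + Im (v' + w') * Im f = 0"
      using uz vwz f by (auto simp: inner_Re_Im)
    then have "cross u (v' + w') * Re f = 0" "cross u (v' + w') * Im f = 0"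
      unfolding cross_def by algebra+
    then have "cross u (v' + w') = 0" using \<open>f \<noteq> 0\<close> complex_eq_iff by auto
    then have "cross u v' + cross u w' = 0" by (simp add: cross_def algebra_simps)
    then show False using cr by (smt (verit) mult_minus_right zero_le_square mult_nonneg_nonneg minus_mult_left)
  qed
  then have "v' = w'" by (simp add: z_def)
  define t where "t = sqrt (m w w) / sqrt (m v v)"
  have "w = sqrt (m w w) *\<^sub>R v'" using r unfolding \<open>v' = w'\<close> by (simp add: w'_def)
  then have t: "t > 0" "w = t *\<^sub>R v" using r unfolding t_def v'_def by (auto simp: divide_inverse)
  have "1 = t"
  proof (rule hdist_eq_on_ray)
    show "b \<in> hplane" "b + 1 *\<^sub>R v \<in> hplane" "b + t *\<^sub>R v \<in> hplane" "v \<noteq> 0" "(0::real) < 1" "0 < t"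
      using h uvw t(1) unfolding t(2)[symmetric] by (auto simp: v_def w_def)
    show "hdist b (b + 1 *\<^sub>R v) = hdist b (b + t *\<^sub>R v)" using d unfolding t(2)[symmetric] by (simp add: v_def w_def)
  qed
  then show ?thesis using t by (simp add: v_def w_def)
qed

section \<open>Convex polygons\<close>

definition gside :: "(int \<Rightarrow> complex) \<Rightarrow> int \<Rightarrow> complex set" where
  "gside W i = closed_segment (W i) (W (i + 1))"

text \<open>Twice the signed area of the triangle formed by side \<open>i\<close> and
  \<open>x\<close>, positive to the left of the directed side.\<close>

definition eform :: "(int \<Rightarrow> complex) \<Rightarrow> int \<Rightarrow> complex \<Rightarrow> real" where
  "eform W i x = cross (W (i + 1) - W i) (x - W i)"

text \<open>Numbering the vertices by all integers with period \<open>p\<close> turns rotation and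
  reversal into plain reindexing and avoids a modular successor.\<close>

definition gon :: "nat \<Rightarrow> (int \<Rightarrow> complex) \<Rightarrow> complex set \<Rightarrow> bool" where
  "gon p W A \<longleftrightarrow> 3 \<le> p \<and> (\<forall>i j. W i = W j \<longleftrightarrow> i mod int p = j mod int p) \<and> range W \<subseteq> hplane \<and>
     A = convex hull (range W) \<and> {e. e edge_of A} = range (gside W)"

definition posgon :: "nat \<Rightarrow> (int \<Rightarrow> complex) \<Rightarrow> complex set \<Rightarrow> bool" where
  "posgon p W A \<longleftrightarrow> gon p W A \<and> (\<forall>i. \<forall>x\<in>A. 0 \<le> eform W i x)"

lemma eform_affine: "eform W i ((1 - t) *\<^sub>R x + t *\<^sub>R y) = (1 - t) * eform W i x + t * eform W i y"
  unfolding eform_def cross_def by (simp add: algebra_simps)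

text \<open>Multiplication by the imaginary unit is a quarter turn; it brings \<open>eform\<close>
  into the shape \<open>n \<bullet> x - c\<close> used for \<open>hrefl\<close>.\<close>

definition edge_normal :: "(int \<Rightarrow> complex) \<Rightarrow> int \<Rightarrow> complex" where
  "edge_normal W i = \<i> * (W (i + 1) - W i)"

definition edge_offset :: "(int \<Rightarrow> complex) \<Rightarrow> int \<Rightarrow> real" where
  "edge_offset W i = edge_normal W i \<bullet> W i"

lemma eform_inner: "eform W i x = edge_normal W i \<bullet> x - edge_offset W i"
  unfolding eform_def edge_normal_def edge_offset_def inner_ii_mult by (simp add: cross_def algebra_simps)

lemma continuous_eform [continuous_intros]: "continuous_on S (eform W i)"
  unfolding eform_def cross_def by (intro continuous_intros)

lemma eform_vertex [simp]: "eform W i (W i) = 0" "eform W i (W (i + 1)) = 0"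
  unfolding eform_def cross_def by simp_all

lemma gonD:
  assumes "gon p W A"
  shows "3 \<le> p" "\<forall>i j. W i = W j \<longleftrightarrow> i mod int p = j mod int p" "range W \<subseteq> hplane"
    "A = convex hull (range W)" "{e. e edge_of A} = range (gside W)"
  using assms unfolding gon_def by - (elim conjE, assumption)+

lemma gonI:
  assumes "3 \<le> p" "\<forall>i j. W i = W j \<longleftrightarrow> i mod int p = j mod int p" "range W \<subseteq> hplane"
    "A = convex hull (range W)" "{e. e edge_of A} = range (gside W)"
  shows "gon p W A"
  using assms unfolding gon_def by (intro conjI)

lemma gon_shift: "gon p W A \<Longrightarrow> gon p (\<lambda>i. W (k + i)) A"
proof -
  assume g: "gon p W A"
  have 1: "range (\<lambda>i. f (k + i)) = range f" for f :: "int \<Rightarrow> 'a"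
  proof -
    have "surj (\<lambda>i. k + i)" by (rule surjI[of _ "\<lambda>i. i - k"]) simp
    then have "range (f \<circ> (\<lambda>i. k + i)) = range f" by (simp only: image_comp[symmetric])
    then show ?thesis by (simp only: o_def)
  qed
  have "gside (\<lambda>i. W (k + i)) = (\<lambda>i. gside W (k + i))" by (auto simp: gside_def add.assoc)
  then have "range (gside (\<lambda>i. W (k + i))) = range (gside W)" using 1[of "gside W"] by simp
  moreover have "(k + i) mod int p = (k + j) mod int p \<longleftrightarrow> i mod int p = j mod int p" for i j
    by (simp add: mod_eq_dvd_iff)
  ultimately show ?thesis using gonD[OF g] by (intro gonI) (simp_all only: 1[of W], simp)
qed

lemma gon_rev: "gon p W A \<Longrightarrow> gon p (\<lambda>i. W (- i)) A"
proof -
  assume g: "gon p W A"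
  have 1: "range (\<lambda>i. f (- i)) = range f" for f :: "int \<Rightarrow> 'a"
  proof -
    have "surj (\<lambda>i. - i :: int)" by (rule surjI[of _ "\<lambda>i. - i"]) simp
    then have "range (f \<circ> (\<lambda>i. - i)) = range f" by (simp only: image_comp[symmetric])
    then show ?thesis by (simp only: o_def)
  qed
  have "gside (\<lambda>i. W (- i)) = (\<lambda>i. gside W (- 1 + - i))"
  proof
    fix i :: int
    have e: "- (i + 1) = - 1 + - i" "- 1 + - i + 1 = - i" by simp_all
    show "gside (\<lambda>i. W (- i)) i = gside W (- 1 + - i)"
      unfolding gside_def e by (rule closed_segment_commute)
  qed
  moreover have "range (\<lambda>i. gside W (- 1 + - i)) = range (gside W)"
  proof -
    have "surj (\<lambda>i. - 1 + - i :: int)" by (rule surjI[of _ "\<lambda>i. - 1 - i"]) simp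
    then have "range (gside W \<circ> (\<lambda>i. - 1 + - i)) = range (gside W)" by (simp only: image_comp[symmetric])
    then show ?thesis by (simp only: o_def)
  qed
  ultimately have "range (gside (\<lambda>i. W (- i))) = range (gside W)" by (simp only:)
  moreover have "(- i) mod int p = (- j) mod int p \<longleftrightarrow> i mod int p = j mod int p" for i j
  proof -
    have "int p dvd - i - - j \<longleftrightarrow> int p dvd - (i - j)" by (simp add: algebra_simps)
    then show ?thesis unfolding mod_eq_dvd_iff dvd_minus_iff .
  qed
  ultimately show ?thesis using gonD[OF g] by (intro gonI) (simp_all only: 1[of W], simp)
qed

lemma gside_cyclic:
  assumes "0 < p"
  shows "gside (\<lambda>i. v (nat (i mod int p))) i = side p v (nat (i mod int p))"
proof -
  have "int (Suc (nat (i mod int p)) mod p) = (i + 1) mod int p"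
    using assms by (simp add: zmod_int mod_add_left_eq add.commute mod_add_right_eq)
  then have "Suc (nat (i mod int p)) mod p = nat ((i + 1) mod int p)" by (metis nat_int)
  then show ?thesis unfolding gside_def side_def by simp
qed

lemma gon_of_cyclic:
  assumes "cyclic_vertices p v A"
  shows "gon p (\<lambda>i. v (nat (i mod int p))) A"
proof -
  define W where "W i = v (nat (i mod int p))" for i
  have p: "3 \<le> p" "inj_on v {..<p}" using assms unfolding cyclic_vertices_def by auto
  have n: "nat (i mod int p) < p" for i using p by (simp add: nat_less_iff)
  have r: "range (\<lambda>i. f (nat (i mod int p))) = f ` {..<p}" for f :: "nat \<Rightarrow> 'a"
  proof
    show "range (\<lambda>i. f (nat (i mod int p))) \<subseteq> f ` {..<p}" using n by auto
    show "f ` {..<p} \<subseteq> range (\<lambda>i. f (nat (i mod int p)))"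
    proof
      fix y assume "y \<in> f ` {..<p}"
      then obtain j where "j < p" "y = f j" by blast
      then show "y \<in> range (\<lambda>i. f (nat (i mod int p)))" by (intro image_eqI[of _ _ "int j"]) auto
    qed
  qed
  have "gside W = (\<lambda>i. side p v (nat (i mod int p)))"
    unfolding W_def using gside_cyclic p(1) by fastforce
  then have 2: "range (gside W) = side p v ` {..<p}" using r[of "side p v"] by simp
  have 3: "range W = v ` {..<p}" unfolding W_def by (rule r)
  have 4: "W i = W j \<longleftrightarrow> i mod int p = j mod int p" for i j
  proof -
    have "W i = W j \<longleftrightarrow> nat (i mod int p) = nat (j mod int p)"
      unfolding W_def using inj_on_eq_iff[OF p(2)] n by simp
    then show ?thesis using p by (simp add: nat_eq_iff)
  qed
  have "gon p W A" unfolding gon_def 2 3 using 4 assms p unfolding cyclic_vertices_def by blast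
  then show ?thesis unfolding W_def .
qed

lemma face_dim_eq: "F face_of A \<Longrightarrow> G face_of A \<Longrightarrow> aff_dim F = aff_dim G \<Longrightarrow> F \<subseteq> G \<Longrightarrow> F = G"
  by (metis face_of_aff_dim_lt face_of_imp_convex face_of_imp_subset face_of_subset order_less_irrefl)

lemma segment_eq_imp: "closed_segment a b = closed_segment c d \<Longrightarrow> {a, b} = {c, d :: complex}"
proof -
  assume "closed_segment a b = closed_segment c d"
  then have "x = a \<or> x = b \<longleftrightarrow> x = c \<or> x = d" for x using extreme_point_of_segment by metis
  then show ?thesis by blast
qed

text \<open>Both values are twice the signed area of the triangle of three successive vertices. This
  carries the orientation from one side to the next.\<close>

lemma turn_next: "eform W i (W (i + 2)) = eform W (i + 1) (W i)"
  unfolding eform_def cross_def by (simp add: algebra_simps)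

context
  fixes p W A assumes g: "gon p W A"
begin

lemma gon_p: "3 \<le> p" using g unfolding gon_def by simp

lemma W_eq: "W i = W j \<longleftrightarrow> i mod int p = j mod int p" using g unfolding gon_def by simp

lemma W_eq_dvd: "W i = W j \<longleftrightarrow> int p dvd i - j" using W_eq by (simp add: mod_eq_dvd_iff)

lemma small_dvd: "int p dvd k \<Longrightarrow> \<bar>k\<bar> < 3 \<Longrightarrow> k = 0"
  using gon_p zdvd_imp_le[of "int p" "\<bar>k\<bar>"] by (cases "k = 0") auto

lemma W_Suc: "W i \<noteq> W (i + 1)" "W i \<noteq> W (i + 2)"
  using small_dvd[of "i - (i + 1)"] small_dvd[of "i - (i + 2)"] unfolding W_eq_dvd by auto

lemma W_periodic: "W (i + int p) = W i" using W_eq by simp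

lemma A_hull: "A = convex hull (range W)" using g unfolding gon_def by simp

lemma finite_range_W: "finite (range W)"
proof -
  have "range W \<subseteq> W ` {0..<int p}"
  proof
    fix x assume "x \<in> range W"
    then obtain i where "x = W i" by blast
    then have "x = W (i mod int p)" using W_eq by simp
    moreover have "i mod int p \<in> {0..<int p}" using gon_p by simp
    ultimately show "x \<in> W ` {0..<int p}" by blast
  qed
  then show ?thesis using finite_subset by blast
qed

lemma gon_polytope: "polytope A" unfolding polytope_def using A_hull finite_range_W by blast

lemma gon_convex: "convex A" and gon_closed: "closed A"
  by (rule polytope_imp_convex[OF gon_polytope] polytope_imp_closed[OF gon_polytope])+

lemma W_in: "W i \<in> A" unfolding A_hull by (rule hull_inc) simp

lemma W_hplane: "W i \<in> hplane" using g unfolding gon_def image_subset_iff by simp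

lemma gon_hplane: "A \<subseteq> hplane"
  unfolding A_hull by (rule hull_minimal) (auto simp: W_hplane convex_hplane)

lemma edge_iff: "e edge_of A \<longleftrightarrow> (\<exists>i. e = gside W i)"
proof -
  have "{e. e edge_of A} = range (gside W)" using gonD(5)[OF g] .
  then have "e \<in> {e. e edge_of A} \<longleftrightarrow> e \<in> range (gside W)" by (rule arg_cong)
  then show ?thesis by (simp add: image_iff)
qed

lemma gside_edge: "gside W i edge_of A" using edge_iff by blast

lemma gside_face: "gside W i face_of A" and gside_aff_dim: "aff_dim (gside W i) = 1" and gside_subset: "gside W i \<subseteq> A"
  using gside_edge[of i] unfolding edge_of_def by (auto simp: face_of_imp_subset)

lemma gside_eq: "gside W i = gside W j \<longleftrightarrow> i mod int p = j mod int p"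
proof
  assume "gside W i = gside W j"
  then have "{W i, W (i + 1)} = {W j, W (j + 1)}" unfolding gside_def by (rule segment_eq_imp)
  then consider "W i = W j" | "W i = W (j + 1)" "W j = W (i + 1)" by (auto simp: doubleton_eq_iff)
  then show "i mod int p = j mod int p"
  proof cases
    case 2
    then have "int p dvd i - (j + 1)" "int p dvd j - (i + 1)" by (auto simp: W_eq_dvd)
    then have "int p dvd (i - (j + 1)) + (j - (i + 1))" by (rule dvd_add)
    then show ?thesis using small_dvd by fastforce
  qed (simp add: W_eq)
next
  assume "i mod int p = j mod int p"
  then have "W i = W j" "W (i + 1) = W (j + 1)" unfolding W_eq_dvd by (auto simp: mod_eq_dvd_iff)
  then show "gside W i = gside W j" unfolding gside_def by simp
qed

lemma gside_eq_dvd: "gside W i = gside W j \<longleftrightarrow> int p dvd i - j" using gside_eq by (simp add: mod_eq_dvd_iff)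

lemma gside_neq_Suc: "gside W i \<noteq> gside W (i + 1)"
  using small_dvd[of "i - (i + 1)"] unfolding gside_eq_dvd by auto

text \<open>In dimension one every side would be a face of full dimension, hence all of
  \<open>A\<close>, although successive sides differ.\<close>

lemma gon_aff_dim: "aff_dim A = 2"
proof (rule ccontr)
  assume "aff_dim A \<noteq> 2"
  moreover have "aff_dim A \<le> 2" using aff_dim_le_DIM[of A] by simp
  moreover have "1 \<le> aff_dim A" using aff_dim_subset[OF gside_subset[of 0]] gside_aff_dim[of 0] by simp
  ultimately have "aff_dim A = 1" by simp
  then have "gside W i = A" for i
    using face_dim_eq[OF gside_face[of i] face_of_refl[OF gon_convex]] gside_aff_dim gside_subset by simp
  then show False using gside_neq_Suc by metis
qed

lemma gon_affine_hull: "affine hull A = UNIV"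
  using gon_aff_dim aff_dim_eq_full[of A] by simp

lemma gon_interior_nonempty: "interior A \<noteq> {}"
proof -
  have "A \<noteq> {}" using W_in by blast
  then have "rel_interior A \<noteq> {}" using gon_convex rel_interior_eq_empty by blast
  then show ?thesis using rel_interior_interior[OF gon_affine_hull] by simp
qed

lemma gside_neq_A: "gside W i \<noteq> A" using gon_aff_dim gside_aff_dim by force

text \<open>Faces of a polytope are exposed. The supporting functional vanishes at both ends of the
  side, so in the plane it is a nonzero multiple of \<open>eform W i\<close>.\<close>

lemma eform_exposed:
  "A \<inter> {x. eform W i x = 0} = gside W i \<and> ((\<forall>x\<in>A. 0 \<le> eform W i x) \<or> (\<forall>x\<in>A. eform W i x \<le> 0))"
proof -
  have "gside W i exposed_face_of A"
    using exposed_face_of_polyhedron[OF polytope_imp_polyhedron[OF gon_polytope]] gside_face by blast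
  moreover have "gside W i \<noteq> {}" unfolding gside_def by simp
  ultimately obtain a b where ab: "a \<noteq> 0" "A \<subseteq> {x. a \<bullet> x \<le> b}" "gside W i = A \<inter> {x. a \<bullet> x = b}"
    using gside_neq_A unfolding exposed_face_of by blast
  define d where "d = W (i + 1) - W i"
  have d0: "d \<noteq> 0" using W_Suc(1)[of i] by (auto simp: d_def)
  have "W i \<in> gside W i" "W (i + 1) \<in> gside W i" unfolding gside_def by auto
  then have e: "a \<bullet> W i = b" "a \<bullet> W (i + 1) = b" using ab by auto
  then have ad: "a \<bullet> d = 0" unfolding d_def by (simp add: inner_diff)
  define k where "k = cross d a"
  have dd: "d \<bullet> d > 0" using d0 by simp
  have key: "(d \<bullet> d) * (a \<bullet> u) = k * cross d u" for u
    using ad unfolding k_def cross_def inner_Re_Im by algebra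
  have "k \<noteq> 0"
  proof
    assume "k = 0"
    then have "a \<bullet> a = 0" using key[of a] dd by simp
    then show False using ab by simp
  qed
  have L: "(d \<bullet> d) * (a \<bullet> x - b) = k * eform W i x" for x
    using key[of "x - W i"] e unfolding eform_def d_def by (simp add: inner_diff)
  have z: "eform W i x = 0 \<longleftrightarrow> a \<bullet> x = b" for x
    using L[of x] dd \<open>k \<noteq> 0\<close> by (metis mult_eq_0_iff right_minus_eq less_irrefl)
  have le: "k * eform W i x \<le> 0" if "x \<in> A" for x
    using L[of x] dd ab that by (smt (verit) mem_Collect_eq mult_nonneg_nonpos subsetD)
  have "(\<forall>x\<in>A. 0 \<le> eform W i x) \<or> (\<forall>x\<in>A. eform W i x \<le> 0)"
  proof (cases "k > 0")
    case True
    then have "\<forall>x\<in>A. eform W i x \<le> 0" using le by (meson mult_le_0_iff not_less)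
    then show ?thesis ..
  next
    case False
    then have "k < 0" using \<open>k \<noteq> 0\<close> by simp
    then have "\<forall>x\<in>A. 0 \<le> eform W i x" using le by (meson mult_le_0_iff not_less)
    then show ?thesis ..
  qed
  then show ?thesis using ab(3) z by auto
qed

lemma W_extreme: "W i extreme_point_of A"
  using extreme_point_of_face[OF gside_face[of i]] extreme_point_of_segment unfolding gside_def by blast

lemma extreme_iff: "x extreme_point_of A \<longleftrightarrow> (\<exists>i. x = W i)"
  using W_extreme extreme_point_of_convex_hull[of x "range W"] A_hull by auto

lemma W_in_gside: "W j \<in> gside W i \<longleftrightarrow> W j = W i \<or> W j = W (i + 1)"
proof
  assume "W j \<in> gside W i"
  then have "W j extreme_point_of (gside W i)" using extreme_point_of_face[OF gside_face[of i]] W_extreme by blast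
  then show "W j = W i \<or> W j = W (i + 1)" unfolding gside_def extreme_point_of_segment .
qed (auto simp: gside_def)

lemma eform_vertex_nonzero: "W j \<noteq> W i \<Longrightarrow> W j \<noteq> W (i + 1) \<Longrightarrow> eform W i (W j) \<noteq> 0"
  using eform_exposed[of i] W_in_gside W_in by blast

text \<open>\<open>A\<close> lies on one side of each line, so a single vertex off the line decides
  the sign: \<open>W (i + 2)\<close> for side \<open>i\<close> and \<open>W i\<close> for the next,
  with equal values by \<open>turn_next\<close>.\<close>

lemma orient_Suc: "(\<forall>x\<in>A. 0 \<le> eform W i x) \<longleftrightarrow> (\<forall>x\<in>A. 0 \<le> eform W (i + 1) x)"
proof -
  have "W (i + 2) \<noteq> W i" "W (i + 2) \<noteq> W (i + 1)" using W_Suc(2)[of i] W_Suc(1)[of "i + 1"] by (auto simp: add.assoc)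
  then have "eform W i (W (i + 2)) \<noteq> 0" using eform_vertex_nonzero by blast
  then show ?thesis using turn_next[of W i] eform_exposed[of i] eform_exposed[of "i + 1"] W_in by (metis order_antisym)
qed

lemma orient_const: "(\<forall>x\<in>A. 0 \<le> eform W i x) \<longleftrightarrow> (\<forall>x\<in>A. 0 \<le> eform W j x)"
proof -
  have *: "(\<forall>x\<in>A. 0 \<le> eform W (i + int k) x) \<longleftrightarrow> (\<forall>x\<in>A. 0 \<le> eform W i x)" for i k
  proof (induction k)
    case (Suc k)
    have "i + int (Suc k) = i + int k + 1" by simp
    then show ?case using Suc orient_Suc[of "i + int k"] by metis
  qed simp
  show ?thesis
  proof (cases "i \<le> j")
    case True then show ?thesis using *[of i "nat (j - i)"] by simp
  next
    case False then show ?thesis using *[of j "nat (i - j)"] by simp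
  qed
qed

text \<open>A common point that is not a vertex is interior to side \<open>i\<close>; the face
  property of side \<open>j\<close> then puts both ends of side \<open>i\<close> into side
  \<open>j\<close>.\<close>

lemma gside_inter:
  assumes "x \<in> gside W i" "x \<in> gside W j" "gside W i \<noteq> gside W j"
  shows "x \<in> range W"
proof (rule ccontr)
  assume "x \<notin> range W"
  then have "x \<in> open_segment (W i) (W (i + 1))" using assms(1) unfolding gside_def open_segment_def by auto
  then have "W i \<in> gside W j" "W (i + 1) \<in> gside W j" using gside_face[of j] assms(2) W_in unfolding face_of_def by blast+
  then have "gside W i \<subseteq> gside W j" unfolding gside_def by (simp add: closed_segment_subset)
  then show False using face_dim_eq[OF gside_face[of i] gside_face[of j]] gside_aff_dim assms(3) by simp
qed

lemma face_cases:
  assumes "F face_of A" "F \<noteq> A" "F \<noteq> {}"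
  shows "(\<exists>i. F = {W i}) \<or> (\<exists>i. F = gside W i)"
proof -
  have "aff_dim F < 2" using face_of_aff_dim_lt[OF gon_convex assms(1,2)] gon_aff_dim by simp
  moreover have "aff_dim F \<ge> 0" using assms(3) aff_dim_empty[of F] aff_dim_geq[of F] by linarith
  ultimately consider "aff_dim F = 0" | "aff_dim F = 1" by linarith
  then show ?thesis
  proof cases
    case 1
    then obtain a where "F = {a}" using aff_dim_eq_0 by blast
    then show ?thesis using assms(1) extreme_iff by (auto simp: face_of_singleton)
  next
    case 2
    then show ?thesis using assms(1) edge_iff unfolding edge_of_def by blast
  qed
qed

end

lemma eform_rev: "eform (\<lambda>i. W (- i)) i x = - eform W (- i - 1) x"
proof -
  have "- (i + 1) = - i - 1" "- i - 1 + 1 = - i" by simp_all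
  then show ?thesis unfolding eform_def cross_def by (simp only:) (simp add: algebra_simps)
qed

lemma eform_shift: "eform (\<lambda>i. W (k + i)) i x = eform W (k + i) x"
  unfolding eform_def by (simp add: add.assoc)

lemma gon_posgon:
  assumes "gon p W A"
  shows "posgon p W A \<or> posgon p (\<lambda>i. W (- i)) A"
proof (cases "\<forall>x\<in>A. 0 \<le> eform W 0 x")
  case True
  then show ?thesis using orient_const[OF assms] assms unfolding posgon_def by blast
next
  case False
  then have "\<not> (\<forall>x\<in>A. 0 \<le> eform W j x)" for j using orient_const[OF assms] by blast
  then have "\<forall>x\<in>A. eform W j x \<le> 0" for j using eform_exposed[OF assms, of j] by blast
  then show ?thesis unfolding posgon_def eform_rev using gon_rev[OF assms] by auto
qed

lemma posgon_shift: "posgon p W A \<Longrightarrow> posgon p (\<lambda>i. W (k + i)) A"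
  unfolding posgon_def eform_shift using gon_shift by blast

context
  fixes p W A assumes pg: "posgon p W A"
begin

lemma pg_gon: "gon p W A" using pg unfolding posgon_def by simp

lemma eform_nonneg: "x \<in> A \<Longrightarrow> 0 \<le> eform W i x" using pg unfolding posgon_def by blast

lemma eform_zero: "x \<in> A \<Longrightarrow> eform W i x = 0 \<longleftrightarrow> x \<in> gside W i" using eform_exposed[OF pg_gon, of i] by blast

lemma eform_interior: "x \<in> interior A \<Longrightarrow> 0 < eform W i x"
  using face_of_disjoint_interior[OF gside_face[OF pg_gon, of i]] gside_neq_A[OF pg_gon] eform_zero eform_nonneg interior_subset
  by (metis disjoint_iff order_le_less subsetD)

lemma eform_vertex_pos: "W j \<noteq> W i \<Longrightarrow> W j \<noteq> W (i + 1) \<Longrightarrow> 0 < eform W i (W j)"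
  using eform_vertex_nonzero[OF pg_gon] eform_nonneg W_in[OF pg_gon] by (metis order_le_less)

lemma turn_pos: "0 < eform W i (W (i + 2))"
  using eform_vertex_pos[of "i + 2" i] W_Suc(2)[OF pg_gon, of i] W_Suc(1)[OF pg_gon, of "i + 1"]
  by (simp add: add.assoc)

text \<open>A segment from an interior point to a point outside leaves \<open>A\<close> through some
  side, and the form of that side, being positive at the start and zero at the exit, is negative at
  the end.\<close>

lemma in_gon_iff: "x \<in> A \<longleftrightarrow> (\<forall>i. 0 \<le> eform W i x)"
proof
  assume *: "\<forall>i. 0 \<le> eform W i x"
  show "x \<in> A"
  proof (rule ccontr)
    assume "x \<notin> A"
    obtain z where z: "z \<in> interior A" using gon_interior_nonempty[OF pg_gon] by blast
    have "closed_segment z x \<inter> frontier A \<noteq> {}"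
      by (rule connected_Int_frontier) (use z \<open>x \<notin> A\<close> interior_subset in auto)
    then obtain y where y: "y \<in> closed_segment z x" "y \<in> frontier A" by blast
    have "rel_frontier A = frontier A"
      unfolding rel_frontier_def frontier_def using rel_interior_interior[OF gon_affine_hull[OF pg_gon]] by simp
    moreover have "polyhedron A" using polytope_imp_polyhedron[OF gon_polytope[OF pg_gon]] .
    ultimately obtain F where F: "F facet_of A" "y \<in> F" using y(2) rel_frontier_of_polyhedron by blast
    then have "F edge_of A" unfolding facet_of_def edge_of_def using gon_aff_dim[OF pg_gon] by simp
    then obtain i where i: "F = gside W i" using edge_iff[OF pg_gon] by blast
    have yA: "y \<in> A" using y(2) gon_closed[OF pg_gon] frontier_subset_closed by blast
    then have "eform W i y = 0" using F i eform_zero by blast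
    obtain t where t: "0 \<le> t" "t \<le> 1" "y = (1 - t) *\<^sub>R z + t *\<^sub>R x" using y(1) by (auto simp: in_segment)
    have "t \<noteq> 1" using t yA \<open>x \<notin> A\<close> by auto
    then have "(1 - t) * eform W i z > 0" using eform_interior[OF z] t by simp
    moreover have "t * eform W i x \<ge> 0" using * t by simp
    ultimately have "eform W i y > 0" unfolding t(3) eform_affine by simp
    then show False using \<open>eform W i y = 0\<close> by simp
  qed
qed (use eform_nonneg in blast)

lemma eform_mod: "eform W i x = eform W (i mod int p) x"
proof -
  have "W i = W (i mod int p)" "W (i + 1) = W (i mod int p + 1)"
    unfolding W_eq[OF pg_gon] by (simp_all add: mod_add_left_eq)
  then show ?thesis unfolding eform_def by simp
qed

lemma eform_all_iff: "(\<forall>i. P (eform W i x)) \<longleftrightarrow> (\<forall>i\<in>{0..<int p}. P (eform W i x))"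
proof
  assume *: "\<forall>i\<in>{0..<int p}. P (eform W i x)"
  show "\<forall>i. P (eform W i x)"
  proof
    fix i
    have "i mod int p \<in> {0..<int p}" using gon_p[OF pg_gon] by simp
    then have "P (eform W (i mod int p) x)" using * by blast
    then show "P (eform W i x)" using eform_mod[of i x] by simp
  qed
qed blast

lemma interior_iff: "x \<in> interior A \<longleftrightarrow> (\<forall>i. 0 < eform W i x)"
proof
  assume *: "\<forall>i. 0 < eform W i x"
  define S where "S = (\<Inter>i\<in>{0..<int p}. {x. 0 < eform W i x})"
  have "open {x. 0 < eform W i x}" for i by (intro open_Collect_less continuous_intros)
  then have "open S" unfolding S_def by (intro open_INT) auto
  moreover have "S \<subseteq> A"
  proof
    fix y assume "y \<in> S"
    then have "\<forall>i\<in>{0..<int p}. 0 \<le> eform W i y" unfolding S_def by (simp add: less_imp_le)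
    then show "y \<in> A" using in_gon_iff eform_all_iff[of "\<lambda>r. 0 \<le> r"] by blast
  qed
  moreover have "x \<in> S" unfolding S_def using * by blast
  ultimately show "x \<in> interior A" by (meson interiorI)
qed (use eform_interior in blast)

text \<open>Only the sides through \<open>x\<close> restrict a small neighbourhood: the finitely
  many other forms are positive at \<open>x\<close> and stay so nearby.\<close>

lemma local_cone:
  assumes "x \<in> A"
  obtains eps where "eps > 0"
    "\<And>y. y \<in> ball x eps \<Longrightarrow> (\<And>i. eform W i x = 0 \<Longrightarrow> 0 < eform W i y) \<Longrightarrow> y \<in> interior A"
proof -
  define S where "S = (\<Inter>i\<in>{i\<in>{0..<int p}. eform W i x \<noteq> 0}. {x. 0 < eform W i x})"
  have "open {x. 0 < eform W i x}" for i by (intro open_Collect_less continuous_intros)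
  then have "open S" unfolding S_def by (intro open_INT) (auto intro: finite_subset[of _ "{0..<int p}"])
  moreover have "x \<in> S" unfolding S_def using eform_nonneg[OF assms] by (auto simp: order_less_le)
  ultimately obtain eps where eps: "eps > 0" "ball x eps \<subseteq> S" using open_contains_ball by blast
  have "y \<in> interior A" if "y \<in> ball x eps" "\<And>i. eform W i x = 0 \<Longrightarrow> 0 < eform W i y" for y
  proof -
    have "y \<in> S" using that eps by blast
    then have "\<forall>i\<in>{0..<int p}. 0 < eform W i y" using that(2) unfolding S_def by blast
    then show ?thesis using interior_iff eform_all_iff[of "\<lambda>r. 0 < r"] by blast
  qed
  then show ?thesis using that eps by blast
qed

end

section \<open>Neighbouring tiles and connectedness\<close>

definition rgon :: "nat \<Rightarrow> real \<Rightarrow> real \<Rightarrow> (int \<Rightarrow> complex) \<Rightarrow> complex set \<Rightarrow> bool" where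
  "rgon p s \<alpha> W A \<longleftrightarrow> posgon p W A \<and> (\<forall>i. hdist (W i) (W (i + 1)) = s) \<and>
     (\<forall>i. hangle (W i) (W (i + 1)) (W (i + 2)) = \<alpha>)"

lemma rgon_shift: "rgon p s \<alpha> W A \<Longrightarrow> rgon p s \<alpha> (\<lambda>i. W (k + i)) A"
  unfolding rgon_def using posgon_shift by (simp add: add.assoc[symmetric])

lemma gon_rgon:
  assumes g: "gon p W A" and d: "\<And>i. hdist (W i) (W (i + 1)) = s"
    and a: "\<And>i. hangle (W i) (W (i + 1)) (W (i + 2)) = \<alpha>"
  shows "\<exists>W. rgon p s \<alpha> W A"
  using gon_posgon[OF g]
proof
  assume "posgon p W A"
  then show ?thesis using d a unfolding rgon_def by blast
next
  assume *: "posgon p (\<lambda>i. W (- i)) A"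
  have "hdist (W (- i)) (W (- (i + 1))) = s" for i
    using d[of "- (i + 1)"] by (simp add: hdist_commute)
  moreover have "hangle (W (- i)) (W (- (i + 1))) (W (- (i + 2))) = \<alpha>" for i
    using a[of "- (i + 2)"] by (simp add: hangle_commute add.commute)
  ultimately have "rgon p s \<alpha> (\<lambda>i. W (- i)) A" using * unfolding rgon_def by blast
  then show ?thesis by blast
qed

lemma regular_rgon:
  assumes "regular_polygon p s \<alpha> A"
  shows "\<exists>W. rgon p s \<alpha> W A"
proof -
  obtain v where v: "cyclic_vertices p v A"
    "\<And>i. i < p \<Longrightarrow> hdist (v i) (v (Suc i mod p)) = s"
    "\<And>i. i < p \<Longrightarrow> hangle (v i) (v (Suc i mod p)) (v (Suc (Suc i) mod p)) = \<alpha>"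
    using assms unfolding regular_polygon_def by blast
  define W where "W i = v (nat (i mod int p))" for i
  have g: "gon p W A" using gon_of_cyclic[OF v(1)] unfolding W_def .
  have p: "3 \<le> p" using gon_p[OF g] .
  have W1: "W (i + int k) = v ((nat (i mod int p) + k) mod p)" for i k
  proof -
    have "int ((nat (i mod int p) + k) mod p) = (i + int k) mod int p"
      using p by (simp add: zmod_int mod_add_left_eq)
    then show ?thesis unfolding W_def by (metis nat_int)
  qed
  have n: "nat (i mod int p) < p" for i using p by (simp add: nat_less_iff)
  have W0: "W i = v (nat (i mod int p))" for i unfolding W_def ..
  have d: "hdist (W i) (W (i + 1)) = s" for i
    using v(2)[OF n, of i] W1[of i 1] W0[of i] by simp
  have a: "hangle (W i) (W (i + 1)) (W (i + 2)) = \<alpha>" for i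
    using v(3)[OF n, of i] W1[of i 1] W1[of i 2] W0[of i] by simp
  show ?thesis by (rule gon_rgon[OF g d a])
qed

text \<open>Both polygons turn left at every vertex, so \<open>next_vertex_unique\<close> extends
  the agreement from one side to the next.\<close>

lemma rgon_unique:
  assumes U: "rgon p s \<alpha> U A" and V: "rgon p s \<alpha> V B" and "U 0 = V 0" "U 1 = V 1"
  shows "A = B"
proof -
  have gU: "posgon p U A" and gV: "posgon p V B" using U V unfolding rgon_def by auto
  note g = pg_gon[OF gU] pg_gon[OF gV]
  have *: "U (int k) = V (int k) \<and> U (int k + 1) = V (int k + 1)" for k
  proof (induction k)
    case (Suc k)
    have "U (int k + 2) = V (int k + 2)"
    proof (rule next_vertex_unique)
      show "U (int k) \<in> hplane" "U (int k + 1) \<in> hplane" "U (int k + 2) \<in> hplane" "V (int k + 2) \<in> hplane"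
        using W_hplane g by blast+
      show "U (int k) \<noteq> U (int k + 1)" using W_Suc[OF g(1)] by blast
      have "hdist (U (int k + 1)) (U (int k + 1 + 1)) = s" "hdist (V (int k + 1)) (V (int k + 1 + 1)) = s"
        using U V unfolding rgon_def by blast+
      then show "hdist (U (int k + 1)) (U (int k + 2)) = hdist (U (int k + 1)) (V (int k + 2))"
        using Suc by (simp add: add.assoc)
      show "hangle (U (int k)) (U (int k + 1)) (U (int k + 2)) = hangle (U (int k)) (U (int k + 1)) (V (int k + 2))"
        using U V Suc unfolding rgon_def by metis
      have "0 < eform U (int k) (U (int k + 2))" "0 < eform V (int k) (V (int k + 2))"
        using turn_pos gU gV by blast+
      then have "0 < cross (U (int k + 1) - U (int k)) (U (int k + 2) - U (int k + 1))"
        "0 < cross (V (int k + 1) - V (int k)) (V (int k + 2) - V (int k + 1))"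
        unfolding eform_def cross_def by (simp_all add: algebra_simps)
      then show "cross (U (int k + 1) - U (int k)) (U (int k + 2) - U (int k + 1)) *
          cross (U (int k + 1) - U (int k)) (V (int k + 2) - U (int k + 1)) > 0"
        using Suc by simp
    qed
    then show ?case using Suc by (simp add: add.commute)
  qed (use assms in simp)
  have "U i = V i" for i
  proof -
    have "U i = U (int (nat (i mod int p)))" "V i = V (int (nat (i mod int p)))"
      using W_eq[OF g(1)] W_eq[OF g(2)] gon_p[OF g(1)] by simp_all
    then show ?thesis using * by metis
  qed
  then have "U = V" by blast
  then show ?thesis using A_hull g by metis
qed

text \<open>Both polygons run counterclockwise, so congruent ones traversing a common side in the same
  direction coincide.\<close>

lemma rgon_share:
  assumes U: "rgon p s \<alpha> U A" and V: "rgon p s \<alpha> V B" and e: "gside U j = gside V k" and "A \<noteq> B"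
  shows "V k = U (j + 1)" "V (k + 1) = U j"
proof -
  have g: "gon p U A" using U pg_gon unfolding rgon_def by blast
  have "{U j, U (j + 1)} = {V k, V (k + 1)}" using segment_eq_imp e unfolding gside_def by blast
  moreover have "\<not> (U j = V k \<and> U (j + 1) = V (k + 1))"
    using rgon_unique[OF rgon_shift[OF U, of j] rgon_shift[OF V, of k]] \<open>A \<noteq> B\<close> by auto
  ultimately show "V k = U (j + 1)" "V (k + 1) = U j" by (auto simp: doubleton_eq_iff)
qed

lemma line_form:
  fixes a b n :: complex
  assumes "a \<noteq> b" "n \<bullet> a = c" "n \<bullet> b = c" "n \<noteq> 0"
  shows "\<exists>k. k \<noteq> 0 \<and> (\<forall>y. n \<bullet> y - c = k * cross (b - a) (y - a))"
proof -
  define d where "d = b - a"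
  have dd: "d \<bullet> d > 0" using assms(1) by (simp add: d_def)
  have nd: "n \<bullet> d = 0" using assms by (simp add: d_def inner_diff)
  define k where "k = cross d n / (d \<bullet> d)"
  have key: "(d \<bullet> d) * (n \<bullet> u) = cross d n * cross d u" for u
    using nd unfolding cross_def inner_Re_Im by algebra
  have "cross d n \<noteq> 0"
  proof
    assume "cross d n = 0"
    then have "n \<bullet> n = 0" using key[of n] dd by simp
    then show False using assms by simp
  qed
  moreover have "n \<bullet> y - c = k * cross (b - a) (y - a)" for y
    using key[of "y - a"] dd assms(2) unfolding k_def d_def by (simp add: inner_diff field_simps)
  ultimately show ?thesis using dd unfolding k_def by (intro exI[of _ "cross d n / (d \<bullet> d)"]) auto
qed

lemma gside_hrefl:
  assumes "c\<^sup>2 < n \<bullet> n" "gon p W A"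
  shows "gside (\<lambda>i. hrefl n c (W i)) i = hrefl n c ` gside W i"
  unfolding gside_def using hrefl_closed_segment[OF assms(1)] W_hplane[OF assms(2)] by simp

text \<open>The harder half is that the image has no further edges. Reflected back, such an edge is
  a face of \<open>A\<close>; it is not \<open>A\<close>, since an edge has empty interior, and not
  a single vertex, so it is a side.\<close>

lemma gon_hrefl:
  assumes nc: "c\<^sup>2 < n \<bullet> n" and g: "gon p W A"
  shows "gon p (\<lambda>i. hrefl n c (W i)) (hrefl n c ` A)"
proof (rule gonI)
  let ?r = "hrefl n c"
  have Ah: "A \<subseteq> hplane" using gon_hplane[OF g] .
  show "3 \<le> p" by (rule gonD[OF g])
  show "\<forall>i j. ?r (W i) = ?r (W j) \<longleftrightarrow> i mod int p = j mod int p"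
    using hrefl_inj[OF nc] W_hplane[OF g] W_eq[OF g] by simp
  show "range (\<lambda>i. ?r (W i)) \<subseteq> hplane" using hrefl_in_hplane[OF nc] W_hplane[OF g] by blast
  show "?r ` A = convex hull (range (\<lambda>i. ?r (W i)))"
    using hrefl_convex_hull[OF nc gonD(3)[OF g]] A_hull[OF g] by (simp add: image_image)
  note gside = gside_hrefl[OF nc g]
  have 1: "gside (\<lambda>i. ?r (W i)) i edge_of ?r ` A" for i
    unfolding edge_of_def
  proof
    show "gside (\<lambda>i. ?r (W i)) i face_of ?r ` A"
      unfolding gside by (rule hrefl_face_of[OF nc gside_face[OF g] Ah])
    have "?r (W i) \<noteq> ?r (W (i + 1))" using hrefl_inj[OF nc] W_hplane[OF g] W_Suc[OF g] by simp
    then show "aff_dim (gside (\<lambda>i. ?r (W i)) i) = 1"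
      unfolding gside_def segment_convex_hull aff_dim_convex_hull by simp
  qed
  have 2: "e \<in> range (gside (\<lambda>i. ?r (W i)))" if "e edge_of ?r ` A" for e
  proof -
    have e: "e face_of ?r ` A" "aff_dim e = 1" using that unfolding edge_of_def by auto
    then have "e \<subseteq> ?r ` A" by (simp add: face_of_imp_subset)
    then have eh: "e \<subseteq> hplane" using hrefl_image_hplane[OF nc Ah] by blast
    have "?r ` e face_of ?r ` ?r ` A" by (rule hrefl_face_of[OF nc e(1) hrefl_image_hplane[OF nc Ah]])
    then have f: "?r ` e face_of A" using hrefl_image_hrefl[OF nc Ah] by simp
    have re: "?r ` ?r ` e = e" by (rule hrefl_image_hrefl[OF nc eh])
    have "?r ` e \<noteq> A"
    proof
      assume "?r ` e = A"
      then have "e = ?r ` A" using re by simp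
      then have "?r ` interior A \<subseteq> interior e" using hrefl_interior_subset[OF nc Ah] by simp
      then have "interior e \<noteq> {}" using gon_interior_nonempty[OF g] by blast
      then have "aff_dim e = 2" using aff_dim_nonempty_interior[of e] by simp
      then show False using e by simp
    qed
    moreover have "?r ` e \<noteq> {}" using e(2) by auto
    moreover have "?r ` e \<noteq> {W i}" for i
    proof
      assume "?r ` e = {W i}"
      then have "e = {?r (W i)}" using re by simp
      then show False using e(2) by simp
    qed
    ultimately obtain i where "?r ` e = gside W i" using face_cases[OF g f] by blast
    then have "e = gside (\<lambda>i. ?r (W i)) i" unfolding gside using re by simp
    then show ?thesis by blast
  qed
  show "{e. e edge_of ?r ` A} = range (gside (\<lambda>i. ?r (W i)))" using 1 2 by blast
qed

lemma rgon_hrefl: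
  assumes nc: "c\<^sup>2 < n \<bullet> n" and W: "rgon p s \<alpha> W A"
  shows "\<exists>U. rgon p s \<alpha> U (hrefl n c ` A)"
proof -
  have g: "gon p W A" using W pg_gon unfolding rgon_def by blast
  show ?thesis
    by (rule gon_rgon[OF gon_hrefl[OF nc g]])
      (use W hdist_hrefl[OF nc] hangle_hrefl[OF nc] W_hplane[OF g] in \<open>auto simp: rgon_def\<close>)
qed

text \<open>The inequality says that the line has distance less than one from 0, that is, meets the
  open disc; the line of a side does so at \<open>W i\<close>.\<close>

lemma edge_offset_less:
  assumes g: "gon p W A"
  shows "(edge_offset W i)\<^sup>2 < edge_normal W i \<bullet> edge_normal W i"
proof -
  let ?n = "edge_normal W i"
  have "?n \<noteq> 0" using W_Suc(1)[OF g, of i] by (auto simp: edge_normal_def)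
  then have n0: "?n \<bullet> ?n > 0" by simp
  have "(edge_offset W i)\<^sup>2 \<le> (?n \<bullet> ?n) * (W i \<bullet> W i)"
    unfolding edge_offset_def by (rule Cauchy_Schwarz_ineq)
  also have "\<dots> < ?n \<bullet> ?n" using n0 W_hplane[OF g, of i] by (simp add: hplane_iff)
  finally show ?thesis .
qed

lemma eform_toward: "eform W i x = 0 \<Longrightarrow> eform W i (x + t *\<^sub>R (z - x)) = t * eform W i z"
  unfolding eform_def cross_def by (simp add: algebra_simps) algebra

lemma point_toward:
  fixes x z :: complex
  assumes "eps > 0"
  obtains t where "0 < t" "t < 1" "x + t *\<^sub>R (z - x) \<in> ball x eps" "x + (- t) *\<^sub>R (z - x) \<in> ball x eps"
proof -
  define N where "N = norm (z - x) + 1"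
  define t where "t = min (1/2) (eps / (2 * N))"
  have N: "N > 0" "norm (z - x) < N" unfolding N_def by (auto simp: add_nonneg_pos)
  have t: "0 < t" "t < 1" "t \<le> eps / (2 * N)" using assms N unfolding t_def by auto
  have "t * norm (z - x) < t * N" using t N by simp
  also have "\<dots> \<le> eps / 2" using t(3) N by (simp add: field_simps)
  also have "\<dots> < eps" using assms by simp
  finally have "t * norm (z - x) < eps" .
  then show ?thesis using that t by (auto simp: dist_norm)
qed

section \<open>Tilings: neighbours across an edge and connectedness\<close>

locale htiling =
  fixes p q :: nat and s \<alpha> :: real and T :: "complex set set"
  assumes reg: "\<And>A. A \<in> T \<Longrightarrow> regular_polygon p s \<alpha> A"
    and cover: "\<Union>T = hplane"
    and disj: "\<And>A B. A \<in> T \<Longrightarrow> B \<in> T \<Longrightarrow> A \<noteq> B \<Longrightarrow> interior A \<inter> interior B = {}"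
    and inter: "\<And>A B. A \<in> T \<Longrightarrow> B \<in> T \<Longrightarrow> (A \<inter> B) face_of A"
    and locfin: "\<And>K. compact K \<Longrightarrow> K \<subseteq> hplane \<Longrightarrow> finite {A \<in> T. A \<inter> K \<noteq> {}}"
    and card_vertex: "\<And>A x. A \<in> T \<Longrightarrow> x extreme_point_of A \<Longrightarrow> card {B \<in> T. x \<in> B} = q"
begin

lemma tile_rgon: "A \<in> T \<Longrightarrow> \<exists>W. rgon p s \<alpha> W A" using reg regular_rgon by blast

lemma tile_posgon: "A \<in> T \<Longrightarrow> \<exists>W. posgon p W A" using tile_rgon unfolding rgon_def by blast

lemma tile_hplane: "A \<in> T \<Longrightarrow> A \<subseteq> hplane" using cover by blast

lemma tile_closed: "A \<in> T \<Longrightarrow> closed A" using tile_posgon pg_gon gon_closed by blast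

lemma tile_convex: "A \<in> T \<Longrightarrow> convex A" using tile_posgon pg_gon gon_convex by blast

lemma tile_interior: "A \<in> T \<Longrightarrow> interior A \<noteq> {}" using tile_posgon pg_gon gon_interior_nonempty by blast

lemma inter2: "A \<in> T \<Longrightarrow> B \<in> T \<Longrightarrow> (A \<inter> B) face_of B" using inter[of B A] by (simp add: Int_commute)

lemma inter_proper:
  assumes "A \<in> T" "B \<in> T" "A \<noteq> B"
  shows "A \<inter> B \<noteq> A"
proof
  assume "A \<inter> B = A"
  then have "A \<subseteq> B" by blast
  then have "interior A \<subseteq> interior B" by (rule interior_mono)
  then show False using disj[OF assms] tile_interior[OF assms(1)] by blast
qed

text \<open>Finitely many tiles meet a closed disc around \<open>a\<close>; those that avoid
  \<open>a\<close> form a closed set and keep a positive distance from \<open>a\<close>.\<close>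

lemma local_tiles:
  assumes "a \<in> hplane"
  obtains eps where "eps > 0" "ball a eps \<subseteq> hplane" "\<And>y B. y \<in> ball a eps \<Longrightarrow> B \<in> T \<Longrightarrow> y \<in> B \<Longrightarrow> a \<in> B"
proof -
  obtain r where r: "r > 0" "cball a r \<subseteq> hplane" using open_contains_cball open_hplane assms by metis
  define F where "F = {A \<in> T. A \<inter> cball a r \<noteq> {}}"
  have "finite F" unfolding F_def by (rule locfin) (use r in auto)
  then have "finite {A \<in> F. a \<notin> A}" by simp
  then have "closed (\<Union>{A \<in> F. a \<notin> A})"
    by (rule closed_Union) (auto simp: F_def tile_closed)
  moreover have "a \<notin> \<Union>{A \<in> F. a \<notin> A}" by blast
  ultimately obtain \<delta> where d: "\<delta> > 0" "ball a \<delta> \<inter> \<Union>{A \<in> F. a \<notin> A} = {}"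
    by (metis (no_types, lifting) ComplI Compl_disjoint2 disjoint_eq_subset_Compl open_Compl openE)
  show ?thesis
  proof
    show "min r \<delta> > 0" using r d by simp
    show "ball a (min r \<delta>) \<subseteq> hplane" using r(2) by auto
    fix y B assume y: "y \<in> ball a (min r \<delta>)" "B \<in> T" "y \<in> B"
    then have "y \<in> cball a r" by auto
    then have "B \<in> F" unfolding F_def using y by blast
    then show "a \<in> B" using d(2) y by auto
  qed
qed

text \<open>A point just beyond the midpoint of the side is covered by another tile, which also
  contains the midpoint if the point is close enough. The common face then contains a relatively
  interior point of the side, so it is the side.\<close>

lemma neighbour_exists:
  assumes A: "A \<in> T" and W: "posgon p W A"
  shows "\<exists>B\<in>T. B \<noteq> A \<and> A \<inter> B = gside W i"
proof -
  note g = pg_gon[OF W]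
  define x where "x = midpoint (W i) (W (i + 1))"
  have x: "x \<in> open_segment (W i) (W (i + 1))" unfolding x_def using W_Suc[OF g] by simp
  then have xs: "x \<in> gside W i" using segment_open_subset_closed unfolding gside_def by blast
  have xA: "x \<in> A" using xs gside_subset[OF g] by blast
  have xnW: "x \<noteq> W k" for k using x xs W_in_gside[OF g, of k i] unfolding open_segment_def by auto
  have x0: "eform W i x = 0" using eform_zero[OF W xA] xs by blast
  have xh: "x \<in> hplane" using xA tile_hplane A by blast
  obtain eps where e: "eps > 0" "ball x eps \<subseteq> hplane" "\<And>y B. y \<in> ball x eps \<Longrightarrow> B \<in> T \<Longrightarrow> y \<in> B \<Longrightarrow> x \<in> B"
    using local_tiles[OF xh] by metis
  obtain z where z: "z \<in> interior A" using tile_interior A by blast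
  obtain t where t: "0 < t" "x + (- t) *\<^sub>R (z - x) \<in> ball x eps" using point_toward[of eps x z] e by metis
  define y where "y = x + (- t) *\<^sub>R (z - x)"
  have "eform W i y < 0" unfolding y_def eform_toward[OF x0] using t eform_interior[OF W z, of i] by simp
  then have "y \<notin> A" using eform_nonneg[OF W] by (meson not_less)
  moreover have "y \<in> hplane" using e t unfolding y_def by blast
  ultimately obtain B where B: "B \<in> T" "y \<in> B" "B \<noteq> A" using cover by blast
  then have "x \<in> B" using e(3) t unfolding y_def by blast
  have "(\<exists>k. A \<inter> B = {W k}) \<or> (\<exists>k. A \<inter> B = gside W k)"
    using face_cases[OF g inter[OF A B(1)]] inter_proper[OF A B(1)] B(3) xA \<open>x \<in> B\<close> by blast
  then obtain k where k: "A \<inter> B = gside W k" using xA \<open>x \<in> B\<close> xnW by blast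
  then have "x \<in> gside W k" using xA \<open>x \<in> B\<close> by blast
  then have "gside W k = gside W i" using gside_inter[OF g \<open>x \<in> gside W k\<close> xs] xnW by blast
  then show ?thesis using k B by blast
qed

lemma share_edge_iff:
  assumes "A \<in> T" "B \<in> T" "posgon p W A"
  shows "share_edge A B \<longleftrightarrow> A \<noteq> B \<and> (\<exists>i. A \<inter> B = gside W i)"
  unfolding share_edge_def edge_iff[OF pg_gon[OF assms(3)]]
  using inter2[OF assms(1,2)] gside_aff_dim[OF pg_gon[OF assms(3)]] unfolding edge_of_def by metis

lemma share_edge_sym: "share_edge A B \<Longrightarrow> share_edge B A"
  unfolding share_edge_def by (simp add: Int_commute) blast

lemma edge_two_tiles:
  assumes T: "A \<in> T" "B \<in> T" and AB: "share_edge A B"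
    and U: "rgon p s \<alpha> U C" and e: "(A \<inter> B) edge_of C"
  shows "C = A \<or> C = B"
proof (rule ccontr)
  assume *: "\<not> (C = A \<or> C = B)"
  obtain W where W: "rgon p s \<alpha> W A" using tile_rgon T by blast
  obtain V where V: "rgon p s \<alpha> V B" using tile_rgon T by blast
  have g: "gon p W A" "gon p V B" "gon p U C" using W V U pg_gon unfolding rgon_def by auto
  obtain i j k where ijk: "A \<inter> B = gside W i" "A \<inter> B = gside V j" "A \<inter> B = gside U k"
    using AB e unfolding share_edge_def edge_iff[OF g(1)] edge_iff[OF g(2)] edge_iff[OF g(3)] by blast
  have "A \<noteq> B" using AB unfolding share_edge_def by blast
  then have "V j = W (i + 1)" "U k = W (i + 1)" "V j = U (k + 1)"
    using rgon_share[OF W V] rgon_share[OF W U] rgon_share[OF U V] * ijk by metis+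
  then show False using W_Suc[OF g(3)] by metis
qed

lemma neighbour_unique:
  assumes T: "A \<in> T" "B \<in> T" "C \<in> T" and AB: "share_edge A B" and AC: "share_edge A C" and e: "A \<inter> B = A \<inter> C"
  shows "B = C"
proof -
  obtain U where "rgon p s \<alpha> U C" using tile_rgon T by blast
  then show ?thesis using edge_two_tiles[OF T(1,2) AB] AC e unfolding share_edge_def by metis
qed

text \<open>The image keeps the common edge, so by \<open>edge_two_tiles\<close> it is
  \<open>A\<close> or \<open>B\<close>; it is not \<open>A\<close>, since interior points change
  sides.\<close>

lemma hrefl_neighbour:
  assumes T: "A \<in> T" "B \<in> T" and AB: "share_edge A B"
    and nc: "c\<^sup>2 < n \<bullet> n" and e: "A \<inter> B \<subseteq> {x. n \<bullet> x = c}"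
  shows "hrefl n c ` A = B"
proof -
  let ?r = "hrefl n c"
  obtain W where W: "rgon p s \<alpha> W A" using tile_rgon T by blast
  obtain U where U: "rgon p s \<alpha> U (?r ` A)" using rgon_hrefl[OF nc W] by blast
  have pW: "posgon p W A" using W unfolding rgon_def by blast
  note gW = pg_gon[OF pW]
  obtain i where i: "A \<inter> B = gside W i" using share_edge_iff[OF T pW] AB by blast
  have on: "n \<bullet> W i = c" "n \<bullet> W (i + 1) = c" using e i unfolding gside_def by auto
  have "?r (W i) = W i" "?r (W (i + 1)) = W (i + 1)"
    using hrefl_eq_iff[OF nc W_hplane[OF gW], of i] hrefl_eq_iff[OF nc W_hplane[OF gW], of "i + 1"] on by blast+
  then have "gside W i = ?r ` gside W i"
    unfolding gside_def using hrefl_closed_segment[OF nc W_hplane[OF gW] W_hplane[OF gW], of i "i + 1"] by (simp only:)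
  also have "\<dots> = gside (\<lambda>i. ?r (W i)) i" by (rule gside_hrefl[OF nc gW, symmetric])
  also have "\<dots> edge_of ?r ` A" by (rule gside_edge[OF gon_hrefl[OF nc gW]])
  finally have "(A \<inter> B) edge_of ?r ` A" unfolding i .
  moreover have "?r ` A \<noteq> A"
  proof
    assume *: "?r ` A = A"
    have "n \<noteq> 0" using nc by auto
    then obtain k where k: "k \<noteq> 0" "\<And>y. n \<bullet> y - c = k * eform W i y"
      using line_form[OF W_Suc(1)[OF gW, of i] on] unfolding eform_def by blast
    obtain z where z: "z \<in> interior A" using tile_interior T by blast
    then have zA: "z \<in> A" and zh: "z \<in> hplane" using interior_subset tile_hplane T by blast+
    define m where "m = (n \<bullet> n - c\<^sup>2) / hden n c z"
    have m: "m > 0" unfolding m_def using nc hden_pos[OF nc zh] by simp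
    have "k * eform W i (?r z) = k * (- m * eform W i z)"
    proof -
      have "- a * (k * l) / b = k * (- (a / b) * l)" for a b l :: real by simp
      then show ?thesis using inner_hrefl[OF nc zh] unfolding k(2) m_def by (simp only:)
    qed
    then have "eform W i (?r z) = - m * eform W i z" unfolding mult_left_cancel[OF k(1)] .
    then have "eform W i (?r z) < 0" using m eform_interior[OF pW z, of i] by simp
    moreover have "0 \<le> eform W i (?r z)" using eform_nonneg[OF pW] * zA by blast
    ultimately show False by simp
  qed
  ultimately show ?thesis using edge_two_tiles[OF T AB U] by blast
qed

text \<open>Near a point \<open>x\<close> of \<open>S\<close> every tile contains \<open>x\<close>,
  so the relation spreads locally and then along the connected set \<open>S\<close>. Choosing
  \<open>S\<close> without vertices makes any two different tiles that meet in \<open>S\<close>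
  adjacent.\<close>

lemma tiles_connected:
  assumes F: "F \<subseteq> T" and S: "connected S" "S \<subseteq> hplane" "S \<subseteq> \<Union>F"
    and trans: "\<And>A B C. R A B \<Longrightarrow> R B C \<Longrightarrow> R A C"
    and R: "\<And>A B x. A \<in> F \<Longrightarrow> B \<in> F \<Longrightarrow> x \<in> A \<Longrightarrow> x \<in> B \<Longrightarrow> x \<in> S \<Longrightarrow> R A B"
    and AB: "A \<in> F" "B \<in> F" "A \<inter> S \<noteq> {}" "B \<inter> S \<noteq> {}"
  shows "R A B"
proof -
  obtain a b where ab: "a \<in> A" "a \<in> S" "b \<in> B" "b \<in> S" using AB by blast
  have "\<forall>C\<in>F. b \<in> C \<longrightarrow> R A C"
  proof (rule connected_induction_simple[OF S(1) ab(2,4), where P = "\<lambda>x. \<forall>C\<in>F. x \<in> C \<longrightarrow> R A C"])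
    show "\<forall>C\<in>F. a \<in> C \<longrightarrow> R A C" using R AB(1) ab by blast
    fix x assume x: "x \<in> S"
    then obtain eps where e: "eps > 0" "\<And>y B. y \<in> ball x eps \<Longrightarrow> B \<in> T \<Longrightarrow> y \<in> B \<Longrightarrow> x \<in> B"
      using local_tiles[of x] S(2) by (metis subsetD)
    show "\<exists>U. openin (top_of_set S) U \<and> x \<in> U \<and>
        (\<forall>y\<in>U. \<forall>z\<in>U. (\<forall>C\<in>F. y \<in> C \<longrightarrow> R A C) \<longrightarrow> (\<forall>C\<in>F. z \<in> C \<longrightarrow> R A C))"
    proof (intro exI[of _ "S \<inter> ball x eps"] conjI ballI impI)
      show "openin (top_of_set S) (S \<inter> ball x eps)" by (simp add: openin_open_Int)
      show "x \<in> S \<inter> ball x eps" using x e by simp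
      fix y z C assume yz: "y \<in> S \<inter> ball x eps" "z \<in> S \<inter> ball x eps" "\<forall>C\<in>F. y \<in> C \<longrightarrow> R A C" "C \<in> F" "z \<in> C"
      obtain D where D: "D \<in> F" "y \<in> D" using yz S(3) by blast
      then have "x \<in> D" "x \<in> C" using e(2) yz F by blast+
      then have "R D C" using R D yz x by blast
      then show "R A C" using yz D trans by blast
    qed
  qed
  then show ?thesis using ab AB by blast
qed

lemma countable_T: "countable T"
proof -
  have "countable (interior ` T)"
    by (rule countable_disjoint_open_subsets) (use disj in \<open>auto simp: pairwise_def disjnt_def\<close>)
  moreover have "inj_on interior T"
    using disj tile_interior by (metis Int_absorb inj_onI)
  ultimately show ?thesis by (rule countable_image_inj_on)
qed

definition verts :: "complex set" where
  "verts = {x. \<exists>A\<in>T. x extreme_point_of A}"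

lemma inter_share_edge:
  assumes "A \<in> T" "B \<in> T" "A \<noteq> B" "x \<in> A" "x \<in> B" "A \<inter> B \<noteq> {x}"
  shows "share_edge A B"
proof -
  obtain W where W: "posgon p W A" using tile_posgon assms by blast
  have "(\<exists>k. A \<inter> B = {W k}) \<or> (\<exists>k. A \<inter> B = gside W k)"
    using face_cases[OF pg_gon[OF W] inter[OF assms(1,2)]] inter_proper[OF assms(1-3)] assms by blast
  moreover have "A \<inter> B \<noteq> {W k}" for k using assms(4-6) by (metis IntI singletonD)
  ultimately show ?thesis using share_edge_iff[OF assms(1,2) W] assms(3) by blast
qed

definition adj :: "complex set \<Rightarrow> complex set \<Rightarrow> bool" where
  "adj A B \<longleftrightarrow> A \<in> T \<and> B \<in> T \<and> share_edge A B"

lemma countable_verts: "countable verts"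
proof -
  have "countable {x. x extreme_point_of A}" if A: "A \<in> T" for A
  proof -
    obtain W where W: "posgon p W A" using tile_posgon[OF A] by blast
    have "{x. x extreme_point_of A} = range W" using extreme_iff[OF pg_gon[OF W]] by blast
    then show ?thesis using finite_range_W[OF pg_gon[OF W]] countable_finite by simp
  qed
  moreover have "verts = (\<Union>A\<in>T. {x. x extreme_point_of A})" unfolding verts_def by blast
  ultimately show ?thesis using countable_T by auto
qed

lemma tile_nonvertex:
  assumes A: "A \<in> T"
  shows "A \<inter> (hplane - verts) \<noteq> {}"
proof
  assume "A \<inter> (hplane - verts) = {}"
  moreover obtain z e where "0 < e" "ball z e \<subseteq> A" using tile_interior[OF A] by (metis mem_interior ex_in_conv)
  ultimately show False
    using countable_subset[OF _ countable_verts, of "ball z e"] uncountable_ball[of e z] tile_hplane[OF A] by blast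
qed

text \<open>There are only countably many vertices, and a disc stays connected without them. Away
  from the vertices, different tiles that meet share an edge.\<close>

lemma all_connected:
  assumes "A \<in> T" "B \<in> T"
  shows "adj\<^sup>*\<^sup>* A B"
proof (rule tiles_connected[where F = T and S = "hplane - verts"])
  have "connected hplane" unfolding hplane_def by simp
  then show "connected (hplane - verts)"
    using connected_open_diff_countable[of hplane verts] open_hplane countable_verts by simp
  show "hplane - verts \<subseteq> \<Union>T" using cover by blast
  fix A B x assume A: "A \<in> T" "B \<in> T" "x \<in> A" "x \<in> B" "x \<in> hplane - verts"
  have "A \<inter> B \<noteq> {x}" using A inter[OF A(1,2)] face_of_singleton unfolding verts_def by fastforce
  then show "adj\<^sup>*\<^sup>* A B" using inter_share_edge[OF A(1,2)] A unfolding adj_def by (cases "A = B") auto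
next
  show "A \<inter> (hplane - verts) \<noteq> {}" "B \<inter> (hplane - verts) \<noteq> {}"
    using assms tile_nonvertex by blast+
qed (use assms in \<open>auto intro: rtranclp_trans\<close>)

end

section \<open>Walls and the tiling distance\<close>

context htiling
begin

definition wall :: "complex \<Rightarrow> real \<Rightarrow> bool" where
  "wall n c \<longleftrightarrow> c\<^sup>2 < n \<bullet> n \<and> (\<exists>e\<in>tiling_edges T. e \<subseteq> {x. n \<bullet> x = c})"

text \<open>For a wall, \<open>wall_no_cross\<close> makes the negation mean that the tile lies in
  the opposite closed half plane.\<close>

definition side_of :: "complex \<Rightarrow> real \<Rightarrow> complex set \<Rightarrow> bool" where
  "side_of n c B \<longleftrightarrow> (\<forall>x\<in>B. c \<le> n \<bullet> x)"

lemma wall_less: "wall n c \<Longrightarrow> c\<^sup>2 < n \<bullet> n"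
  unfolding wall_def by blast

lemma edge_tiling_edges: "A \<in> T \<Longrightarrow> gon p W A \<Longrightarrow> gside W i \<in> tiling_edges T"
  unfolding tiling_edges_def using gside_edge by blast

lemma adj_sym: "adj A B \<Longrightarrow> adj B A"
  unfolding adj_def using share_edge_sym by blast

lemma adj_edge: "adj A B \<Longrightarrow> gon p W A \<Longrightarrow> \<exists>i. A \<inter> B = gside W i"
  using edge_iff unfolding adj_def share_edge_def by blast

lemma neighbour_adj:
  assumes "A \<in> T" "gon p W A"
  shows "\<exists>B. adj A B \<and> A \<inter> B = gside W i"
proof -
  obtain V where V: "posgon p V A" using tile_posgon assms by blast
  obtain j where "gside W i = gside V j" using edge_iff[OF pg_gon[OF V]] gside_edge[OF assms(2)] by blast
  moreover obtain B where B: "B \<in> T" "B \<noteq> A" "A \<inter> B = gside V j" using neighbour_exists[OF assms(1) V] by blast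
  moreover have "share_edge A B" using share_edge_iff[OF assms(1) B(1) V] B by metis
  ultimately show ?thesis unfolding adj_def using assms by auto
qed

text \<open>The reflection maps the tile at the defining edge to its neighbour. From there the claim
  spreads along chains of adjacent tiles, because a congruent polygon on an edge of a tile is that
  tile or its neighbour.\<close>

lemma hrefl_tile:
  assumes w: "wall n c" and B: "B \<in> T"
  shows "hrefl n c ` B \<in> T"
proof -
  let ?r = "hrefl n c"
  note nc = wall_less[OF w]
  obtain e A where A: "A \<in> T" "e edge_of A" "e \<subseteq> {x. n \<bullet> x = c}"
    using w unfolding wall_def tiling_edges_def by blast
  obtain W where W: "posgon p W A" using tile_posgon A by blast
  obtain i where i: "e = gside W i" using edge_iff[OF pg_gon[OF W]] A by blast
  obtain A' where A': "adj A A'" "A \<inter> A' = gside W i" using neighbour_adj[OF A(1) pg_gon[OF W]] by blast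
  have rA: "?r ` A = A'" using hrefl_neighbour[OF A(1) _ _ nc, of A'] A' A i unfolding adj_def by auto
  have "adj\<^sup>*\<^sup>* A B" using all_connected A B by blast
  then show ?thesis
  proof (induction rule: rtranclp_induct)
    case base
    then show ?case using rA A' unfolding adj_def by simp
  next
    case (step B C)
    have BC: "B \<in> T" "C \<in> T" "share_edge B C" using step unfolding adj_def by auto
    obtain V where V: "gon p V B" using tile_posgon pg_gon BC by blast
    obtain X where X: "rgon p s \<alpha> X C" using tile_rgon BC by blast
    have gX: "gon p X C" using X pg_gon unfolding rgon_def by blast
    obtain j k where jk: "B \<inter> C = gside V j" "B \<inter> C = gside X k"
      using BC unfolding share_edge_def edge_iff[OF V] edge_iff[OF gX] by blast
    obtain N where N: "adj (?r ` B) N" "?r ` B \<inter> N = gside (\<lambda>i. ?r (V i)) j"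
      using neighbour_adj[OF step(3) gon_hrefl[OF nc V]] by blast
    have NT: "N \<in> T" using N unfolding adj_def by blast
    obtain U where U: "rgon p s \<alpha> U (?r ` C)" using rgon_hrefl[OF nc X] by blast
    have "?r ` B \<inter> N = gside (\<lambda>i. ?r (X i)) k"
      unfolding N(2) gside_hrefl[OF nc V] gside_hrefl[OF nc gX] using jk by simp
    then have "?r ` C = ?r ` B \<or> ?r ` C = N"
      using edge_two_tiles[OF step(3) NT _ U] N(1) gside_edge[OF gon_hrefl[OF nc gX]] unfolding adj_def by simp
    moreover have "?r ` B \<noteq> ?r ` C"
      using BC hrefl_image_hrefl[OF nc tile_hplane] unfolding share_edge_def by metis
    ultimately have "?r ` C = N" by blast
    then show ?case using NT by simp
  qed
qed

lemma hrefl_hrefl_tile: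
  assumes "wall n c" "B \<in> T"
  shows "hrefl n c ` hrefl n c ` B = B"
  using hrefl_image_hrefl tile_hplane assms unfolding wall_def by blast

lemma hrefl_adj:
  assumes w: "wall n c" and a: "adj B C"
  shows "adj (hrefl n c ` B) (hrefl n c ` C)"
proof -
  let ?r = "hrefl n c"
  note nc = wall_less[OF w]
  have BC: "B \<in> T" "C \<in> T" "B \<noteq> C" using a unfolding adj_def share_edge_def by auto
  have rT: "?r ` B \<in> T" "?r ` C \<in> T" using hrefl_tile[OF w] BC by auto
  have ne: "?r ` B \<noteq> ?r ` C" using BC hrefl_hrefl_tile[OF w] by metis
  obtain V where V: "posgon p V B" using tile_posgon BC by blast
  obtain j where j: "B \<inter> C = gside V j" using adj_edge[OF a pg_gon[OF V]] by blast
  have g: "gon p (\<lambda>i. ?r (V i)) (?r ` B)" using gon_hrefl[OF nc pg_gon[OF V]] .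
  have "inj_on ?r hplane" using hrefl_inj[OF nc] by (simp add: inj_on_def)
  then have "?r ` B \<inter> ?r ` C = ?r ` (B \<inter> C)"
    using tile_hplane[OF BC(1)] tile_hplane[OF BC(2)] by (metis inj_on_image_Int)
  also have "\<dots> = gside (\<lambda>i. ?r (V i)) j"
    unfolding j by (rule gside_hrefl[OF nc pg_gon[OF V], symmetric])
  finally have "(?r ` B \<inter> ?r ` C) edge_of ?r ` B" using gside_edge[OF g] by simp
  then have "share_edge (?r ` B) (?r ` C)"
    using ne inter2[OF rT] unfolding share_edge_def edge_of_def by blast
  then show ?thesis unfolding adj_def using rT by blast
qed

lemma edge_wall:
  assumes A: "A \<in> T" and g: "gon p W A"
  shows "wall (edge_normal W i) (edge_offset W i)"
proof -
  have "gside W i \<subseteq> {x. edge_normal W i \<bullet> x = edge_offset W i}"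
    using eform_exposed[OF g, of i] unfolding eform_inner by auto
  then show ?thesis unfolding wall_def using edge_offset_less[OF g] edge_tiling_edges[OF A g] by blast
qed

end

lemma cross_zero_param:
  assumes "d \<noteq> 0" "cross d (x - a) = 0"
  obtains u where "x = a + u *\<^sub>R d"
proof -
  define u where "u = (d \<bullet> (x - a)) / (d \<bullet> d)"
  have dd: "d \<bullet> d \<noteq> 0" using assms(1) by simp
  have "(d \<bullet> d) *\<^sub>R (x - a) = (d \<bullet> (x - a)) *\<^sub>R d"
    using assms(2) unfolding cross_def inner_Re_Im by (simp add: complex_eq_iff) algebra
  then have "x - a = u *\<^sub>R d" using dd unfolding u_def
    by (metis (no_types) divide_inverse inverse_inverse_eq left_inverse mult.commute scaleR_one scaleR_scaleR)
  then have "x = a + u *\<^sub>R d" by (simp add: algebra_simps)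
  then show ?thesis by (rule that)
qed

lemma affine_hull_line:
  fixes a b n :: complex
  assumes "a \<noteq> b" "n \<bullet> a = c" "n \<bullet> b = c" "n \<noteq> 0"
  shows "affine hull {a, b} = {x. n \<bullet> x = c}"
proof
  show "affine hull {a, b} \<subseteq> {x. n \<bullet> x = c}"
    by (rule hull_minimal) (use assms affine_hyperplane in auto)
  show "{x. n \<bullet> x = c} \<subseteq> affine hull {a, b}"
  proof
    fix x assume "x \<in> {x. n \<bullet> x = c}"
    moreover obtain k where "k \<noteq> 0" and k: "\<And>y. n \<bullet> y - c = k * cross (b - a) (y - a)"
      using line_form[OF assms] by blast
    ultimately have cr: "cross (b - a) (x - a) = 0" using k[of x] by simp
    obtain u where "x = a + u *\<^sub>R (b - a)" using cross_zero_param[OF _ cr] assms(1) by auto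
    then have "x = (1 - u) *\<^sub>R a + u *\<^sub>R b" by (simp add: algebra_simps)
    then show "x \<in> affine hull {a, b}" unfolding affine_hull_2 by (metis (mono_tags, lifting) diff_add_cancel mem_Collect_eq)
  qed
qed

section \<open>Labels and walls\<close>

locale ltiling = htiling +
  fixes A0 :: "complex set" and lab :: "complex set \<Rightarrow> nat"
  assumes A0: "A0 \<in> T" and elab: "edge_labelling p T A0 lab"
begin

text \<open>Uses \<open>gon\<close> and not \<open>posgon\<close>: a reflection keeps the labels but
  reverses the orientation, so the labels run clockwise in some tiles and counterclockwise in
  others.\<close>

definition lgon :: "(int \<Rightarrow> complex) \<Rightarrow> complex set \<Rightarrow> bool" where
  "lgon W B \<longleftrightarrow> gon p W B \<and> (\<forall>i. lab (gside W i) = Suc (nat (i mod int p)))"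

lemma lab_hrefl:
  assumes w: "wall n c" and f: "f \<in> tiling_edges T"
  shows "lab (hrefl n c ` f) = lab f"
proof -
  note nc = wall_less[OF w]
  obtain e A where e: "A \<in> T" "e edge_of A" "e \<in> tiling_edges T" "e \<subseteq> {x. n \<bullet> x = c}"
    using w unfolding wall_def tiling_edges_def by blast
  obtain W where W: "posgon p W A" using tile_posgon e by blast
  obtain i where i: "e = gside W i" using edge_iff[OF pg_gon[OF W]] e by blast
  have n0: "n \<noteq> 0" using nc by auto
  have "affine hull {W i, W (i + 1)} = {x. n \<bullet> x = c}"
    by (rule affine_hull_line[OF W_Suc(1)[OF pg_gon[OF W]] _ _ n0]) (use e i in \<open>auto simp: gside_def\<close>)
  then have "affine hull e = {x. n \<bullet> x = c}" unfolding i gside_def segment_convex_hull by simp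
  then show ?thesis using hreflection_hrefl[OF nc] elab e f unfolding edge_labelling_def by blast
qed

lemma lgon_A0: "\<exists>W. lgon W A0"
proof -
  obtain v where v: "cyclic_vertices p v A0" "\<forall>i<p. lab (side p v i) = Suc i"
    using elab unfolding edge_labelling_def by blast
  define W where "W i = v (nat (i mod int p))" for i
  have g: "gon p W A0" using gon_of_cyclic[OF v(1)] unfolding W_def .
  have p: "3 \<le> p" using gon_p[OF g] .
  have "lab (gside W i) = Suc (nat (i mod int p))" for i
  proof -
    have "gside W i = side p v (nat (i mod int p))" unfolding W_def using gside_cyclic p by simp
    moreover have "nat (i mod int p) < p" using p by (simp add: nat_less_iff)
    ultimately show ?thesis using v(2) by simp
  qed
  then show ?thesis unfolding lgon_def using g by blast
qed

lemma lgon_hrefl: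
  assumes w: "wall n c" and B: "B \<in> T" and l: "lgon W B"
  shows "lgon (\<lambda>i. hrefl n c (W i)) (hrefl n c ` B)"
proof -
  note nc = wall_less[OF w]
  have g: "gon p W B" using l unfolding lgon_def by blast
  show ?thesis
    unfolding lgon_def using gside_hrefl[OF nc g] gon_hrefl[OF nc g] lab_hrefl[OF w edge_tiling_edges[OF B g]] l lgon_def by simp
qed

lemma adj_hrefl:
  assumes w: "c\<^sup>2 < n \<bullet> n" and a: "adj B C" and e: "B \<inter> C \<subseteq> {x. n \<bullet> x = c}"
  shows "hrefl n c ` B = C"
  using hrefl_neighbour[OF _ _ _ w e] a unfolding adj_def by blast

lemma adj_wall:
  assumes "adj B C" "gon p W B"
  obtains i where "B \<inter> C = gside W i" "wall (edge_normal W i) (edge_offset W i)"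
    "B \<inter> C \<subseteq> {x. edge_normal W i \<bullet> x = edge_offset W i}"
proof -
  obtain i where i: "B \<inter> C = gside W i" using adj_edge[OF assms] by blast
  moreover have "B \<in> T" using assms unfolding adj_def by blast
  moreover have "gside W i \<subseteq> {x. edge_normal W i \<bullet> x = edge_offset W i}"
    using eform_exposed[OF assms(2), of i] unfolding eform_inner by auto
  ultimately show ?thesis using that edge_wall[OF _ assms(2)] by blast
qed

lemma lgon_exists:
  assumes "B \<in> T"
  shows "\<exists>W. lgon W B"
proof -
  have "adj\<^sup>*\<^sup>* A0 B" using all_connected A0 assms by blast
  then show ?thesis
  proof (induction rule: rtranclp_induct)
    case base
    then show ?case by (rule lgon_A0)
  next
    case (step B C)
    then obtain W where W: "lgon W B" by blast
    then have g: "gon p W B" unfolding lgon_def by blast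
    obtain i where i: "wall (edge_normal W i) (edge_offset W i)"
      "B \<inter> C \<subseteq> {x. edge_normal W i \<bullet> x = edge_offset W i}"
      using adj_wall[OF step(2) g] by metis
    have "B \<in> T" using step(2) unfolding adj_def by blast
    then show ?case
      using lgon_hrefl[OF i(1) _ W] adj_hrefl[OF _ step(2) i(2)] i(1) unfolding wall_def by metis
  qed
qed

lemma side_of_interior:
  assumes "B \<in> T" "x \<in> interior B" "n \<noteq> 0" "\<forall>x\<in>B. c \<le> n \<bullet> x"
  shows "c < n \<bullet> x"
proof -
  have "interior {x. c \<le> n \<bullet> x} = {x. c < n \<bullet> x}" using interior_halfspace_ge[OF assms(3)] by simp
  moreover have "interior B \<subseteq> interior {x. c \<le> n \<bullet> x}" by (rule interior_mono) (use assms in blast)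
  ultimately show ?thesis using assms by blast
qed

text \<open>If the line met the interior of a tile, the reflection would map that tile onto itself;
  preserving the labels, it would fix every side and hence every vertex.\<close>

lemma wall_no_cross:
  assumes w: "wall n c" and B: "B \<in> T"
  shows "(\<forall>x\<in>B. c \<le> n \<bullet> x) \<or> (\<forall>x\<in>B. n \<bullet> x \<le> c)"
proof (rule ccontr)
  let ?r = "hrefl n c"
  assume "\<not> ?thesis"
  then obtain x y where xy: "x \<in> B" "y \<in> B" "n \<bullet> x < c" "c < n \<bullet> y" by (meson not_less)
  note nc = wall_less[OF w]
  \<comment> \<open>A tile is the closure of its interior, so the points on the two sides may be
    taken interior; the segment between them crosses the line at an interior point.\<close>
  have cl: "closure (interior B) = B"
    using convex_closure_interior[OF tile_convex tile_interior] tile_closed B by (metis closure_closed)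
  have "open {x. n \<bullet> x < c}" "open {x. c < n \<bullet> x}" by (rule open_halfspace_lt open_halfspace_gt)+
  then have "{x. n \<bullet> x < c} \<inter> interior B \<noteq> {}" "{x. c < n \<bullet> x} \<inter> interior B \<noteq> {}"
    using xy cl open_Int_closure_eq_empty by blast+
  then obtain x' y' where xy': "x' \<in> interior B" "y' \<in> interior B" "n \<bullet> x' < c" "c < n \<bullet> y'" by blast
  define u where "u = (c - n \<bullet> x') / (n \<bullet> y' - n \<bullet> x')"
  have u: "0 < u" "u < 1" unfolding u_def using xy' by (simp_all add: field_simps)
  define z where "z = (1 - u) *\<^sub>R x' + u *\<^sub>R y'"
  have zi: "z \<in> interior B" unfolding z_def
    using convex_interior[OF tile_convex[OF B]] xy' u by (simp add: convexD_alt)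
  have "n \<bullet> z = n \<bullet> x' + u * (n \<bullet> y' - n \<bullet> x')" unfolding z_def by (simp add: inner_add algebra_simps)
  then have nz: "n \<bullet> z = c" unfolding u_def using xy' by simp
  have "z \<in> hplane" using zi interior_subset tile_hplane[OF B] by blast
  then have "?r z = z" using hrefl_eq_iff[OF nc] nz by blast
  then have "z \<in> interior (?r ` B)" using hrefl_interior_subset[OF nc tile_hplane[OF B]] zi by force
  then have rB: "?r ` B = B" using disj[OF hrefl_tile[OF w B] B] zi by blast
  obtain W where W: "lgon W B" using lgon_exists[OF B] by blast
  then have g: "gon p W B" unfolding lgon_def by blast
  note rs = gside_hrefl[OF nc g, symmetric]
  have "{W i, W (i + 1)} = {?r (W i), ?r (W (i + 1))}" for i
  proof -
    have "gside (\<lambda>i. ?r (W i)) i edge_of B" using gside_edge[OF gon_hrefl[OF nc g], of i] rB by simp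
    then obtain j where j: "?r ` gside W i = gside W j" using edge_iff[OF g] rs by metis
    have "lab (gside W j) = lab (gside W i)" using lab_hrefl[OF w edge_tiling_edges[OF B g], of i] j by simp
    then have "nat (j mod int p) = nat (i mod int p)" using W unfolding lgon_def by simp
    then have "j mod int p = i mod int p" using gon_p[OF g] by (simp add: nat_eq_iff)
    then have "gside W i = gside (\<lambda>i. ?r (W i)) i" using gside_eq[OF g] j rs by metis
    then show ?thesis unfolding gside_def by (rule segment_eq_imp)
  qed
  note pairs = this
  \<comment> \<open>The vertex lies on two sides, both mapped to themselves, and has different other
    ends there.\<close>
  have "?r (W i) = W i" for i
  proof (rule ccontr)
    assume "?r (W i) \<noteq> W i"
    moreover have "?r (W i) \<in> {W i, W (i + 1)}" by (simp only: pairs[of i]) simp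
    moreover have "?r (W (i - 1 + 1)) \<in> {W (i - 1), W (i - 1 + 1)}" by (simp only: pairs[of "i - 1"]) simp
    ultimately have "?r (W i) = W (i + 1)" "?r (W i) = W (i - 1)" by auto
    then show False using W_Suc(2)[OF g, of "i - 1"] by (simp add: algebra_simps)
  qed
  then have "n \<bullet> W i = c" for i using hrefl_eq_iff[OF nc W_hplane[OF g]] by blast
  then have "B \<subseteq> {x. n \<bullet> x = c}" unfolding A_hull[OF g]
    by (intro hull_minimal convex_hyperplane) auto
  then show False using xy by auto
qed

lemma side_cases:
  assumes w: "wall n c" and B: "B \<in> T" and x: "x \<in> B"
  shows "side_of n c B \<Longrightarrow> c \<le> n \<bullet> x" "\<not> side_of n c B \<Longrightarrow> n \<bullet> x \<le> c"
  using wall_no_cross[OF w B] x unfolding side_of_def by auto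

lemma wall_interior:
  assumes w: "wall n c" and B: "B \<in> T" and x: "x \<in> interior B"
  shows "side_of n c B \<longleftrightarrow> c < n \<bullet> x" "n \<bullet> x \<noteq> c"
proof -
  have n: "n \<noteq> 0" using w unfolding wall_def by auto
  have 1: "side_of n c B \<Longrightarrow> c < n \<bullet> x" using side_of_interior[OF B x n] unfolding side_of_def by blast
  have 2: "\<not> side_of n c B \<Longrightarrow> n \<bullet> x < c"
    using side_of_interior[OF B x, of "- n" "- c"] n wall_no_cross[OF w B] unfolding side_of_def by auto
  show "side_of n c B \<longleftrightarrow> c < n \<bullet> x" "n \<bullet> x \<noteq> c" using 1 2 by force+
qed

lemma side_hrefl:
  assumes w: "wall n c" and B: "B \<in> T"
  shows "side_of n c (hrefl n c ` B) \<longleftrightarrow> \<not> side_of n c B"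
proof -
  note nc = wall_less[OF w]
  obtain z where z: "z \<in> interior B" using tile_interior[OF B] by blast
  then have zh: "z \<in> hplane" using interior_subset tile_hplane[OF B] by blast
  have rz: "hrefl n c z \<in> interior (hrefl n c ` B)"
    using hrefl_interior_subset[OF nc tile_hplane[OF B]] z by blast
  define m where "m = (n \<bullet> n - c\<^sup>2) / hden n c z"
  have m: "m > 0" unfolding m_def using nc hden_pos[OF nc zh] by simp
  have "n \<bullet> hrefl n c z - c = - (m * (n \<bullet> z - c))"
  proof -
    have "- a * l / b = - (a / b * l)" for a b l :: real by simp
    then show ?thesis using inner_hrefl[OF nc zh] unfolding m_def by (simp only:)
  qed
  moreover have "m * (n \<bullet> z - c) > 0 \<longleftrightarrow> n \<bullet> z > c" "m * (n \<bullet> z - c) = 0 \<longleftrightarrow> n \<bullet> z = c"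
    using m by (simp_all add: zero_less_mult_iff)
  ultimately show ?thesis
    using wall_interior[OF w B z] wall_interior[OF w hrefl_tile[OF w B] rz] by linarith
qed

lemma side_adj:
  assumes w: "wall n c" and a: "adj B C"
  shows "side_of n c B \<noteq> side_of n c C \<longleftrightarrow> B \<inter> C \<subseteq> {x. n \<bullet> x = c}"
proof
  have BC: "B \<in> T" "C \<in> T" using a unfolding adj_def by auto
  assume "side_of n c B \<noteq> side_of n c C"
  then show "B \<inter> C \<subseteq> {x. n \<bullet> x = c}"
    using side_cases[OF w BC(1)] side_cases[OF w BC(2)] by (auto intro: order_antisym)
next
  assume "B \<inter> C \<subseteq> {x. n \<bullet> x = c}"
  then have "hrefl n c ` B = C" using adj_hrefl a w unfolding wall_def by blast
  then show "side_of n c B \<noteq> side_of n c C" using side_hrefl[OF w, of B] a unfolding adj_def by blast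
qed

text \<open>Reflecting the part of the path after its last crossing of the wall turns that crossing
  into a standstill, which saves one step. The induction treats the path from its end.\<close>

lemma side_pow_reflect:
  assumes w: "wall n c" and "(adj ^^ k) A B" "side_of n c A \<noteq> side_of n c B"
  shows "\<exists>m. k = Suc m \<and> (adj ^^ m) A (hrefl n c ` B)"
  using assms(2,3)
proof (induction k arbitrary: B)
  case (Suc k)
  then obtain Y where Y: "(adj ^^ k) A Y" "adj Y B" by (auto elim: relpowp_Suc_E)
  show ?case
  proof (cases "side_of n c A = side_of n c Y")
    case True
    then have "Y \<inter> B \<subseteq> {x. n \<bullet> x = c}" using side_adj[OF w Y(2)] Suc(3) by blast
    then have "hrefl n c ` B = Y"
      using adj_hrefl[OF _ adj_sym[OF Y(2)]] w unfolding wall_def by (metis Int_commute)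
    then show ?thesis using Y by blast
  next
    case False
    then obtain m where m: "k = Suc m" "(adj ^^ m) A (hrefl n c ` Y)" using Suc(1) Y by blast
    then show ?thesis using hrefl_adj[OF w Y(2)] relpowp_Suc_I by metis
  qed
qed simp

section \<open>Distance from the base tile\<close>

definition tdist :: "complex set \<Rightarrow> nat" where
  "tdist B = (LEAST k. (adj ^^ k) A0 B)"

lemma tdist_path:
  assumes "B \<in> T"
  shows "(adj ^^ tdist B) A0 B"
proof -
  have "\<exists>k. (adj ^^ k) A0 B" using all_connected[OF A0 assms] rtranclp_imp_relpowp by metis
  then show ?thesis unfolding tdist_def by (rule LeastI_ex)
qed

lemma tdist_le: "(adj ^^ k) A0 B \<Longrightarrow> tdist B \<le> k"
  unfolding tdist_def by (rule Least_le)

lemma tdist_A0 [simp]: "tdist A0 = 0"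
  using tdist_le[of 0 A0] by simp

lemma tdist_adj_le:
  assumes "adj B C"
  shows "tdist C \<le> Suc (tdist B)"
proof -
  have "B \<in> T" using assms unfolding adj_def by blast
  then have "(adj ^^ Suc (tdist B)) A0 C" by (rule relpowp_Suc_I[OF tdist_path assms])
  then show ?thesis by (rule tdist_le)
qed

lemma tdist_wall:
  assumes a: "adj B C" and w: "wall n c" and e: "B \<inter> C \<subseteq> {x. n \<bullet> x = c}"
  shows "side_of n c A0 \<noteq> side_of n c B \<Longrightarrow> tdist B = Suc (tdist C)"
    and "side_of n c A0 = side_of n c B \<Longrightarrow> tdist C = Suc (tdist B)"
proof -
  have *: "tdist B = Suc (tdist C)" if 1: "adj B C" and 2: "B \<inter> C \<subseteq> {x. n \<bullet> x = c}" and 3: "side_of n c A0 \<noteq> side_of n c B" for B C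
  proof -
    have "B \<in> T" using 1 unfolding adj_def by blast
    then obtain m where m: "tdist B = Suc m" "(adj ^^ m) A0 (hrefl n c ` B)"
      using side_pow_reflect[OF w tdist_path 3] by blast
    moreover have "hrefl n c ` B = C" using adj_hrefl[OF _ 1 2] w unfolding wall_def by blast
    ultimately have "tdist C \<le> m" using tdist_le by blast
    then show ?thesis using tdist_adj_le[OF adj_sym[OF 1]] m by simp
  qed
  show "side_of n c A0 \<noteq> side_of n c B \<Longrightarrow> tdist B = Suc (tdist C)" using *[OF a e] .
  assume "side_of n c A0 = side_of n c B"
  then have "side_of n c A0 \<noteq> side_of n c C" using side_adj[OF w a] e by blast
  then show "tdist C = Suc (tdist B)" using *[OF adj_sym[OF a]] e by (simp add: Int_commute)
qed

lemma tdist_adj: "adj B C \<Longrightarrow> tdist B = Suc (tdist C) \<or> tdist C = Suc (tdist B)"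
proof -
  assume a: "adj B C"
  then obtain W where "gon p W B" using tile_posgon pg_gon unfolding adj_def by blast
  then show ?thesis using adj_wall[OF a] tdist_wall[OF a] by metis
qed

end

section \<open>Walls through nonadjacent sides do not meet\<close>

text \<open>Cramer's rule for the triangle \<open>P\<close>, \<open>Q\<close>, \<open>x\<close>; its
  area is nonzero by assumption.\<close>

lemma bary_exists:
  fixes P Q x y :: complex
  assumes "cross (Q - P) (x - P) \<noteq> 0"
  obtains a b c where "a + b + c = (1::real)" "y = a *\<^sub>R P + b *\<^sub>R Q + c *\<^sub>R x"
proof -
  define D where "D = cross (Q - P) (x - P)"
  define c where "c = cross (Q - P) (y - P) / D"
  define b where "b = cross (y - P) (x - P) / D"
  have D: "D \<noteq> 0" using assms D_def by simp
  have Dc: "D * c = cross (Q - P) (y - P)" and Db: "D * b = cross (y - P) (x - P)"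
    unfolding c_def b_def using D by auto
  have "D * (Re y - Re P) = (D * b) * (Re Q - Re P) + (D * c) * (Re x - Re P)"
    "D * (Im y - Im P) = (D * b) * (Im Q - Im P) + (D * c) * (Im x - Im P)"
    unfolding Dc Db unfolding D_def cross_def by (simp_all add: algebra_simps)
  then have "D * (Re y - Re P) = D * (b * (Re Q - Re P) + c * (Re x - Re P))"
    "D * (Im y - Im P) = D * (b * (Im Q - Im P) + c * (Im x - Im P))"
    by (simp_all add: algebra_simps)
  then have "Re y - Re P = b * (Re Q - Re P) + c * (Re x - Re P)"
    "Im y - Im P = b * (Im Q - Im P) + c * (Im x - Im P)"
    unfolding mult_left_cancel[OF D] by auto
  then have "y = (1 - b - c) *\<^sub>R P + b *\<^sub>R Q + c *\<^sub>R x"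
    by (simp add: complex_eq_iff algebra_simps)
  then show ?thesis using that[of "1 - b - c" b c] by simp
qed

lemma eform_bary:
  assumes "a + b + c = 1"
  shows "eform W i (a *\<^sub>R P + b *\<^sub>R Q + c *\<^sub>R x) = a * eform W i P + b * eform W i Q + c * eform W i x"
proof -
  have c: "c = 1 - a - b" using assms by simp
  show ?thesis unfolding c eform_def cross_def by (simp add: algebra_simps)
qed

lemma on_line:
  assumes "W i \<noteq> W (i + 1)" "eform W i x = 0"
  obtains v where "x = W i + v *\<^sub>R (W (i + 1) - W i)"
  using cross_zero_param[of "W (i + 1) - W i" x "W i"] assms that unfolding eform_def by auto

lemma eform_beyond:
  "eform W (i + 1) (W (i + 1) + t *\<^sub>R (W (i + 1) - W i)) = - t * cross (W (i + 1) - W i) (W (i + 2) - W (i + 1))"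
  unfolding eform_def cross_def by (simp add: algebra_simps add.assoc)

lemma zero_between:
  fixes \<alpha> \<beta> :: real
  assumes "\<alpha> < 0" "0 < \<beta>"
  obtains u where "0 < u" "u < 1" "(1 - u) * \<beta> + u * \<alpha> = 0"
proof -
  have "0 < \<beta> / (\<beta> - \<alpha>)" "\<beta> / (\<beta> - \<alpha>) < 1" using assms by (auto simp: field_simps)
  moreover have "(1 - \<beta> / (\<beta> - \<alpha>)) * \<beta> + \<beta> / (\<beta> - \<alpha>) * \<alpha> = 0" using assms by (simp add: field_simps)
  ultimately show ?thesis using that by blast
qed

context
  fixes p W A assumes pg: "posgon p W A"
begin

lemma turn: "0 < cross (W (i + 1) - W i) (W (i + 2) - W (i + 1))"
  using turn_pos[OF pg, of i] unfolding eform_def cross_def by (simp add: algebra_simps)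

text \<open>If the lines of sides \<open>i\<close> and \<open>i + k\<close> meet beyond the vertices
  between them, the line of side \<open>i + 1\<close> cuts off a smaller region with the same
  property for \<open>i + 1\<close> and \<open>i + k\<close>. The descent stops with one side in
  between. The convex set \<open>K\<close> keeps the new crossing points inside a given
  region.\<close>

lemma crossing_reduce:
  assumes "2 \<le> k" "int k \<le> int p - 2" "convex K" "A \<subseteq> K" "x \<in> K" "t > 0" "r > 0"
    and "x = W (i + 1) + t *\<^sub>R (W (i + 1) - W i)"
    and "x = W (i + int k) + r *\<^sub>R (W (i + int k) - W (i + int k + 1))"
  shows "\<exists>m y. y \<in> K \<and> eform W (m - 1) y = 0 \<and> eform W (m + 1) y = 0 \<and> eform W m y < 0"
  using assms
proof (induction k arbitrary: i x t r rule: nat_induct_at_least)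
  case base
  have "eform W (i + 1 - 1) x = 0" unfolding base(7) eform_def cross_def by (simp add: algebra_simps)
  moreover have "eform W (i + 1 + 1) x = 0" unfolding base(8) eform_def cross_def by (simp add: algebra_simps)
  moreover have "eform W (i + 1) x < 0" unfolding base(7) eform_beyond using turn[of i] base(5) by simp
  ultimately show ?case using base(4) by blast
next
  case (Suc k)
  note g = pg_gon[OF pg]
  define j where "j = i + int (Suc k)"
  note x1 = Suc.prems(7) and x2 = Suc.prems(8)[folded j_def]
  have kp: "int k + 1 \<le> int p - 2" "2 \<le> int k" using Suc by auto
  have nd: "\<not> int p dvd a" if "0 < a" "a < int p" for a
    using that zdvd_not_zless by blast
  have ne: "W j \<noteq> W (i + 1)" "W j \<noteq> W (i + 2)" "W j \<noteq> W i"
    unfolding W_eq_dvd[OF g] j_def by (rule nd; use kp in simp)+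
  have neg: "eform W (i + 1) x < 0" unfolding x1 eform_beyond using turn[of i] Suc.prems(5) by simp
  have pos: "0 < eform W (i + 1) (W j)"
    using eform_vertex_pos[OF pg, of j "i + 1"] ne by (simp add: add.assoc)
  \<comment> \<open>The line of side \<open>i + 1\<close> separates \<open>W j\<close> from
    \<open>x\<close> and so crosses the segment between them.\<close>
  obtain u where u: "0 < u" "u < 1" "(1 - u) * eform W (i + 1) (W j) + u * eform W (i + 1) x = 0"
    using zero_between[OF neg pos] by metis
  define y where "y = (1 - u) *\<^sub>R W j + u *\<^sub>R x"
  have yK: "y \<in> K" unfolding y_def
    using Suc.prems(2-4) W_in[OF g, of j] u by (simp add: convexD_alt subset_iff)
  have y0: "eform W (i + 1) y = 0" unfolding y_def eform_affine using u by simp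
  have y2: "y = W j + (u * r) *\<^sub>R (W j - W (j + 1))" unfolding y_def x2 by (simp add: algebra_simps)
  have "eform W i x = 0" unfolding x1 eform_def cross_def by (simp add: algebra_simps)
  then have Liy: "0 < eform W i y" unfolding y_def eform_affine using eform_vertex_pos[OF pg, of j i] ne u by simp
  obtain v where v: "y = W (i + 1) + v *\<^sub>R (W (i + 2) - W (i + 1))"
    using on_line[OF W_Suc(1)[OF g] y0] by (auto simp: add.assoc)
  have "eform W i y = v * cross (W (i + 1) - W i) (W (i + 2) - W (i + 1))"
    unfolding v eform_def cross_def by (simp add: algebra_simps)
  then have v0: "v > 0" using Liy turn[of i] by (simp add: zero_less_mult_iff)
  \<comment> \<open>Otherwise \<open>y\<close> would lie on side \<open>i + 1\<close>, but it is on
    the extension of side \<open>j\<close> behind \<open>W j\<close>, hence beyond side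
    \<open>j - 1\<close> and outside \<open>A\<close>.\<close>
  have "v > 1"
  proof (rule ccontr)
    assume "\<not> v > 1"
    then have "y \<in> closed_segment (W (i + 1)) (W (i + 2))"
      unfolding in_segment using v v0 by (intro exI[of _ v]) (simp add: algebra_simps)
    then have "y \<in> A" using gside_subset[OF g, of "i + 1"] unfolding gside_def by (auto simp: add.assoc)
    moreover have "eform W (j - 1) y = - (u * r) * cross (W (j - 1 + 1) - W (j - 1)) (W (j - 1 + 2) - W (j - 1 + 1))"
      unfolding y2 eform_def cross_def by (simp add: algebra_simps)
    then have "eform W (j - 1) y < 0" using turn[of "j - 1"] u Suc.prems(6) by simp
    ultimately show False using eform_nonneg[OF pg, of y "j - 1"] by simp
  qed
  have "\<exists>m y. y \<in> K \<and> eform W (m - 1) y = 0 \<and> eform W (m + 1) y = 0 \<and> eform W m y < 0"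
  proof (rule Suc.IH[where i = "i + 1" and x = y and t = "v - 1" and r = "u * r"])
    show "y = W (i + 1 + 1) + (v - 1) *\<^sub>R (W (i + 1 + 1) - W (i + 1))"
      unfolding v by (simp add: algebra_simps add.assoc)
    have "i + 1 + int k = j" unfolding j_def by simp
    then show "y = W (i + 1 + int k) + (u * r) *\<^sub>R (W (i + 1 + int k) - W (i + 1 + int k + 1))"
      using y2 by simp
  qed (use Suc.prems yK \<open>v > 1\<close> u in auto)
  then show ?case .
qed

text \<open>Each of the three forms vanishes at two corners of the triangle, so its sign at
  \<open>y\<close> is the sign of the barycentric weight at the third.\<close>

lemma cap_triangle:
  assumes x: "eform W (i - 1) x = 0" "eform W (i + 1) x = 0" "eform W i x < 0"
    and y: "eform W i y \<le> 0" "0 \<le> eform W (i - 1) y" "0 \<le> eform W (i + 1) y"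
  shows "y \<in> convex hull {W i, W (i + 1), x}"
proof -
  note g = pg_gon[OF pg]
  have "cross (W (i + 1) - W i) (x - W i) \<noteq> 0" using x(3) unfolding eform_def by simp
  then obtain a b c where abc: "a + b + c = 1" "y = a *\<^sub>R W i + b *\<^sub>R W (i + 1) + c *\<^sub>R x"
    using bary_exists by metis
  have ne: "W i \<noteq> W (i + 1)" "W i \<noteq> W (i + 2)" "W (i + 1) \<noteq> W (i - 1)"
    using W_Suc[OF g, of i] W_Suc(2)[OF g, of "i - 1"] by (simp_all add: algebra_simps)
  have z: "eform W (i - 1) (W i) = 0" using eform_vertex(2)[of W "i - 1"] by simp
  have "eform W i y = c * eform W i x" unfolding abc(2) eform_bary[OF abc(1)] by simp
  then have "c \<ge> 0" using y(1) x(3) by (metis mult_le_0_iff not_less)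
  have "eform W (i - 1) y = b * eform W (i - 1) (W (i + 1))" unfolding abc(2) eform_bary[OF abc(1)] using x z by simp
  moreover have "0 < eform W (i - 1) (W (i + 1))"
    using eform_vertex_pos[OF pg, of "i + 1" "i - 1"] ne by simp
  ultimately have "b \<ge> 0" using y(2) by (simp add: zero_le_mult_iff)
  have "eform W (i + 1) y = a * eform W (i + 1) (W i)" unfolding abc(2) eform_bary[OF abc(1)] using x by simp
  moreover have "0 < eform W (i + 1) (W i)"
    using eform_vertex_pos[OF pg, of i "i + 1"] ne by (simp add: add.assoc)
  ultimately have "a \<ge> 0" using y(3) by (simp add: zero_le_mult_iff)
  then show ?thesis unfolding convex_hull_3 using abc \<open>b \<ge> 0\<close> \<open>c \<ge> 0\<close> by blast
qed

end

context ltiling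
begin

text \<open>\<open>C\<close> is the tile across side \<open>i\<close>. The walls of sides
  \<open>i - 1\<close> and \<open>i + 1\<close> do not separate it from \<open>B\<close>, so it
  stays in the triangle. Two of its sides then have lines that meet in the triangle, and
  \<open>crossing_reduce\<close> finds the same defect for \<open>C\<close> there.\<close>

lemma bad_step:
  assumes p: "4 \<le> p" and B: "B \<in> T" and W: "rgon p s \<alpha> W B"
    and x: "x \<in> hplane" "eform W (i - 1) x = 0" "eform W (i + 1) x = 0" "eform W i x < 0"
  shows "\<exists>C V j y. C \<in> T \<and> rgon p s \<alpha> V C \<and> y \<in> hplane \<and> eform V (j - 1) y = 0 \<and> eform V (j + 1) y = 0 \<and> eform V j y < 0
    \<and> convex hull {V j, V (j + 1), y} \<subseteq> convex hull {W i, W (i + 1), x} \<and> C \<subseteq> convex hull {W i, W (i + 1), x}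
    \<and> \<not> C \<subseteq> convex hull {V j, V (j + 1), y}"
proof -
  let ?\<Delta> = "convex hull {W i, W (i + 1), x}"
  have pW: "posgon p W B" using W unfolding rgon_def by blast
  note gW = pg_gon[OF pW]
  obtain C where C: "adj B C" "B \<inter> C = gside W i" using neighbour_adj[OF B gW] by blast
  have CT: "C \<in> T" and "B \<noteq> C" using C unfolding adj_def share_edge_def by auto
  obtain V0 where V0: "rgon p s \<alpha> V0 C" using tile_rgon[OF CT] by blast
  then have "gon p V0 C" using pg_gon unfolding rgon_def by blast
  then obtain j0 where j0: "B \<inter> C = gside V0 j0"
    using adj_edge[OF adj_sym[OF C(1)]] by (metis Int_commute)
  \<comment> \<open>Numbered so that side 0 of \<open>C\<close> is the common side, run through in
    the direction opposite to side \<open>i\<close> of \<open>B\<close>.\<close>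
  define V where "V m = V0 (j0 + m)" for m
  have rV: "rgon p s \<alpha> V C" using rgon_shift[OF V0] unfolding V_def .
  then have V: "posgon p V C" unfolding rgon_def by blast
  note gV = pg_gon[OF V]
  have V01: "V 0 = W (i + 1)" "V 1 = W i"
    using rgon_share[OF W V0 _ \<open>B \<noteq> C\<close>, of i j0] C(2) j0 unfolding V_def by auto
  have other: "0 \<le> eform W m z" if "gside W m \<noteq> gside W i" "z \<in> C" for m z
  proof -
    let ?n = "edge_normal W m"
    let ?c = "edge_offset W m"
    have w: "wall ?n ?c" by (rule edge_wall[OF B gW])
    have "\<not> B \<inter> C \<subseteq> {x. ?n \<bullet> x = ?c}"
    proof
      assume "B \<inter> C \<subseteq> {x. ?n \<bullet> x = ?c}"
      then have "gside W i \<subseteq> gside W m"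
        using eform_exposed[OF gW, of m] gside_subset[OF gW, of i] C(2) unfolding eform_inner by auto
      then show False using face_dim_eq[OF gside_face[OF gW, of i] gside_face[OF gW, of m]] gside_aff_dim[OF gW] that by simp
    qed
    moreover have "side_of ?n ?c B"
      using eform_nonneg[OF pW] unfolding side_of_def eform_inner by simp
    ultimately have "side_of ?n ?c C" using side_adj[OF w C(1)] by blast
    then show ?thesis using that(2) unfolding side_of_def eform_inner by simp
  qed
  have CD: "C \<subseteq> ?\<Delta>"
  proof
    fix z assume z: "z \<in> C"
    have "eform W i z = - eform V 0 z" unfolding eform_def using V01 by (simp add: cross_def algebra_simps)
    then have "eform W i z \<le> 0" using eform_nonneg[OF V z, of 0] by simp
    moreover have "0 \<le> eform W (i - 1) z" "0 \<le> eform W (i + 1) z"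
      using other[OF _ z] gside_neq_Suc[OF gW, of i] gside_neq_Suc[OF gW, of "i - 1"] by auto
    ultimately show "z \<in> ?\<Delta>" using cap_triangle[OF pW x(2-4)] by blast
  qed
  define j where "j = int p - 1"
  have Vp: "V (j + 1) = V 0" using W_periodic[OF gV, of 0] by (simp add: j_def)
  have bary: "\<exists>a b c. a \<ge> 0 \<and> b \<ge> 0 \<and> c \<ge> 0 \<and> a + b + c = 1 \<and> z = a *\<^sub>R V 1 + b *\<^sub>R V 0 + c *\<^sub>R x" if "z \<in> C" for z
    using CD that unfolding convex_hull_3 V01 by blast
  have Lx: "eform V 0 x > 0" using x(4) unfolding eform_def using V01 by (simp add: cross_def algebra_simps)
  have nd: "\<not> int p dvd a" if "0 < a" "a < int p" for a
    using that zdvd_not_zless by blast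
  have ne: "V 2 \<noteq> V 0" "V 2 \<noteq> V 1" "V j \<noteq> V 0" "V j \<noteq> V 1" "V j \<noteq> V 2"
    unfolding W_eq_dvd[OF gV] j_def by (rule nd; use p in simp)+
  obtain a b c where 1: "a \<ge> 0" "b \<ge> 0" "c \<ge> 0" "a + b + c = 1" "V 2 = a *\<^sub>R V 1 + b *\<^sub>R V 0 + c *\<^sub>R x"
    using bary[OF W_in[OF gV]] by metis
  obtain a' b' c' where 2: "a' \<ge> 0" "b' \<ge> 0" "c' \<ge> 0" "a' + b' + c' = 1" "V j = a' *\<^sub>R V 1 + b' *\<^sub>R V 0 + c' *\<^sub>R x"
    using bary[OF W_in[OF gV]] by metis
  have L01: "eform V 0 (V 1) = 0" using eform_vertex(2)[of V 0] by simp
  have "eform V 0 (V 2) = c * eform V 0 x" unfolding 1(5) eform_bary[OF 1(4)] using L01 by simp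
  moreover have "0 < eform V 0 (V 2)" using eform_vertex_pos[OF V, of 2 0] ne by simp
  ultimately have c: "c > 0" using 1(3) by (cases "c = 0") auto
  have "eform V 0 (V j) = c' * eform V 0 x" unfolding 2(5) eform_bary[OF 2(4)] using L01 by simp
  moreover have "0 < eform V 0 (V j)" using eform_vertex_pos[OF V, of j 0] ne by simp
  ultimately have c': "c' > 0" using 2(3) by (cases "c' = 0") auto
  \<comment> \<open>the lines of the two sides of \<open>C\<close> next to the common side meet in the triangle\<close>
  define D where "D = b * c' + c * a' + c * c'"
  have D: "D > 0" unfolding D_def using 1 2 c c' by (simp add: add_nonneg_pos)
  \<comment> \<open>On the line of \<open>V 1\<close> and \<open>V 2\<close> the weights of
    \<open>V 0\<close> and \<open>x\<close> are as \<open>b\<close> to \<open>c\<close>; on the line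
    of \<open>V 0\<close> and \<open>V j\<close> those of \<open>V 1\<close> and \<open>x\<close>
    are as \<open>a'\<close> to \<open>c'\<close>. These weights satisfy both, and \<open>D\<close>
    makes their sum one.\<close>
  define y where "y = (c * a' / D) *\<^sub>R V 1 + (b * c' / D) *\<^sub>R V 0 + (c * c' / D) *\<^sub>R x"
  have sumD: "c * a' / D + b * c' / D + c * c' / D = 1"
    using D by (simp add: add_divide_distrib[symmetric]) (simp add: D_def add_ac)
  have yD: "y \<in> ?\<Delta>" unfolding convex_hull_3 y_def V01[symmetric]
  proof -
    have "y = (c * a' / D) *\<^sub>R V 1 + (b * c' / D) *\<^sub>R V 0 + (c * c' / D) *\<^sub>R x \<and>
      0 \<le> c * a' / D \<and> 0 \<le> b * c' / D \<and> 0 \<le> c * c' / D \<and> c * a' / D + b * c' / D + c * c' / D = 1"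
      using sumD y_def 1 2 c c' D by simp
    then show "(c * a' / D) *\<^sub>R V 1 + (b * c' / D) *\<^sub>R V 0 + (c * c' / D) *\<^sub>R x
      \<in> {u *\<^sub>R V 1 + v *\<^sub>R V 0 + w *\<^sub>R x |u v w. 0 \<le> u \<and> 0 \<le> v \<and> 0 \<le> w \<and> u + v + w = 1}"
      unfolding y_def by blast
  qed
  have y1: "y = V 1 + (c' / D) *\<^sub>R (V 2 - V 1)"
  proof -
    have a: "a = 1 - b - c" using 1 by simp
    have e: "c * a' / D = 1 - b * c' / D - c * c' / D" using sumD by simp
    show ?thesis unfolding y_def e 1(5) a by (simp add: algebra_simps)
  qed
  have y2: "y = V 0 + (c / D) *\<^sub>R (V j - V 0)"
  proof -
    have b: "b' = 1 - a' - c'" using 2 by simp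
    have e: "b * c' / D = 1 - c * a' / D - c * c' / D" using sumD by simp
    show ?thesis unfolding y_def e 2(5) b by (simp add: algebra_simps)
  qed
  have "eform V 1 (V 1 + r *\<^sub>R (V (1 + 1) - V 1)) = 0" for r
    unfolding eform_def cross_def by (simp add: algebra_simps)
  then have Ly: "eform V 1 y = 0" unfolding y1 by simp
  have "eform V j (V 0 + r *\<^sub>R (V j - V 0)) = 0" for r
    unfolding eform_def Vp cross_def by (simp add: algebra_simps)
  then have Ly': "eform V j y = 0" unfolding y2 .
  \<comment> \<open>A point of \<open>C\<close> on both lines would be a common vertex of sides
    \<open>1\<close> and \<open>j\<close>, and there is none since \<open>p\<close> is at least
    4.\<close>
  have yC: "y \<notin> C"
  proof
    assume "y \<in> C"
    then have ys: "y \<in> gside V 1" "y \<in> gside V j" using eform_zero[OF V] Ly Ly' by auto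
    have "V j \<in> gside V j" unfolding gside_def by simp
    moreover have "V j \<notin> gside V 1" unfolding W_in_gside[OF gV] using ne by simp
    ultimately have "gside V 1 \<noteq> gside V j" by blast
    then obtain m where m: "y = V m" using gside_inter[OF gV ys] by blast
    then have "V m = V 1 \<or> V m = V 2" "V m = V j \<or> V m = V 0"
      using ys W_in_gside[OF gV] Vp by auto
    moreover have "V 0 \<noteq> V 1" using W_Suc(1)[OF gV, of 0] by simp
    ultimately show False using ne by metis
  qed
  have "c' / D > 1"
  proof (rule ccontr)
    assume "\<not> c' / D > 1"
    then have "y \<in> closed_segment (V 1) (V 2)"
      unfolding in_segment using y1 c' D by (intro exI[of _ "c' / D"]) (simp add: algebra_simps)
    then show False using yC gside_subset[OF gV, of 1] unfolding gside_def by auto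
  qed
  have "c / D > 1"
  proof (rule ccontr)
    assume "\<not> c / D > 1"
    then have "y \<in> closed_segment (V 0) (V j)"
      unfolding in_segment using y2 c D by (intro exI[of _ "c / D"]) (simp add: algebra_simps)
    then show False using yC gside_subset[OF gV, of j] Vp unfolding gside_def by (auto simp: closed_segment_commute)
  qed
  have hD: "?\<Delta> \<subseteq> hplane"
    by (rule hull_minimal) (use W_hplane[OF gW] x(1) convex_hplane in auto)
  \<comment> \<open>Sides \<open>1\<close> and \<open>j = 1 + (p - 2)\<close> are the two neighbours
    of side 0, the widest gap that \<open>crossing_reduce\<close> allows.\<close>
  have "\<exists>m y. y \<in> ?\<Delta> \<and> eform V (m - 1) y = 0 \<and> eform V (m + 1) y = 0 \<and> eform V m y < 0"
  proof (rule crossing_reduce[OF V, where k = "p - 2" and i = 1 and x = y and t = "c' / D - 1" and r = "c / D - 1"])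
    show "y = V (1 + 1) + (c' / D - 1) *\<^sub>R (V (1 + 1) - V 1)" unfolding y1 by (simp add: algebra_simps)
    have "1 + int (p - 2) = j" using p unfolding j_def by simp
    then show "y = V (1 + int (p - 2)) + (c / D - 1) *\<^sub>R (V (1 + int (p - 2)) - V (1 + int (p - 2) + 1))"
      unfolding y2 using Vp by (simp add: algebra_simps)
  qed (use p CD yD \<open>c' / D > 1\<close> \<open>c / D > 1\<close> in auto)
  then obtain m u where mu: "u \<in> ?\<Delta>" "eform V (m - 1) u = 0" "eform V (m + 1) u = 0" "eform V m u < 0" by blast
  have sub: "convex hull {V m, V (m + 1), u} \<subseteq> ?\<Delta>"
    by (rule hull_minimal) (use mu CD W_in[OF gV] in auto)
  \<comment> \<open>The new triangle lies beyond side \<open>m\<close> of \<open>C\<close>, while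
    \<open>C\<close> has interior points on the near side.\<close>
  have "\<not> C \<subseteq> convex hull {V m, V (m + 1), u}"
  proof
    assume *: "C \<subseteq> convex hull {V m, V (m + 1), u}"
    have "convex {z. eform V m z \<le> 0}" unfolding eform_inner
      using convex_halfspace_le[of "edge_normal V m" "edge_offset V m"] by simp
    then have "convex hull {V m, V (m + 1), u} \<subseteq> {z. eform V m z \<le> 0}"
      by (intro hull_minimal) (use mu in auto)
    moreover obtain z where "z \<in> interior C" using tile_interior[OF CT] by blast
    ultimately show False using eform_interior[OF V, of z m] * interior_subset by fastforce
  qed
  then show ?thesis using CT rV mu sub CD hD by blast
qed

text \<open>Infinite descent: by \<open>bad_step\<close>, a side whose two neighbouring sides have lines meeting beyond
  it at \<open>x\<close> yields another such side with a strictly smaller triangle, measured by the number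
  of tiles inside it, which is finite.\<close>

lemma no_bad:
  assumes p: "4 \<le> p" and "B \<in> T" "rgon p s \<alpha> W B"
    "x \<in> hplane" "eform W (i - 1) x = 0" "eform W (i + 1) x = 0" "eform W i x < 0"
  shows False
  using assms(2-)
proof (induction "card {C \<in> T. C \<subseteq> convex hull {W i, W (i + 1), x}}" arbitrary: B W i x rule: less_induct)
  case less
  obtain C V j y where C: "C \<in> T" "rgon p s \<alpha> V C" "y \<in> hplane" "eform V (j - 1) y = 0" "eform V (j + 1) y = 0" "eform V j y < 0"
    and sub: "convex hull {V j, V (j + 1), y} \<subseteq> convex hull {W i, W (i + 1), x}"
    and in1: "C \<subseteq> convex hull {W i, W (i + 1), x}" and in2: "\<not> C \<subseteq> convex hull {V j, V (j + 1), y}"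
    using bad_step[OF p less(2-)] by blast
  have g: "gon p W B" using less(3) pg_gon unfolding rgon_def by blast
  have "finite {A \<in> T. A \<inter> convex hull {W i, W (i + 1), x} \<noteq> {}}"
  proof (rule locfin)
    show "compact (convex hull {W i, W (i + 1), x})" by (rule finite_imp_compact_convex_hull) simp
    show "convex hull {W i, W (i + 1), x} \<subseteq> hplane"
      by (rule hull_minimal) (use W_hplane[OF g] less(4) convex_hplane in auto)
  qed
  moreover have "{C \<in> T. C \<subseteq> convex hull {W i, W (i + 1), x}} \<subseteq> {A \<in> T. A \<inter> convex hull {W i, W (i + 1), x} \<noteq> {}}"
    using tile_interior interior_subset by fastforce
  ultimately have "finite {C \<in> T. C \<subseteq> convex hull {W i, W (i + 1), x}}" using finite_subset by blast
  moreover have "{A \<in> T. A \<subseteq> convex hull {V j, V (j + 1), y}} \<subset> {A \<in> T. A \<subseteq> convex hull {W i, W (i + 1), x}}"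
    using sub in1 in2 C(1) by blast
  ultimately have "card {A \<in> T. A \<subseteq> convex hull {V j, V (j + 1), y}} < card {A \<in> T. A \<subseteq> convex hull {W i, W (i + 1), x}}"
    by (rule psubset_card_mono)
  then show False using less(1) C by blast
qed

text \<open>From a point beyond both sides one gets a crossing point of the two lines in the plane,
  by convexity. It lies past the end of one side and before the start of the other, which is the
  situation excluded by \<open>crossing_reduce\<close> and \<open>no_bad\<close>.\<close>

lemma nonadjacent_sides:
  assumes B: "B \<in> T" and W: "rgon p s \<alpha> W B" and disj: "gside W i \<inter> gside W j = {}"
    and z: "z \<in> hplane" "eform W i z < 0" "eform W j z < 0"
  shows False
proof -
  have pW: "posgon p W B" using W unfolding rgon_def by blast
  note g = pg_gon[OF pW]
  have key: False if d: "gside W i \<inter> gside W j = {}" and x: "x \<in> hplane" and v: "v > 1" "x = W i + v *\<^sub>R (W (i + 1) - W i)"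
    and w: "w < 0" "x = W j + w *\<^sub>R (W (j + 1) - W j)" for x v w i j
  proof -
    \<comment> \<open>The number of sides from \<open>i\<close> on to \<open>j\<close>; disjointness
      excludes 0, 1 and \<open>p - 1\<close>.\<close>
    define k where "k = (j - i) mod int p"
    have p3: "3 \<le> p" using gon_p[OF g] .
    have k: "0 \<le> k" "k < int p" using p3 by (auto simp: k_def)
    have kj: "int p dvd i + k - j"
    proof -
      have "int p dvd (j - i) - (j - i) mod int p" by (rule dvd_minus_mod)
      then have "int p dvd - ((j - i) - (j - i) mod int p)" by (simp only: dvd_minus_iff)
      then show ?thesis unfolding k_def by (simp add: algebra_simps)
    qed
    have ds: "W i \<in> gside W i" "W (i + 1) \<in> gside W i" "W j \<in> gside W j" "W (j + 1) \<in> gside W j" unfolding gside_def by auto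
    have Wj: "W (i + k) = W j" "W (i + k + 1) = W (j + 1)"
      unfolding W_eq_dvd[OF g] using kj by (simp_all add: algebra_simps)
    have "k \<noteq> 0" using Wj ds d by auto
    moreover have "k \<noteq> 1" using Wj ds d by auto
    moreover have "k \<noteq> int p - 1"
    proof
      assume "k = int p - 1"
      then have "i + k + 1 = i + int p" by simp
      then have "W (j + 1) = W (i + int p)" using Wj(2) by metis
      then show False using W_periodic[OF g, of i] ds d by auto
    qed
    ultimately have k2: "2 \<le> k" "k \<le> int p - 2" using k by auto
    have nk: "int (nat k) = k" using k by simp
    have "\<exists>m y. y \<in> hplane \<and> eform W (m - 1) y = 0 \<and> eform W (m + 1) y = 0 \<and> eform W m y < 0"
    proof (rule crossing_reduce[OF pW, where k = "nat k" and i = i and x = x and t = "v - 1" and r = "- w"])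
      show "x = W (i + 1) + (v - 1) *\<^sub>R (W (i + 1) - W i)" unfolding v(2) by (simp add: algebra_simps)
      show "x = W (i + int (nat k)) + (- w) *\<^sub>R (W (i + int (nat k)) - W (i + int (nat k) + 1))"
        unfolding nk Wj unfolding w(2) by (simp add: algebra_simps)
    qed (use k2 v w x tile_hplane[OF B] convex_hplane in auto)
    moreover have "4 \<le> p" using k2 by simp
    ultimately show False using no_bad[OF _ B W] by blast
  qed
  have ds: "W i \<in> gside W i" "W (i + 1) \<in> gside W i" "W j \<in> gside W j" "W (j + 1) \<in> gside W j" unfolding gside_def by auto
  have pos: "0 < eform W i (W j)" "0 < eform W j (W i)"
    using eform_zero[OF pW W_in[OF g]] eform_nonneg[OF pW W_in[OF g]] ds disj by (metis disjoint_iff order_le_less)+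
  obtain u where u: "0 < u" "u < 1" "(1 - u) * eform W i (W j) + u * eform W i z = 0"
    using zero_between[OF z(2) pos(1)] by metis
  \<comment> \<open>First move to the line of side \<open>i\<close> while staying beyond side
    \<open>j\<close>; then \<open>x\<close> moves along that line, starting from \<open>W i\<close>,
    to the line of side \<open>j\<close>.\<close>
  define y where "y = (1 - u) *\<^sub>R W j + u *\<^sub>R z"
  have yh: "y \<in> hplane" unfolding y_def using convex_hplane W_hplane[OF g] z u by (simp add: convexD_alt)
  have y0: "eform W i y = 0" unfolding y_def eform_affine using u by simp
  have "eform W j y < 0" unfolding y_def eform_affine using u z(3) by (simp add: mult_pos_neg)
  then obtain u' where u': "0 < u'" "u' < 1" "(1 - u') * eform W j (W i) + u' * eform W j y = 0"
    using zero_between[OF _ pos(2)] by metis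
  define x where "x = (1 - u') *\<^sub>R W i + u' *\<^sub>R y"
  have xh: "x \<in> hplane" unfolding x_def using convex_hplane W_hplane[OF g] yh u' by (simp add: convexD_alt)
  have xi: "eform W i x = 0" unfolding x_def eform_affine using y0 by simp
  have xj: "eform W j x = 0" unfolding x_def eform_affine using u' by simp
  have xB: "x \<notin> B" using eform_zero[OF pW] xi xj disj by blast
  obtain v where v: "x = W i + v *\<^sub>R (W (i + 1) - W i)" using on_line[OF W_Suc(1)[OF g] xi] by metis
  obtain w where w: "x = W j + w *\<^sub>R (W (j + 1) - W j)" using on_line[OF W_Suc(1)[OF g] xj] by metis
  have seg: "t < 0 \<or> t > 1" if "x = W m + t *\<^sub>R (W (m + 1) - W m)" for t m
  proof (rule ccontr)
    assume "\<not> ?thesis"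
    then have "x \<in> gside W m" unfolding gside_def in_segment using that by (intro exI[of _ t]) (simp add: algebra_simps)
    then show False using gside_subset[OF g] xB by blast
  qed
  \<comment> \<open>The cross product of the two directions; comparing signs shows that
    \<open>v\<close> and \<open>w\<close> have opposite signs.\<close>
  define \<kappa> where "\<kappa> = cross (W (j + 1) - W j) (W (i + 1) - W i)"
  have "eform W j x = eform W j (W i) + v * \<kappa>" unfolding v eform_def cross_def \<kappa>_def by (simp add: algebra_simps)
  then have 1: "v * \<kappa> < 0" using xj pos by simp
  have "eform W i x = eform W i (W j) - w * \<kappa>" unfolding w eform_def cross_def \<kappa>_def by (simp add: algebra_simps)
  then have 2: "w * \<kappa> > 0" using xi pos by simp
  have "v * w < 0"
  proof -
    have "(v * \<kappa>) * (w * \<kappa>) < 0" using 1 2 by (rule mult_neg_pos)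
    then have "(v * w) * \<kappa>\<^sup>2 < 0" by (simp add: power2_eq_square mult_ac)
    then show ?thesis by (meson mult_less_0_iff not_less zero_le_power2)
  qed
  then consider "v > 1" "w < 0" | "v < 0" "w > 1"
    using seg[OF v] seg[OF w] by (auto simp: mult_less_0_iff)
  then show False
    using key[OF disj xh _ v _ w] key[OF _ xh _ w _ v] disj by (cases) (auto simp: Int_commute)
qed

text \<open>An interior point of the base tile lies strictly beyond every side of \<open>B\<close>
  whose crossing lowers the distance, so \<open>nonadjacent_sides\<close> applies to it.\<close>

lemma descents_meet:
  assumes C: "adj B C" and D: "adj B D" and "tdist C < tdist B" "tdist D < tdist B"
  shows "B \<inter> C \<inter> (B \<inter> D) \<noteq> {}"
proof
  assume dj: "B \<inter> C \<inter> (B \<inter> D) = {}"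
  have B: "B \<in> T" using C unfolding adj_def by blast
  obtain W where rW: "rgon p s \<alpha> W B" using tile_rgon[OF B] by blast
  then have W: "posgon p W B" unfolding rgon_def by blast
  note g = pg_gon[OF W]
  obtain z where z: "z \<in> interior A0" using tile_interior[OF A0] by blast
  then have zh: "z \<in> hplane" using interior_subset tile_hplane[OF A0] by blast
  have *: "\<exists>i. B \<inter> E = gside W i \<and> eform W i z < 0" if a: "adj B E" and t: "tdist E < tdist B" for E
  proof -
    obtain i where i: "B \<inter> E = gside W i" and w: "wall (edge_normal W i) (edge_offset W i)"
      and e: "B \<inter> E \<subseteq> {x. edge_normal W i \<bullet> x = edge_offset W i}"
      using adj_wall[OF a g] by metis
    have "side_of (edge_normal W i) (edge_offset W i) B"
      using eform_nonneg[OF W] unfolding side_of_def eform_inner by simp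
    then have "\<not> side_of (edge_normal W i) (edge_offset W i) A0"
      using tdist_wall[OF a w e] t by auto
    then have "eform W i z < 0" using wall_interior[OF w A0 z] unfolding eform_inner by linarith
    then show ?thesis using i by blast
  qed
  obtain i j where "B \<inter> C = gside W i" "eform W i z < 0" "B \<inter> D = gside W j" "eform W j z < 0"
    using *[OF C] *[OF D] assms by blast
  then show False using nonadjacent_sides[OF B rW _ zh] dj by metis
qed

end

section \<open>Tiles around a vertex\<close>

primrec walk :: "('a \<Rightarrow> 'a) \<Rightarrow> ('a \<Rightarrow> 'a) \<Rightarrow> 'a \<Rightarrow> nat \<Rightarrow> 'a" where
  "walk f g x 0 = x"
| "walk f g x (Suc n) = (if even n then f else g) (walk f g x n)"

text \<open>Two involutions without fixed points arrange a set on which they act transitively in a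
  cycle, whose steps belong to \<open>f\<close> and \<open>g\<close> in turn. Starting with
  \<open>g\<close> means running around it backwards.\<close>

lemma walk_two_involutions:
  fixes f g :: "'a \<Rightarrow> 'a" and X :: "'a set"
  assumes fin: "finite X" and x: "x \<in> X" and qX: "card X = q"
    and f: "\<And>y. y \<in> X \<Longrightarrow> f y \<in> X \<and> f (f y) = y \<and> f y \<noteq> y"
    and g: "\<And>y. y \<in> X \<Longrightarrow> g y \<in> X \<and> g (g y) = y \<and> g y \<noteq> y"
    and conn: "\<And>S. x \<in> S \<Longrightarrow> S \<subseteq> X \<Longrightarrow> (\<And>y. y \<in> S \<Longrightarrow> f y \<in> S \<and> g y \<in> S) \<Longrightarrow> X \<subseteq> S"
  shows "even q" "walk f g x q = x" "inj_on (walk f g x) {..<q}"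
    "\<And>n. n \<le> q \<Longrightarrow> walk g f x n = walk f g x (q - n)"
proof -
  let ?w = "walk f g x"
  have wX: "?w n \<in> X" for n by (induction n) (use x f g in auto)
  have inv: "(if even n then f else g) (?w (Suc n)) = ?w n" "?w (Suc n) \<noteq> ?w n" for n
    using f[OF wX] g[OF wX] by auto
  \<comment> \<open>With an odd gap, the step forward from the first place and the step back from
    the second use the same involution, so the gap shrinks by two; gap one would be a fixed
    point.\<close>
  have odd: False if "?w i = ?w (i + d)" "odd d" for i d
    using that
  proof (induction d arbitrary: i rule: less_induct)
    case (less d)
    show False
    proof (cases "d = 1")
      case True
      then have "?w (Suc i) = ?w i" using less(2) by (simp del: walk.simps)
      then show False using inv(2) by blast
    next
      case False
      define e where "e = d - 2"
      have "2 \<le> d" using odd_pos[OF less(3)] False by linarith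
      then have d2: "d = e + 2" unfolding e_def by simp
      then have e: "d = e + 2" "odd e" using less(3) by simp_all
      have "?w (i + 1 + e) = (if even (i + 1 + e) then f else g) (?w (Suc (i + 1 + e)))"
        using inv(1)[of "i + 1 + e"] by simp
      also have "Suc (i + 1 + e) = i + d" using d2 by simp
      also have "?w (i + d) = ?w i" using less(2) by (rule sym)
      also have "(if even (i + 1 + e) then f else g) (?w i) = ?w (i + 1)" using e by simp
      finally show False using less(1)[of e "i + 1"] e by (simp del: walk.simps)
    qed
  qed
  \<comment> \<open>With an even gap both places are reached by the same involution, so the
    coincidence moves back to the start.\<close>
  have even: "?w 0 = ?w d" if "?w i = ?w (i + d)" "even d" for i d
    using that
  proof (induction i)
    case (Suc i)
    have "?w i = (if even i then f else g) (?w (Suc i))" using inv(1)[of i] by simp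
    also have "\<dots> = (if even (i + d) then f else g) (?w (Suc (i + d)))" using Suc(2,3) by simp
    also have "\<dots> = ?w (i + d)" using inv(1)[of "i + d"] by simp
    finally show ?case using Suc by simp
  qed simp
  have shift: "?w 0 = ?w (j - i) \<and> even (j - i)" if "i < j" "?w i = ?w j" for i j
    using odd[of i "j - i"] even[of i "j - i"] that by fastforce
  have "\<not> inj_on ?w {..q}"
  proof
    assume "inj_on ?w {..q}"
    then have "card {..q} \<le> card X" by (rule card_inj_on_le) (use wX fin in auto)
    then show False using qX by simp
  qed
  then obtain i j where "i \<noteq> j" "?w i = ?w j" unfolding inj_on_def by blast
  then have ex: "\<exists>n>0. ?w n = x" using shift[of i j] shift[of j i] by (metis linorder_neqE_nat walk.simps(1) zero_less_diff)
  define N where "N = (LEAST n. 0 < n \<and> ?w n = x)"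
  have N: "0 < N" "?w N = x" using LeastI_ex[OF ex] unfolding N_def by auto
  have Nmin: "N \<le> n" if "0 < n" "?w n = x" for n unfolding N_def using that by (intro Least_le) simp
  have evN: "even N" using odd[of 0 N] N by auto
  have inj: "inj_on ?w {..<N}"
  proof (rule linorder_inj_onI')
    fix i j assume ij: "i \<in> {..<N}" "j \<in> {..<N}" "i < j"
    show "?w i \<noteq> ?w j"
    proof
      assume "?w i = ?w j"
      then have "?w (j - i) = x" using shift[OF ij(3)] by simp
      then show False using Nmin[of "j - i"] ij by auto
    qed
  qed
  have "X \<subseteq> ?w ` {..<N}"
  proof (rule conn)
    show "x \<in> ?w ` {..<N}" using N by (intro image_eqI[of _ _ 0]) auto
    show "?w ` {..<N} \<subseteq> X" using wX by blast
    fix y assume "y \<in> ?w ` {..<N}"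
    then obtain n where n: "n < N" "y = ?w n" by blast
    have up: "?w (Suc n) \<in> ?w ` {..<N}"
    proof (cases "Suc n = N")
      case True
      then show ?thesis using N by (intro image_eqI[of _ _ 0]) auto
    next
      case False
      then have "Suc n < N" using n by simp
      then show ?thesis by blast
    qed
    \<comment> \<open>The predecessor on the cycle, which for 0 is the last place.\<close>
    define n' where "n' = (if n = 0 then N - 1 else n - 1)"
    have "n = 0 \<Longrightarrow> Suc n' = N" "n \<noteq> 0 \<Longrightarrow> Suc n' = n" using N unfolding n'_def by auto
    then have yn': "y = ?w (Suc n')" using n N by (cases "n = 0") (simp_all del: walk.simps(2))
    have "n' < N" unfolding n'_def using n N by auto
    then have down: "?w n' \<in> ?w ` {..<N}" by blast
    have "even n' \<longleftrightarrow> odd n" unfolding n'_def using evN N by (cases n) auto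
    then have "(if even n then g else f) y = ?w n'" using inv(1)[of n'] unfolding yn' by auto
    moreover have "(if even n then f else g) y = ?w (Suc n)" unfolding n(2) by simp
    ultimately show "f y \<in> ?w ` {..<N} \<and> g y \<in> ?w ` {..<N}"
      using up down by (cases "even n") (auto simp del: walk.simps)
  qed
  then have "X = ?w ` {..<N}" using wX by blast
  then have NQ: "N = q" using card_image[OF inj] qX by simp
  show "even q" "?w q = x" "inj_on ?w {..<q}" using evN N inj NQ by auto
  show "walk g f x n = ?w (q - n)" if "n \<le> q" for n
    using that
  proof (induction n)
    case 0
    then show ?case using N NQ by simp
  next
    case (Suc n)
    then have e: "q - n = Suc (q - Suc n)" by simp
    have "even (q - Suc n) \<longleftrightarrow> odd n" using evN NQ Suc(2) by auto
    then have "(if even n then g else f) (?w (q - n)) = ?w (q - Suc n)"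
      using inv(1)[of "q - Suc n"] unfolding e by auto
    then show ?case using Suc by simp
  qed
qed

lemma first_ascent:
  fixes \<phi> :: "nat \<Rightarrow> nat"
  assumes "\<phi> q = \<phi> 0" "0 < q"
    and step: "\<And>n. n < q \<Longrightarrow> \<phi> n = Suc (\<phi> (Suc n)) \<or> \<phi> (Suc n) = Suc (\<phi> n)"
    and "\<phi> 0 = Suc (\<phi> 1)"
  obtains i where "0 < i" "i < q" "\<phi> (Suc i) = Suc (\<phi> i)" "\<phi> (i - 1) = Suc (\<phi> i)"
    "\<And>n. n \<le> i \<Longrightarrow> \<phi> n + n = \<phi> 0"
proof -
  have "\<exists>i<q. \<phi> (Suc i) = Suc (\<phi> i)"
  proof (rule ccontr)
    assume "\<not> ?thesis"
    then have *: "\<phi> n = Suc (\<phi> (Suc n))" if "n < q" for n using step that by blast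
    have "\<phi> n + n = \<phi> 0" if "n \<le> q" for n using that
    proof (induction n)
      case (Suc n)
      then show ?case using *[of n] by simp
    qed simp
    then have "\<phi> q + q = \<phi> 0" by simp
    then show False using assms(1,2) by simp
  qed
  define i where "i = (LEAST i. i < q \<and> \<phi> (Suc i) = Suc (\<phi> i))"
  have i: "i < q" "\<phi> (Suc i) = Suc (\<phi> i)"
    using LeastI_ex[OF \<open>\<exists>i<q. \<phi> (Suc i) = Suc (\<phi> i)\<close>] unfolding i_def by auto
  have des: "\<phi> n = Suc (\<phi> (Suc n))" if "n < i" for n
    using not_less_Least[of n "\<lambda>i. i < q \<and> \<phi> (Suc i) = Suc (\<phi> i)"] that step[of n] i(1) unfolding i_def by auto
  have "i \<noteq> 0" using i(2) assms(4) by (intro notI) simp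
  then have "0 < i" by simp
  moreover have "\<phi> (i - 1) = Suc (\<phi> i)" using des[of "i - 1"] \<open>0 < i\<close> by simp
  moreover have "\<phi> n + n = \<phi> 0" if "n \<le> i" for n using that
  proof (induction n)
    case (Suc n)
    then show ?case using des[of n] by simp
  qed simp
  ultimately show ?thesis using that i by blast
qed

text \<open>The first ascents seen from the two ends are both local minima, hence the same place.
  The descents to it from the two ends have equal depth and therefore equal length, so it is the
  middle.\<close>

lemma unimodal:
  fixes \<phi> :: "nat \<Rightarrow> nat"
  assumes q: "\<phi> q = \<phi> 0" "0 < q"
    and step: "\<And>n. n < q \<Longrightarrow> \<phi> n = Suc (\<phi> (Suc n)) \<or> \<phi> (Suc n) = Suc (\<phi> n)"
    and ends: "\<phi> 0 = Suc (\<phi> 1)" "\<phi> 0 = Suc (\<phi> (q - 1))"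
    and uniq: "\<And>i j. 0 < i \<Longrightarrow> i < q \<Longrightarrow> 0 < j \<Longrightarrow> j < q \<Longrightarrow>
      \<phi> (i - 1) = Suc (\<phi> i) \<Longrightarrow> \<phi> (Suc i) = Suc (\<phi> i) \<Longrightarrow>
      \<phi> (j - 1) = Suc (\<phi> j) \<Longrightarrow> \<phi> (Suc j) = Suc (\<phi> j) \<Longrightarrow> i = j"
    and n: "n \<le> q div 2"
  shows "\<phi> n + n = \<phi> 0"
proof -
  obtain i where i: "0 < i" "i < q" "\<phi> (Suc i) = Suc (\<phi> i)" "\<phi> (i - 1) = Suc (\<phi> i)"
    and di: "\<And>n. n \<le> i \<Longrightarrow> \<phi> n + n = \<phi> 0"
    using first_ascent[of \<phi>, OF q step ends(1)] by metis
  define \<psi> where "\<psi> n = \<phi> (q - n)" for n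
  have s: "\<psi> n = Suc (\<psi> (Suc n)) \<or> \<psi> (Suc n) = Suc (\<psi> n)" if "n < q" for n
  proof -
    have "q - n = Suc (q - Suc n)" "q - Suc n < q" using that by auto
    then show ?thesis unfolding \<psi>_def using step[of "q - Suc n"] by auto
  qed
  have e: "\<psi> q = \<psi> 0" "\<psi> 0 = Suc (\<psi> 1)" unfolding \<psi>_def using q ends by auto
  obtain j where j: "0 < j" "j < q" "\<psi> (Suc j) = Suc (\<psi> j)" "\<psi> (j - 1) = Suc (\<psi> j)"
    and dj: "\<And>n. n \<le> j \<Longrightarrow> \<psi> n + n = \<psi> 0"
    using first_ascent[of \<psi>, OF e(1) q(2) s e(2)] by metis
  have "q - Suc j = q - j - 1" "q - (j - 1) = Suc (q - j)" using j by auto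
  then have "i = q - j" using uniq[OF i(1,2), of "q - j"] i j unfolding \<psi>_def by simp
  moreover have "\<phi> i + i = \<phi> 0" using di by simp
  moreover have "\<phi> (q - j) + j = \<phi> 0" using dj[of j] q unfolding \<psi>_def by simp
  ultimately have "i = j" by simp
  then have "n \<le> i" using n \<open>i = q - j\<close> by simp
  then show ?thesis by (rule di)
qed

section \<open>Crossing edges by label, and the tiles at a vertex\<close>

context ltiling
begin

definition nb :: "complex set \<Rightarrow> nat \<Rightarrow> complex set" where
  "nb B k = (THE C. adj B C \<and> lab (B \<inter> C) = k)"

lemma p_ge_3: "3 \<le> p"
  using tile_posgon[OF A0] pg_gon gon_p by blast

lemma adj_T: "adj B C \<Longrightarrow> B \<in> T" "adj B C \<Longrightarrow> C \<in> T"
  unfolding adj_def by auto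

lemma adj_unique:
  assumes C: "adj B C" and D: "adj B D" and l: "lab (B \<inter> C) = lab (B \<inter> D)"
  shows "C = D"
proof -
  obtain W where W: "lgon W B" using lgon_exists adj_T[OF C] by blast
  then have g: "gon p W B" unfolding lgon_def by blast
  obtain i j where ij: "B \<inter> C = gside W i" "B \<inter> D = gside W j" using adj_edge[OF C g] adj_edge[OF D g] by blast
  then have "nat (i mod int p) = nat (j mod int p)" using l W unfolding lgon_def by simp
  then have "i mod int p = j mod int p" using p_ge_3 by (simp add: nat_eq_iff)
  then have "B \<inter> C = B \<inter> D" using ij gside_eq[OF g] by simp
  then show ?thesis using neighbour_unique C D unfolding adj_def by blast
qed

lemma nb_exists:
  assumes "B \<in> T" "k \<in> {1..p}"
  shows "\<exists>C. adj B C \<and> lab (B \<inter> C) = k"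
proof -
  obtain W where W: "lgon W B" using lgon_exists assms by blast
  then have g: "gon p W B" unfolding lgon_def by blast
  obtain C where "adj B C" "B \<inter> C = gside W (int k - 1)" using neighbour_adj[OF assms(1) g] by blast
  moreover have "lab (gside W (int k - 1)) = k"
  proof -
    have "(int k - 1) mod int p = int k - 1" using assms(2) by (intro mod_pos_pos_trivial) auto
    moreover have "Suc (nat (int k - 1)) = k" using assms(2) by auto
    ultimately show ?thesis using W unfolding lgon_def by simp
  qed
  ultimately show ?thesis by auto
qed

lemma nb_eq: "adj B C \<Longrightarrow> nb B (lab (B \<inter> C)) = C"
  unfolding nb_def by (rule the_equality) (use adj_unique in auto)

lemma nb_adj: "B \<in> T \<Longrightarrow> k \<in> {1..p} \<Longrightarrow> adj B (nb B k)"
  and nb_lab: "B \<in> T \<Longrightarrow> k \<in> {1..p} \<Longrightarrow> lab (B \<inter> nb B k) = k"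
  using nb_exists[of B k] nb_eq[of B] by auto

lemma nb_T: "B \<in> T \<Longrightarrow> k \<in> {1..p} \<Longrightarrow> nb B k \<in> T"
  using nb_adj adj_T by blast

lemma nb_nb: "B \<in> T \<Longrightarrow> k \<in> {1..p} \<Longrightarrow> nb (nb B k) k = B"
  using nb_eq[OF adj_sym[OF nb_adj]] nb_lab by (metis Int_commute)

lemma nb_neq: "B \<in> T \<Longrightarrow> k \<in> {1..p} \<Longrightarrow> nb B k \<noteq> B"
  using nb_adj unfolding adj_def share_edge_def by metis

lemma lab_range: "adj B C \<Longrightarrow> lab (B \<inter> C) \<in> {1..p}"
proof -
  assume a: "adj B C"
  obtain W where W: "lgon W B" using lgon_exists adj_T[OF a] by blast
  then have "gon p W B" unfolding lgon_def by blast
  then obtain i where "B \<inter> C = gside W i" using adj_edge[OF a] by blast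
  moreover have "nat (i mod int p) < p" using p_ge_3 by (simp add: nat_less_iff)
  ultimately show ?thesis using W unfolding lgon_def by simp
qed

text \<open>For distinct letters, \<open>v\<close> is the vertex of \<open>C\<close> at which the
  edges labelled \<open>a\<close> and \<open>b\<close> meet.\<close>

definition corner :: "complex \<Rightarrow> nat \<Rightarrow> nat \<Rightarrow> complex set \<Rightarrow> bool" where
  "corner v a b C \<longleftrightarrow> C \<in> T \<and> v \<in> C \<inter> nb C a \<and> v \<in> C \<inter> nb C b"

text \<open>The reflection over the edge labelled \<open>a\<close> fixes \<open>v\<close> and
  preserves labels, so it takes the edge labelled \<open>b\<close> of \<open>C\<close> to that of
  the neighbour.\<close>

lemma corner_nb:
  assumes c: "corner v a b C" and ab: "a \<in> {1..p}" "b \<in> {1..p}"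
  shows "corner v a b (nb C a)"
proof -
  have C: "C \<in> T" and v: "v \<in> C \<inter> nb C a" "v \<in> C \<inter> nb C b" using c unfolding corner_def by auto
  define D where "D = nb C a"
  have a: "adj C D" unfolding D_def by (rule nb_adj[OF C ab(1)])
  have D: "D \<in> T" using adj_T[OF a] by blast
  obtain W where W: "lgon W C" using lgon_exists C by blast
  then have g: "gon p W C" unfolding lgon_def by blast
  obtain n c where w: "wall n c" and e: "C \<inter> D \<subseteq> {x. n \<bullet> x = c}"
    using adj_wall[OF a g] by metis
  note nc = wall_less[OF w]
  let ?r = "hrefl n c"
  have rC: "?r ` C = D" using adj_hrefl[OF nc a e] .
  have rv: "?r v = v" using hrefl_eq_iff[OF nc] v e tile_hplane[OF C] unfolding D_def by blast
  have ar: "adj D (?r ` nb C b)" using hrefl_adj[OF w nb_adj[OF C ab(2)]] rC by simp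
  have "inj_on ?r hplane" using hrefl_inj[OF nc] by (simp add: inj_on_def)
  then have i: "D \<inter> ?r ` nb C b = ?r ` (C \<inter> nb C b)"
    using tile_hplane[OF C] tile_hplane[OF nb_T[OF C ab(2)]] rC by (metis inj_on_image_Int)
  have "C \<inter> nb C b \<in> tiling_edges T"
    using nb_adj[OF C ab(2)] unfolding adj_def share_edge_def tiling_edges_def by blast
  then have "lab (D \<inter> ?r ` nb C b) = b" using i lab_hrefl[OF w] nb_lab[OF C ab(2)] by simp
  then have "nb D b = ?r ` nb C b" using nb_eq[OF ar] by simp
  then have "v \<in> D \<inter> nb D b" using i v rv by force
  moreover have "v \<in> D \<inter> nb D a" unfolding D_def nb_nb[OF C ab(1)] using v by blast
  ultimately show ?thesis using D unfolding corner_def D_def by blast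
qed

lemma corner_commute: "corner v a b C \<longleftrightarrow> corner v b a C"
  unfolding corner_def by blast

text \<open>Distinct sides meet only in vertices, and exactly two sides, with successive numbers,
  contain a given vertex.\<close>

lemma corner_vertex:
  assumes c: "corner v a b C" and ab: "a \<in> {1..p}" "b \<in> {1..p}" "a \<noteq> b"
  shows "v extreme_point_of C" "\<And>D. adj C D \<Longrightarrow> v \<in> D \<Longrightarrow> D = nb C a \<or> D = nb C b"
    "consecutive_letters p a b"
proof -
  have C: "C \<in> T" and v: "v \<in> C \<inter> nb C a" "v \<in> C \<inter> nb C b" using c unfolding corner_def by auto
  obtain W where W: "lgon W C" using lgon_exists C by blast
  then have g: "gon p W C" unfolding lgon_def by blast
  have lW: "lab (gside W i) = Suc (nat (i mod int p))" for i using W unfolding lgon_def by blast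
  obtain i where i: "C \<inter> nb C a = gside W i" using adj_edge[OF nb_adj[OF C ab(1)] g] by blast
  obtain j where j: "C \<inter> nb C b = gside W j" using adj_edge[OF nb_adj[OF C ab(2)] g] by blast
  have la: "lab (gside W i) = a" "lab (gside W j) = b" using nb_lab[OF C] ab i j by metis+
  then have ne: "gside W i \<noteq> gside W j" using ab by metis
  then obtain m where m: "v = W m" using gside_inter[OF g] v i j by blast
  then show "v extreme_point_of C" using W_extreme[OF g] by blast
  have at: "gside W k = gside W m \<or> gside W k = gside W (m - 1)" if "v \<in> gside W k" for k
  proof -
    have "int p dvd m - k \<or> int p dvd m - (k + 1)"
      using that W_in_gside[OF g, of m k] unfolding m W_eq_dvd[OF g] by blast
    then show ?thesis unfolding gside_eq_dvd[OF g] by (metis diff_diff_add diff_minus_eq_add dvd_minus_iff minus_diff_eq add.commute diff_diff_eq2)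
  qed
  have ij: "gside W i = gside W m \<and> gside W j = gside W (m - 1) \<or> gside W i = gside W (m - 1) \<and> gside W j = gside W m"
    using at[of i] at[of j] v i j ne by metis
  show "D = nb C a \<or> D = nb C b" if D: "adj C D" "v \<in> D" for D
  proof -
    obtain k where k: "C \<inter> D = gside W k" using adj_edge[OF D(1) g] by blast
    then have "gside W k = gside W i \<or> gside W k = gside W j" using at[of k] ij D(2) v by auto
    then have "lab (C \<inter> D) = a \<or> lab (C \<inter> D) = b" using la k by metis
    then show ?thesis using nb_eq[OF D(1)] by metis
  qed
  define u where "u = m mod int p"
  have u: "0 \<le> u" "u < int p" using p_ge_3 unfolding u_def by auto
  have "lab (gside W m) = Suc (nat u)" using lW unfolding u_def .
  \<comment> \<open>The wrap-around case gives the pair of letters \<open>p\<close>, 1.\<close>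
  moreover have "lab (gside W (m - 1)) = (if u = 0 then p else nat u)"
  proof -
    have "(m - 1) mod int p = (u - 1) mod int p" unfolding u_def by (simp add: mod_simps)
    also have "\<dots> = (if u = 0 then int p - 1 else u - 1)"
    proof (cases "u = 0")
      case True
      then show ?thesis using p_ge_3 by (simp add: zmod_minus1)
    next
      case False
      then show ?thesis using u by simp
    qed
    finally show ?thesis unfolding lW using u p_ge_3 by auto
  qed
  ultimately show "consecutive_letters p a b"
    using ij la ab u unfolding consecutive_letters_def by (cases "u = 0") auto
qed

lemma consecutive_corner:
  assumes cl: "consecutive_letters p a b" and B: "B \<in> T"
  shows "\<exists>v. corner v a b B" and "a \<noteq> b" and "a \<in> {1..p}" and "b \<in> {1..p}"
proof -
  show ab: "a \<noteq> b" "a \<in> {1..p}" "b \<in> {1..p}" using cl p_ge_3 unfolding consecutive_letters_def by auto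
  obtain W where W: "lgon W B" using lgon_exists B by blast
  then have g: "gon p W B" unfolding lgon_def by blast
  have lW: "lab (gside W i) = Suc (nat (i mod int p))" for i using W unfolding lgon_def by blast
  have edge: "B \<inter> nb B (lab (gside W i)) = gside W i" for i
    using neighbour_adj[OF B g, of i] nb_eq by metis
  have s: "\<exists>v. corner v (lab (gside W i)) (lab (gside W (i + 1))) B" for i
    unfolding corner_def edge using B unfolding gside_def by (intro exI[of _ "W (i + 1)"]) auto
  have l: "lab (gside W (int k - 1)) = k" if "k \<in> {1..p}" for k
  proof -
    have "(int k - 1) mod int p = int k - 1" using that by (intro mod_pos_pos_trivial) auto
    moreover have "Suc (nat (int k - 1)) = k" using that by auto
    ultimately show ?thesis using lW[of "int k - 1"] by simp
  qed
  have l1: "lab (gside W (int p - 1 + 1)) = 1" using lW[of "int p - 1 + 1"] by simp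
  have lS: "lab (gside W (int k - 1 + 1)) = k + 1" if "k \<in> {1..p}" "k + 1 \<in> {1..p}" for k
    using l[OF that(2)] by simp
  have *: "\<exists>v. corner v a b B" if "b = a + 1 \<or> (a = p \<and> b = 1)" "a \<in> {1..p}" "b \<in> {1..p}" for a b
  proof (cases "b = a + 1")
    case True
    then show ?thesis using s[of "int a - 1"] l[OF that(2)] lS[of a] that by simp
  next
    case False
    then show ?thesis using s[of "int p - 1"] l[OF that(2)] l1 that by simp
  qed
  show "\<exists>v. corner v a b B"
    using *[of a b] *[of b a] cl corner_commute unfolding consecutive_letters_def by blast
qed

text \<open>A punctured disc around \<open>v\<close> is connected, and tiles at \<open>v\<close>
  that meet in it share an edge at \<open>v\<close>. By \<open>corner_vertex\<close> that edge is
  labelled \<open>a\<close> or \<open>b\<close>. The set \<open>S\<close> lets the conclusion be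
  used as an induction over crossings of these edges.\<close>

lemma corner_connected:
  assumes c: "corner v a b B" and ab: "a \<in> {1..p}" "b \<in> {1..p}" "a \<noteq> b"
    and S: "B \<in> S" "\<And>y. y \<in> S \<Longrightarrow> nb y a \<in> S \<and> nb y b \<in> S"
    and C: "C \<in> T" "v \<in> C"
  shows "C \<in> S" "corner v a b C"
proof -
  let ?X = "{B \<in> T. v \<in> B}"
  let ?R = "\<lambda>C D. adj C D \<and> v \<in> C \<inter> D"
  have B: "B \<in> ?X" using c unfolding corner_def by blast
  have vh: "v \<in> hplane" using B tile_hplane by blast
  obtain eps where e: "eps > 0" "ball v eps \<subseteq> hplane" "\<And>y B. y \<in> ball v eps \<Longrightarrow> B \<in> T \<Longrightarrow> y \<in> B \<Longrightarrow> v \<in> B"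
    using local_tiles[OF vh] by metis
  \<comment> \<open>A tile at \<open>v\<close> is convex and contains a second point, so it reaches
    into the punctured disc.\<close>
  have pts: "D \<inter> (ball v eps - {v}) \<noteq> {}" if D: "D \<in> ?X" for D
  proof -
    obtain z where z: "z \<in> interior D" using tile_interior D by blast
    have "interior D - {v} \<noteq> {}"
    proof
      assume "interior D - {v} = {}"
      then have "interior D \<subseteq> {v}" by blast
      then have "interior D \<subseteq> interior {v}" by (meson interior_maximal open_interior)
      then show False using z by (simp add: interior_singleton)
    qed
    then obtain z where z: "z \<in> D" "z \<noteq> v" using interior_subset by blast
    obtain t where t: "0 < t" "t < 1" "v + t *\<^sub>R (z - v) \<in> ball v eps" using point_toward[OF e(1)] by metis
    have "v + t *\<^sub>R (z - v) = (1 - t) *\<^sub>R v + t *\<^sub>R z" by (simp add: algebra_simps)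
    moreover have "\<dots> \<in> D" using D z t tile_convex[of D] by (intro convexD_alt) auto
    ultimately have "v + t *\<^sub>R (z - v) \<in> D \<inter> (ball v eps - {v})" using t z by auto
    then show ?thesis by blast
  qed
  have "?R\<^sup>*\<^sup>* B C"
  proof (rule tiles_connected[where F = ?X and S = "ball v eps - {v}"])
    show "connected (ball v eps - {v})" by (rule connected_open_diff_countable) auto
    show "ball v eps - {v} \<subseteq> \<Union> ?X" using e cover by blast
    fix A D x assume A: "A \<in> ?X" "D \<in> ?X" "x \<in> A" "x \<in> D" "x \<in> ball v eps - {v}"
    show "?R\<^sup>*\<^sup>* A D"
    proof (cases "A = D")
      case False
      have "v \<in> A \<inter> D" "x \<noteq> v" using A by auto
      then have "share_edge A D" using inter_share_edge[of A D v] A False by blast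
      then have "?R A D" using A unfolding adj_def by blast
      then show ?thesis by blast
    qed simp
  next
    show "B \<inter> (ball v eps - {v}) \<noteq> {}" by (rule pts[OF B])
    show "C \<inter> (ball v eps - {v}) \<noteq> {}" by (rule pts) (use C in blast)
  qed (use B C e in \<open>auto intro: rtranclp_trans\<close>)
  then have "C \<in> S \<and> corner v a b C"
  proof (induction rule: rtranclp_induct)
    case base
    then show ?case using S(1) c by blast
  next
    case (step C D)
    have cC: "corner v a b C" using step by blast
    have "D = nb C a \<or> D = nb C b" using corner_vertex(2)[OF cC ab] step by blast
    then show ?case
      using S(2) step corner_nb[OF cC ab(1,2)] corner_nb[of v b a C] cC ab corner_commute by metis
  qed
  then show "C \<in> S" "corner v a b C" by auto
qed

text \<open>At a local minimum of the distance among the tiles at \<open>v\<close>, the base tile lies in the cone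
  spanned by the tile at \<open>v\<close>; cones of different tiles have disjoint interiors.\<close>

lemma local_min_unique:
  assumes C: "corner v a b C" and D: "corner v a b D" and ab: "a \<in> {1..p}" "b \<in> {1..p}" "a \<noteq> b"
    and "tdist (nb C a) = Suc (tdist C)" "tdist (nb C b) = Suc (tdist C)"
    and "tdist (nb D a) = Suc (tdist D)" "tdist (nb D b) = Suc (tdist D)"
  shows "C = D"
proof (rule ccontr)
  assume "C \<noteq> D"
  obtain z where z: "z \<in> interior A0" using tile_interior[OF A0] by blast
  have *: "\<exists>eps>0. \<forall>t>0. v + t *\<^sub>R (z - v) \<in> ball v eps \<longrightarrow> v + t *\<^sub>R (z - v) \<in> interior C"
    if C: "corner v a b C" and m: "tdist (nb C a) = Suc (tdist C)" "tdist (nb C b) = Suc (tdist C)" for C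
  proof -
    have CT: "C \<in> T" and vC: "v \<in> C" using C unfolding corner_def by auto
    obtain W where W: "posgon p W C" using tile_posgon[OF CT] by blast
    note g = pg_gon[OF W]
    obtain eps where e: "eps > 0" "\<And>y. y \<in> ball v eps \<Longrightarrow> (\<And>i. eform W i v = 0 \<Longrightarrow> 0 < eform W i y) \<Longrightarrow> y \<in> interior C"
      using local_cone[OF W vC] by metis
    have "eform W i z > 0" if i: "eform W i v = 0" for i
    proof -
      have vi: "v \<in> gside W i" using eform_zero[OF W vC] i by blast
      obtain E where E: "adj C E" "C \<inter> E = gside W i" using neighbour_adj[OF CT g] by blast
      then have "E = nb C a \<or> E = nb C b" using corner_vertex(2)[OF C ab] vi by blast
      then have t: "tdist E = Suc (tdist C)" using m by blast
      let ?n = "edge_normal W i"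
      let ?c = "edge_offset W i"
      have w: "wall ?n ?c" by (rule edge_wall[OF CT g])
      have l: "C \<inter> E \<subseteq> {x. ?n \<bullet> x = ?c}" using E(2) eform_exposed[OF g, of i] unfolding eform_inner by auto
      have "side_of ?n ?c C" using eform_nonneg[OF W] unfolding side_of_def eform_inner by simp
      then have "side_of ?n ?c A0" using tdist_wall[OF E(1) w l] t by auto
      then show ?thesis using wall_interior[OF w A0 z] unfolding eform_inner by simp
    qed
    then have "v + t *\<^sub>R (z - v) \<in> interior C" if "t > 0" "v + t *\<^sub>R (z - v) \<in> ball v eps" for t
      using e(2)[OF that(2)] that(1) by (simp add: eform_toward)
    then show ?thesis using e(1) by blast
  qed
  obtain d1 where 1: "d1 > 0" "\<And>t. t > 0 \<Longrightarrow> v + t *\<^sub>R (z - v) \<in> ball v d1 \<Longrightarrow> v + t *\<^sub>R (z - v) \<in> interior C"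
    using *[OF C] assms by blast
  obtain d2 where 2: "d2 > 0" "\<And>t. t > 0 \<Longrightarrow> v + t *\<^sub>R (z - v) \<in> ball v d2 \<Longrightarrow> v + t *\<^sub>R (z - v) \<in> interior D"
    using *[OF D] assms by blast
  obtain t where t: "0 < t" "v + t *\<^sub>R (z - v) \<in> ball v (min d1 d2)"
    using point_toward[of "min d1 d2" v z] 1 2 by (metis min_less_iff_conj)
  then have "v + t *\<^sub>R (z - v) \<in> interior C \<inter> interior D" using 1(2) 2(2) by simp
  then show False using disj \<open>C \<noteq> D\<close> C D unfolding corner_def by blast
qed

text \<open>The tiling has \<open>q\<close> tiles at \<open>v\<close>, on which crossing
  \<open>a\<close> and crossing \<open>b\<close> are involutions without fixed points; they act
  transitively by \<open>corner_connected\<close>.\<close>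

lemma vertex_cycle:
  assumes c: "corner v a b B" and ab: "a \<in> {1..p}" "b \<in> {1..p}" "a \<noteq> b"
  defines "f \<equiv> \<lambda>C. nb C a" and "g \<equiv> \<lambda>C. nb C b"
  shows "even q" "walk f g B q = B" "inj_on (walk f g B) {..<q}"
    "\<And>n. n \<le> q \<Longrightarrow> walk g f B n = walk f g B (q - n)" "\<And>n. corner v a b (walk f g B n)" "0 < q"
proof -
  let ?X = "{B \<in> T. v \<in> B}"
  have B: "B \<in> ?X" using c unfolding corner_def by blast
  have corner: "corner v a b C" if "C \<in> ?X" for C
    using corner_connected(2)[OF c ab, of UNIV C] that by blast
  have step: "C \<in> ?X \<Longrightarrow> f C \<in> ?X \<and> g C \<in> ?X" for C
    using corner nb_T ab unfolding corner_def f_def g_def by blast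
  have "?X = {B \<in> T. B \<inter> {v} \<noteq> {}}" by blast
  moreover have "finite {B \<in> T. B \<inter> {v} \<noteq> {}}" by (rule locfin) (use B tile_hplane in auto)
  ultimately have fin: "finite ?X" by simp
  have cX: "card ?X = q" using card_vertex corner_vertex(1)[OF c ab] B by blast
  show "0 < q" using cX fin B by (metis card_gt_0_iff empty_iff)
  have cl: "?X \<subseteq> S" if S: "B \<in> S" "S \<subseteq> ?X" "\<And>y. y \<in> S \<Longrightarrow> f y \<in> S \<and> g y \<in> S" for S
    using corner_connected(1)[OF c ab S(1)] S(3) unfolding f_def g_def by blast
  have inv: "f C \<in> ?X \<and> f (f C) = C \<and> f C \<noteq> C" "g C \<in> ?X \<and> g (g C) = C \<and> g C \<noteq> C" if "C \<in> ?X" for C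
    using step[OF that] that nb_nb nb_neq ab unfolding f_def g_def by auto
  show "even q" "walk f g B q = B" "inj_on (walk f g B) {..<q}"
    "\<And>n. n \<le> q \<Longrightarrow> walk g f B n = walk f g B (q - n)"
    using walk_two_involutions[OF fin B cX inv cl] by blast+
  have "walk f g B n \<in> ?X" for n by (induction n) (use B step in auto)
  then show "corner v a b (walk f g B n)" for n using corner by blast
qed

lemma walk_exchange:
  assumes cl: "consecutive_letters p a b" and B: "B \<in> T"
  shows "walk (\<lambda>C. nb C a) (\<lambda>C. nb C b) B (q div 2) = walk (\<lambda>C. nb C b) (\<lambda>C. nb C a) B (q div 2)"
proof -
  obtain v where v: "corner v a b B" using consecutive_corner(1)[OF cl B] by blast
  note ab = consecutive_corner(3,4,2)[OF cl B]
  have "q - q div 2 = q div 2" using vertex_cycle(1)[OF v ab] by auto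
  then show ?thesis using vertex_cycle(4)[OF v ab, of "q div 2"] by simp
qed

text \<open>\<open>descents_meet\<close> provides the vertex. Along the cycle around it neighbouring
  distances differ by one and \<open>local_min_unique\<close> leaves a single local minimum, so
  \<open>unimodal\<close> applies.\<close>

lemma walk_descent:
  assumes B: "B \<in> T" and ab: "a \<in> {1..p}" "b \<in> {1..p}" "a \<noteq> b"
    and lt: "tdist (nb B a) < tdist B" "tdist (nb B b) < tdist B"
  shows "consecutive_letters p a b"
    and "n \<le> q div 2 \<Longrightarrow> tdist (walk (\<lambda>C. nb C a) (\<lambda>C. nb C b) B n) + n = tdist B"
proof -
  obtain v where "v \<in> B \<inter> nb B a \<inter> (B \<inter> nb B b)"
    using descents_meet[OF nb_adj[OF B ab(1)] nb_adj[OF B ab(2)] lt] by blast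
  then have v: "corner v a b B" using B unfolding corner_def by blast
  show "consecutive_letters p a b" by (rule corner_vertex(3)[OF v ab])
  let ?w = "walk (\<lambda>C. nb C a) (\<lambda>C. nb C b) B"
  note cyc = vertex_cycle[OF v ab]
  have wT: "?w n \<in> T" for n using cyc(5) unfolding corner_def by blast
  have adjw: "adj (?w n) (?w (Suc n))" for n using nb_adj[OF wT] ab by simp
  have q2: "2 \<le> q" using cyc(1,6) by presburger
  have w1: "tdist B = Suc (tdist (?w 1))" using tdist_adj[OF nb_adj[OF B ab(1)]] lt by simp
  \<comment> \<open>The walk with the letters swapped runs the cycle backwards, so its first tile is
    the last one before the return to \<open>B\<close>.\<close>
  have wq: "?w (q - 1) = nb B b" using cyc(4)[of 1] q2 by simp
  show "tdist (?w n) + n = tdist B" if n: "n \<le> q div 2"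
  proof -
    have "tdist (?w n) + n = tdist (?w 0)"
    proof (rule unimodal[where q = q and \<phi> = "\<lambda>n. tdist (?w n)"])
      show "tdist (?w q) = tdist (?w 0)" using cyc(2) by simp
      show "0 < q" by (rule cyc(6))
      show "tdist (?w n) = Suc (tdist (?w (Suc n))) \<or> tdist (?w (Suc n)) = Suc (tdist (?w n))" for n
        by (rule tdist_adj[OF adjw])
      show "tdist (?w 0) = Suc (tdist (?w 1))" using w1 by simp
      show "tdist (?w 0) = Suc (tdist (?w (q - 1)))"
        unfolding wq using tdist_adj[OF nb_adj[OF B ab(2)]] lt by simp
      \<comment> \<open>The previous and the next tile of the walk are the neighbours across
        \<open>a\<close> and \<open>b\<close>, in an order that depends on the parity of
        \<open>i\<close>.\<close>
      have min: "tdist (nb (?w i) a) = Suc (tdist (?w i)) \<and> tdist (nb (?w i) b) = Suc (tdist (?w i))"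
        if i: "0 < i" "tdist (?w (i - 1)) = Suc (tdist (?w i))" "tdist (?w (Suc i)) = Suc (tdist (?w i))" for i
      proof -
        obtain k where k: "i = Suc k" using i(1) gr0_implies_Suc by blast
        have "nb (?w i) (if even k then a else b) = ?w k"
          unfolding k using nb_nb[OF wT] ab by simp
        moreover have "nb (?w i) (if even k then b else a) = ?w (Suc i)" unfolding k by simp
        ultimately show ?thesis using i(2,3) unfolding k by (cases "even k") (simp_all del: walk.simps)
      qed
      show "i = j" if "0 < i" "i < q" "0 < j" "j < q"
        "tdist (?w (i - 1)) = Suc (tdist (?w i))" "tdist (?w (Suc i)) = Suc (tdist (?w i))"
        "tdist (?w (j - 1)) = Suc (tdist (?w j))" "tdist (?w (Suc j)) = Suc (tdist (?w j))" for i j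
      proof -
        have "?w i = ?w j"
          using local_min_unique[OF cyc(5) cyc(5) ab] min[OF that(1,5,6)] min[OF that(3,7,8)] by blast
        then show ?thesis using cyc(3) that unfolding inj_on_def by blast
      qed
    qed (rule n)
    then show ?thesis by simp
  qed
qed

end

section \<open>Words and geodesics\<close>

lemma words_append [simp]: "u @ v \<in> words p \<longleftrightarrow> u \<in> words p \<and> v \<in> words p"
  unfolding words_def by auto

lemma words_Cons [simp]: "k # v \<in> words p \<longleftrightarrow> k \<in> {1..p} \<and> v \<in> words p"
  unfolding words_def by auto

lemma words_Nil [simp]: "[] \<in> words p"
  unfolding words_def by auto

lemma words_rev [simp]: "rev w \<in> words p \<longleftrightarrow> w \<in> words p"
  unfolding words_def by auto

lemma alternating_0 [simp]: "alternating 0 a b = []"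
  unfolding alternating_def by simp

lemma alternating_snoc: "alternating (Suc m) a b = alternating m a b @ [if even m then a else b]"
  unfolding alternating_def by simp

lemma alternating_Cons: "alternating (Suc m) a b = a # alternating m b a"
  by (induction m) (simp_all add: alternating_snoc)

lemma length_alternating [simp]: "length (alternating m a b) = m"
  unfolding alternating_def by simp

lemma alternating_words: "a \<in> {1..p} \<Longrightarrow> b \<in> {1..p} \<Longrightarrow> alternating m a b \<in> words p"
  by (induction m) (auto simp: alternating_snoc)

lemma rev_alternating: "rev (alternating m a b) = (if even m then alternating m b a else alternating m a b)"
  by (induction m arbitrary: a b) (simp_all add: alternating_Cons, simp_all add: alternating_snoc flip: alternating_Cons)

lemma alternating_add: "\<exists>r. alternating (m + k) a b = alternating m a b @ r"
  by (induction k) (auto simp: alternating_snoc)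

lemma exchange_context: "exchange p q w w' \<Longrightarrow> exchange p q (x @ w @ y) (x @ w' @ y)"
  unfolding exchange_def by (metis append.assoc)

lemma exchange_rtrancl_append: "(exchange p q)\<^sup>*\<^sup>* w w' \<Longrightarrow> (exchange p q)\<^sup>*\<^sup>* (w @ y) (w' @ y)"
proof (induction rule: rtranclp_induct)
  case (step u v)
  then show ?case using exchange_context[of p q u v "[]" y] by (simp add: rtranclp.rtrancl_into_rtrancl)
qed simp

lemma exchange_rtrancl_sym: "(exchange p q)\<^sup>*\<^sup>* w w' \<Longrightarrow> (exchange p q)\<^sup>*\<^sup>* w' w"
  using exchange_sym by (metis sympI sympD symp_rtranclp)

lemma exchange_words: "exchange p q w w' \<Longrightarrow> w \<in> words p \<longleftrightarrow> w' \<in> words p"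
  unfolding exchange_def consecutive_letters_def by (auto simp: alternating_words)

lemma exchange_length: "exchange p q w w' \<Longrightarrow> length w = length w'"
  unfolding exchange_def by auto

lemma exchange_rtrancl_words: "(exchange p q)\<^sup>*\<^sup>* w w' \<Longrightarrow> w \<in> words p \<Longrightarrow> w' \<in> words p \<and> length w' = length w"
  by (induction rule: rtranclp_induct) (use exchange_words exchange_length in \<open>auto simp: exchange_words\<close>)

section \<open>The action of words on tiles\<close>

context ltiling
begin

abbreviation act :: "complex set \<Rightarrow> nat list \<Rightarrow> complex set" where
  "act \<equiv> foldl nb"

lemma act_T: "B \<in> T \<Longrightarrow> w \<in> words p \<Longrightarrow> act B w \<in> T"
  by (induction w arbitrary: B) (simp_all add: nb_T)

lemma act_rev: "B \<in> T \<Longrightarrow> w \<in> words p \<Longrightarrow> act (act B w) (rev w) = B"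
proof (induction w arbitrary: B)
  case (Cons k w)
  then show ?case using Cons.IH[of "nb B k"] nb_T nb_nb by simp
qed simp

lemma act_alternating: "act B (alternating m a b) = walk (\<lambda>C. nb C a) (\<lambda>C. nb C b) B m"
  by (induction m) (simp_all add: alternating_snoc)

lemma act_exchange:
  assumes "exchange p q w w'" "B \<in> T" "w \<in> words p"
  shows "act B w = act B w'"
proof -
  obtain x y a b where *: "consecutive_letters p a b" "w = x @ alternating (q div 2) a b @ y"
    "w' = x @ alternating (q div 2) b a @ y" using assms(1) unfolding exchange_def by blast
  then have "act B x \<in> T" using assms act_T by simp
  then show ?thesis using walk_exchange[OF *(1)] * by (simp add: act_alternating)
qed

lemma act_exchange_rtrancl:
  assumes "(exchange p q)\<^sup>*\<^sup>* w w'" "B \<in> T" "w \<in> words p"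
  shows "act B w = act B w'"
  using assms
proof (induction rule: rtranclp_induct)
  case (step u v)
  then show ?case using act_exchange exchange_rtrancl_words by metis
qed simp

lemma tdist_nb: "B \<in> T \<Longrightarrow> k \<in> {1..p} \<Longrightarrow> tdist B = Suc (tdist (nb B k)) \<or> tdist (nb B k) = Suc (tdist B)"
  using tdist_adj nb_adj by blast

lemma tdist_act_le:
  assumes "B \<in> T" "w \<in> words p"
  shows "tdist (act B w) \<le> tdist B + length w"
  using assms
proof (induction w arbitrary: B)
  case (Cons k w)
  have "tdist (act (nb B k) w) \<le> tdist (nb B k) + length w" using Cons nb_T by simp
  then show ?case using Cons.prems tdist_nb[of B k] by auto
qed simp

lemma geodesic_word:
  assumes "B \<in> T"
  shows "\<exists>w\<in>words p. length w = tdist B \<and> act A0 w = B"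
proof -
  have "\<exists>w\<in>words p. length w = n \<and> act A0 w = B" if "(adj ^^ n) A0 B" for n
    using that
  proof (induction n arbitrary: B)
    case 0
    then show ?case by (intro bexI[of _ "[]"]) auto
  next
    case (Suc n)
    then obtain C where C: "(adj ^^ n) A0 C" "adj C B" by (auto elim: relpowp_Suc_E)
    then obtain w where "w \<in> words p" "length w = n" "act A0 w = C" using Suc by blast
    then show ?case using nb_eq[OF C(2)] lab_range[OF C(2)]
      by (intro bexI[of _ "w @ [lab (C \<inter> B)]"]) auto
  qed
  then show ?thesis using tdist_path[OF assms] by blast
qed

lemma q_pos: "1 \<le> q div 2"
proof -
  have p1: "1 \<in> {1..p}" "2 \<in> {1..p}" using p_ge_3 by auto
  then have "consecutive_letters p 1 2" unfolding consecutive_letters_def by simp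
  then obtain v where v: "corner v 1 2 A0" using consecutive_corner(1) A0 by blast
  have "even q" "0 < q" using vertex_cycle(1)[OF v p1] vertex_cycle(6)[OF v p1] by auto
  then show ?thesis by presburger
qed

text \<open>Matsumoto's argument: two geodesics with different last letters \<open>s\<close>, \<open>t\<close> are compared with
  geodesics that run around the common vertex of the last two edges.\<close>

lemma geodesics_exchange:
  assumes "w \<in> words p" "w' \<in> words p" "act A0 w = act A0 w'"
    "length w = tdist (act A0 w)" "length w' = tdist (act A0 w')"
  shows "(exchange p q)\<^sup>*\<^sup>* w w'"
  using assms
proof (induction "length w" arbitrary: w w' rule: less_induct)
  case less
  show ?case
  proof (cases "w = []")
    case True
    then show ?thesis using less by simp
  next
    case False
    have "w' \<noteq> []" using less(4-6) False by auto
    then obtain u s u' t where w: "w = u @ [s]" and w': "w' = u' @ [t]" using False by (metis rev_exhaust)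
    define B where "B = act A0 w"
    have B: "B \<in> T" unfolding B_def using act_T A0 less by blast
    have us: "u \<in> words p" "s \<in> {1..p}" and ut: "u' \<in> words p" "t \<in> {1..p}" using less w w' by auto
    have Bu: "nb (act A0 u) s = B" "nb (act A0 u') t = B" using less(4) w w' B_def by auto
    then have au: "act A0 u = nb B s" and au': "act A0 u' = nb B t"
      using nb_nb[OF act_T[OF A0 us(1)] us(2)] nb_nb[OF act_T[OF A0 ut(1)] ut(2)] by auto
    have len: "length w = tdist B" "length w' = tdist B" using less B_def by auto
    have du: "length u = tdist (nb B s)" "tdist (nb B s) < tdist B"
      using tdist_act_le[OF A0 us(1)] tdist_nb[OF B us(2)] len w au by auto
    have du': "length u' = tdist (nb B t)" "tdist (nb B t) < tdist B"
      using tdist_act_le[OF A0 ut(1)] tdist_nb[OF B ut(2)] len w' au' by auto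
    show ?thesis
    proof (cases "s = t")
      case True
      then have "(exchange p q)\<^sup>*\<^sup>* u u'" using less(1)[of u u'] us ut au au' du du' w by simp
      then show ?thesis using exchange_rtrancl_append w w' True by metis
    next
      case False
      define m where "m = q div 2"
      have cl: "consecutive_letters p s t" by (rule walk_descent(1)[OF B us(2) ut(2) False du(2) du'(2)])
      define M where "M = act B (alternating m s t)"
      have M': "M = act B (alternating m t s)"
        unfolding M_def act_alternating m_def by (rule walk_exchange[OF cl B])
      have dM: "tdist M + m = tdist B"
        unfolding M_def act_alternating m_def
        by (rule walk_descent(2)[OF B us(2) ut(2) False du(2) du'(2)]) simp
      have alt: "alternating k s t \<in> words p" "alternating k t s \<in> words p" for k
        using us ut by (auto intro: alternating_words)
      have MT: "M \<in> T" unfolding M_def using act_T B alt by blast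
      \<comment> \<open>A geodesic to the tile opposite to \<open>B\<close> at the vertex; continued
        along either way around the vertex, it becomes a geodesic to \<open>B\<close>, since
        \<open>dM\<close> makes the lengths add up.\<close>
      obtain z where z: "z \<in> words p" "length z = tdist M" "act A0 z = M" using geodesic_word[OF MT] by blast
      have zs: "act A0 (z @ rev (alternating m s t)) = B"
        using act_rev[OF B alt(1)] z unfolding M_def by simp
      have zt: "act A0 (z @ rev (alternating m t s)) = B"
        using act_rev[OF B alt(2)] z unfolding M' by simp
      obtain m' where m': "m = Suc m'" using q_pos unfolding m_def by (cases "q div 2") auto
      have rs: "rev (alternating m s t) = rev (alternating m' t s) @ [s]"
        and rt: "rev (alternating m t s) = rev (alternating m' s t) @ [t]"
        unfolding m' alternating_Cons by simp_all
      have "act A0 (z @ rev (alternating m' t s)) = nb B s"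
      proof -
        have "nb (act A0 (z @ rev (alternating m' t s))) s = B" using zs unfolding rs by simp
        then show ?thesis using nb_nb[OF act_T[OF A0] us(2)] z(1) alt words_append words_rev by metis
      qed
      \<comment> \<open>Without the common last letter both words are geodesics to the same
        neighbour of \<open>B\<close>, and they are shorter.\<close>
      then have 1: "(exchange p q)\<^sup>*\<^sup>* u (z @ rev (alternating m' t s))"
        using less(1)[of u "z @ rev (alternating m' t s)"] us au du w z alt dM m' len by simp
      have "act A0 (z @ rev (alternating m' s t)) = nb B t"
      proof -
        have "nb (act A0 (z @ rev (alternating m' s t))) t = B" using zt unfolding rt by simp
        then show ?thesis using nb_nb[OF act_T[OF A0] ut(2)] z(1) alt words_append words_rev by metis
      qed
      then have 2: "(exchange p q)\<^sup>*\<^sup>* u' (z @ rev (alternating m' s t))"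
        using less(1)[of u' "z @ rev (alternating m' s t)"] ut au' du' w w' z alt dM m' len by simp
      \<comment> \<open>Reversal of an alternating word swaps its letters exactly for even length,
        hence the case distinction in the witnesses.\<close>
      have "exchange p q (z @ rev (alternating m s t)) (z @ rev (alternating m t s))"
      proof -
        have "exchange p q (rev (alternating m s t)) (rev (alternating m t s))"
          unfolding rev_alternating m_def exchange_def
          using cl exchange_sym unfolding consecutive_letters_def
          by (intro exI[of _ "[]"] exI[of _ "if even (q div 2) then t else s"]
              exI[of _ "if even (q div 2) then s else t"]) auto
        then show ?thesis using exchange_context[of p q _ _ z "[]"] by simp
      qed
      then have "(exchange p q)\<^sup>*\<^sup>* (z @ rev (alternating m s t)) (z @ rev (alternating m t s))" by blast
      moreover have "(exchange p q)\<^sup>*\<^sup>* w (z @ rev (alternating m s t))"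
        using exchange_rtrancl_append[OF 1, of "[s]"] unfolding w rs by simp
      moreover have "(exchange p q)\<^sup>*\<^sup>* (z @ rev (alternating m t s)) w'"
        using exchange_rtrancl_sym[OF exchange_rtrancl_append[OF 2, of "[t]"]] unfolding w' rt by simp
      ultimately show ?thesis by (meson rtranclp_trans)
    qed
  qed
qed

text \<open>At the first letter \<open>k\<close> that spoils minimality, the prefix \<open>u\<close>
  is geodesic and crossing \<open>k\<close> leads back towards the base tile. Then \<open>u\<close>
  is equivalent to a geodesic ending in \<open>k\<close>, and appending \<open>k\<close> creates the
  repetition.\<close>

lemma nongeodesic_exchange:
  assumes "w \<in> words p" "tdist (act A0 w) < length w"
  shows "\<exists>w'. (exchange p q)\<^sup>*\<^sup>* w w' \<and> (\<exists>k\<in>{1..p}. sublist [k, k] w')"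
  using assms
proof (induction w rule: rev_induct)
  case (snoc k u)
  have u: "u \<in> words p" "k \<in> {1..p}" using snoc by auto
  show ?case
  proof (cases "tdist (act A0 u) < length u")
    case True
    then obtain u' j where u': "(exchange p q)\<^sup>*\<^sup>* u u'" "j \<in> {1..p}" "sublist [j, j] u'"
      using snoc u by blast
    then have "sublist [j, j] (u' @ [k])" unfolding sublist_def by (metis append.assoc)
    then show ?thesis using exchange_rtrancl_append[OF u'(1)] u' by blast
  next
    case False
    define B where "B = act A0 u"
    have B: "B \<in> T" unfolding B_def using act_T A0 u by blast
    have lu: "length u = tdist B" using False tdist_act_le[OF A0 u(1)] B_def by simp
    have dB: "tdist B = Suc (tdist (nb B k))"
      using tdist_nb[OF B u(2)] snoc(3) lu B_def by auto
    obtain z where z: "z \<in> words p" "length z = tdist (nb B k)" "act A0 z = nb B k"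
      using geodesic_word[OF nb_T[OF B u(2)]] by blast
    have "act A0 (z @ [k]) = B" using z nb_nb[OF B u(2)] by simp
    then have "(exchange p q)\<^sup>*\<^sup>* u (z @ [k])"
      using geodesics_exchange[of u "z @ [k]"] u z lu dB B_def by simp
    then have "(exchange p q)\<^sup>*\<^sup>* (u @ [k]) (z @ [k] @ [k])" using exchange_rtrancl_append by fastforce
    moreover have "sublist [k, k] (z @ [k] @ [k])" unfolding sublist_def by (intro exI[of _ z] exI[of _ "[]"]) simp
    ultimately show ?thesis using u by blast
  qed
qed simp

lemma repeated_not_geodesic:
  assumes "x @ [k, k] @ y \<in> words p"
  shows "tdist (act A0 (x @ [k, k] @ y)) < length (x @ [k, k] @ y)"
proof -
  have w: "x \<in> words p" "k \<in> {1..p}" "y \<in> words p" using assms by auto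
  have "act A0 (x @ [k, k] @ y) = act A0 (x @ y)" using nb_nb[OF act_T[OF A0 w(1)] w(2)] by simp
  then show ?thesis using tdist_act_le[OF A0, of "x @ y"] w by simp
qed

text \<open>Deleting a pair \<open>kk\<close> keeps the end tile. In an alternating subword that is
  too long, exchanging the first \<open>q div 2\<close> letters produces such a pair.\<close>

lemma geodesic_admissible:
  assumes w: "w \<in> words p" and geo: "length w = tdist (act A0 w)"
  shows "admissible p q w"
  unfolding admissible_def
proof (intro conjI ballI allI impI notI)
  fix k assume "sublist [k, k] w"
  then obtain x y where "w = x @ [k, k] @ y" unfolding sublist_def by blast
  then show False using repeated_not_geodesic[of x k y] w geo by simp
next
  fix a b m assume ab: "consecutive_letters p a b \<and> m > q div 2" and "sublist (alternating m a b) w"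
  then obtain x y where xy: "w = x @ alternating m a b @ y" unfolding sublist_def by blast
  obtain k where k: "m = Suc (q div 2) + k" using ab less_iff_Suc_add by auto
  obtain r where r: "alternating m a b = alternating (Suc (q div 2)) a b @ r"
    using alternating_add[of "Suc (q div 2)" k a b] k by blast
  \<comment> \<open>The letter that follows the exchanged block; it equals the last letter of the
    block after the exchange.\<close>
  define c where "c = (if even (q div 2) then a else b)"
  obtain h where h: "q div 2 = Suc h" using q_pos by (cases "q div 2") auto
  have "w = x @ alternating (q div 2) a b @ ([c] @ r @ y)"
    unfolding xy r alternating_snoc c_def by simp
  then have ex: "exchange p q w (x @ alternating (q div 2) b a @ ([c] @ r @ y))"
    using ab unfolding exchange_def by blast
  have e: "x @ alternating (q div 2) b a @ ([c] @ r @ y) = (x @ alternating h b a) @ [c, c] @ (r @ y)"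
    unfolding h alternating_snoc c_def by simp
  have "(x @ alternating h b a) @ [c, c] @ (r @ y) \<in> words p" using exchange_words[OF ex] w e by simp
  from repeated_not_geodesic[OF this] show False
    using act_exchange[OF ex A0 w] exchange_length[OF ex] geo unfolding e by simp
qed

text \<open>Exchanges keep length and end tile, so one geodesic word makes the whole class geodesic
  and thus admissible; a class with a word that is not geodesic contains a word with a pair
  \<open>kk\<close>.\<close>

lemma class_iff_geodesic:
  "C \<in> admissible_word_classes p q n \<longleftrightarrow>
     (\<exists>w\<in>words p. C = word_equiv p q `` {w} \<and> length w = n \<and> tdist (act A0 w) = n)"
proof
  assume C: "C \<in> admissible_word_classes p q n"
  then obtain w where w: "w \<in> words p" "C = word_equiv p q `` {w}"
    unfolding admissible_word_classes_def by (auto elim: quotientE)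
  have wC: "w \<in> C" unfolding w(2) word_equiv_def using w(1) by simp
  have adm: "admissible p q u \<and> length u = n" if "u \<in> C" for u
    using C that unfolding admissible_word_classes_def by blast
  have "\<not> tdist (act A0 w) < length w"
  proof
    assume "tdist (act A0 w) < length w"
    then obtain w' k where w': "(exchange p q)\<^sup>*\<^sup>* w w'" "k \<in> {1..p}" "sublist [k, k] w'"
      using nongeodesic_exchange[OF w(1)] by blast
    then have "w' \<in> C" unfolding w(2) word_equiv_def using w(1) exchange_rtrancl_words by blast
    then show False using adm w' unfolding admissible_def by blast
  qed
  then have "tdist (act A0 w) = n" using tdist_act_le[OF A0 w(1)] adm[OF wC] by simp
  then show "\<exists>w\<in>words p. C = word_equiv p q `` {w} \<and> length w = n \<and> tdist (act A0 w) = n"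
    using w adm[OF wC] by blast
next
  assume "\<exists>w\<in>words p. C = word_equiv p q `` {w} \<and> length w = n \<and> tdist (act A0 w) = n"
  then obtain w where w: "w \<in> words p" "C = word_equiv p q `` {w}" "length w = n" "tdist (act A0 w) = n" by blast
  have "admissible p q u \<and> length u = n" if "u \<in> C" for u
  proof -
    have u: "(exchange p q)\<^sup>*\<^sup>* w u" "u \<in> words p" using that unfolding w(2) word_equiv_def by auto
    have "length u = n" "act A0 u = act A0 w"
      using exchange_rtrancl_words[OF u(1) w(1)] w act_exchange_rtrancl[OF u(1) A0 w(1)] by auto
    then show ?thesis using geodesic_admissible[OF u(2)] w by simp
  qed
  then show "C \<in> admissible_word_classes p q n"
    unfolding admissible_word_classes_def using w by (auto intro: quotientI)
qed

section \<open>Tiling paths and the bijection\<close>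

lemma path_pow:
  assumes "A \<in> T"
  shows "(\<exists>P. tiling_path T P \<and> hd P = A \<and> last P = B \<and> length P - 1 = n) \<longleftrightarrow> (adj ^^ n) A B"
  using assms
proof (induction n arbitrary: A)
  case 0
  have "tiling_path T P \<and> hd P = A \<and> last P = B \<and> length P - 1 = 0 \<longleftrightarrow> P = [A] \<and> A = B" for P
    unfolding tiling_path_def using 0 by (cases P) auto
  then show ?case by simp
next
  case (Suc n)
  show ?case
  proof
    assume "\<exists>P. tiling_path T P \<and> hd P = A \<and> last P = B \<and> length P - 1 = Suc n"
    then obtain P where P: "tiling_path T P" "hd P = A" "last P = B" "length P - 1 = Suc n" by blast
    then obtain D R where R: "P = A # D # R" by (cases P; cases "tl P") auto
    then have "tiling_path T (D # R)" "adj A D" using P unfolding tiling_path_def adj_def by auto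
    moreover have "last (D # R) = B" "length (D # R) - 1 = n" using P R by auto
    ultimately show "(adj ^^ Suc n) A B"
      using Suc.IH[of D] adj_T relpowp_Suc_I2[of adj A D n B] by (metis list.sel(1))
  next
    assume "(adj ^^ Suc n) A B"
    then obtain D where D: "adj A D" "(adj ^^ n) D B" by (metis relpowp_Suc_D2)
    then obtain P where P: "tiling_path T P" "hd P = D" "last P = B" "length P - 1 = n"
      using Suc.IH[of D] adj_T by metis
    then obtain R where "P = D # R" unfolding tiling_path_def by (cases P) auto
    then show "\<exists>P. tiling_path T P \<and> hd P = A \<and> last P = B \<and> length P - 1 = Suc n"
      using P D Suc unfolding tiling_path_def adj_def by (intro exI[of _ "A # P"]) auto
  qed
qed

lemma tiling_dist_tdist: "tiling_dist T A0 B = tdist B"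
  unfolding tiling_dist_def tdist_def path_pow[OF A0] ..

lemma path_word_act:
  assumes "A \<in> T" "w \<in> words p"
  shows "(\<exists>P. tiling_path T P \<and> hd P = A \<and> last P = B \<and> path_word lab P = w) \<longleftrightarrow> act A w = B"
  using assms
proof (induction w arbitrary: A)
  case Nil
  have "tiling_path T P \<and> hd P = A \<and> last P = B \<and> path_word lab P = [] \<longleftrightarrow> P = [A] \<and> A = B" for P
    unfolding tiling_path_def path_word_def using Nil by (cases P; cases "tl P") auto
  then show ?case by simp
next
  case (Cons k w)
  have k: "k \<in> {1..p}" "w \<in> words p" using Cons by auto
  show ?case
  proof
    assume "\<exists>P. tiling_path T P \<and> hd P = A \<and> last P = B \<and> path_word lab P = k # w"
    then obtain P where P: "tiling_path T P" "hd P = A" "last P = B" "path_word lab P = k # w" by blast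
    then obtain D R where R: "P = A # D # R" unfolding path_word_def by (cases P; cases "tl P") auto
    then have "tiling_path T (D # R)" and a: "adj A D" using P unfolding tiling_path_def adj_def by auto
    moreover have "last (D # R) = B" "path_word lab (D # R) = w" "lab (A \<inter> D) = k"
      using P R unfolding path_word_def by auto
    moreover have "nb A k = D" using nb_eq[OF a] calculation by blast
    ultimately show "act A (k # w) = B"
      using Cons.IH[of D] adj_T[OF a] k by (metis foldl_Cons list.sel(1))
  next
    assume *: "act A (k # w) = B"
    define D where "D = nb A k"
    have D: "adj A D" "lab (A \<inter> D) = k" unfolding D_def using nb_adj nb_lab Cons k by auto
    have "act D w = B" using * unfolding D_def by simp
    then obtain P where P: "tiling_path T P" "hd P = D" "last P = B" "path_word lab P = w"
      using Cons.IH[of D] adj_T[OF D(1)] k by metis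
    then obtain R where "P = D # R" unfolding tiling_path_def by (cases P) auto
    then show "\<exists>P. tiling_path T P \<and> hd P = A \<and> last P = B \<and> path_word lab P = k # w"
      using P D Cons unfolding tiling_path_def adj_def path_word_def by (intro exI[of _ "A # P"]) auto
  qed
qed

theorem classes_tiles_bij:
  "\<exists>f. bij_betw f (admissible_word_classes p q n) {B \<in> T. tiling_dist T A0 B = n} \<and>
    (\<forall>C\<in>admissible_word_classes p q n. \<forall>w\<in>C. \<forall>B. word_leads_to T lab A0 w B \<longleftrightarrow> B = f C)"
proof -
  \<comment> \<open>The chosen representative does not matter, because equivalent words lead to the
    same tile.\<close>
  define f where "f C = act A0 (SOME w. w \<in> C)" for C
  have fC: "f (word_equiv p q `` {w}) = act A0 w" if "w \<in> words p" for w
  proof -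
    have "w \<in> word_equiv p q `` {w}" unfolding word_equiv_def using that by simp
    then have "(SOME u. u \<in> word_equiv p q `` {w}) \<in> word_equiv p q `` {w}" by (rule someI)
    then have "(exchange p q)\<^sup>*\<^sup>* w (SOME u. u \<in> word_equiv p q `` {w})" unfolding word_equiv_def by auto
    then show ?thesis unfolding f_def using act_exchange_rtrancl[OF _ A0 that] by metis
  qed
  have "bij_betw f (admissible_word_classes p q n) {B \<in> T. tiling_dist T A0 B = n}"
    unfolding bij_betw_def
  proof
    show "inj_on f (admissible_word_classes p q n)"
    proof (rule inj_onI)
      fix C D assume CD: "C \<in> admissible_word_classes p q n" "D \<in> admissible_word_classes p q n" "f C = f D"
      obtain w where w: "w \<in> words p" "C = word_equiv p q `` {w}" "length w = n" "tdist (act A0 w) = n"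
        using CD(1) class_iff_geodesic by blast
      obtain u where u: "u \<in> words p" "D = word_equiv p q `` {u}" "length u = n" "tdist (act A0 u) = n"
        using CD(2) class_iff_geodesic by blast
      have "act A0 w = act A0 u" using CD(3) fC w u by simp
      then have "(exchange p q)\<^sup>*\<^sup>* w u" using geodesics_exchange[OF w(1) u(1)] w u by simp
      then have "(w, u) \<in> word_equiv p q" unfolding word_equiv_def using w u by simp
      then show "C = D" unfolding w(2) u(2) by (rule equiv_class_eq[OF equiv_word_equiv])
    qed
    show "f ` admissible_word_classes p q n = {B \<in> T. tiling_dist T A0 B = n}"
    proof
      show "f ` admissible_word_classes p q n \<subseteq> {B \<in> T. tiling_dist T A0 B = n}"
        using fC act_T[OF A0] unfolding class_iff_geodesic tiling_dist_tdist
        by (auto simp: class_iff_geodesic)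
      show "{B \<in> T. tiling_dist T A0 B = n} \<subseteq> f ` admissible_word_classes p q n"
      proof
        fix B assume "B \<in> {B \<in> T. tiling_dist T A0 B = n}"
        then have B: "B \<in> T" "tdist B = n" unfolding tiling_dist_tdist by auto
        then obtain w where w: "w \<in> words p" "length w = n" "act A0 w = B" using geodesic_word by blast
        then have "word_equiv p q `` {w} \<in> admissible_word_classes p q n"
          unfolding class_iff_geodesic using B by blast
        then show "B \<in> f ` admissible_word_classes p q n" using fC[OF w(1)] w(3) by force
      qed
    qed
  qed
  moreover have "word_leads_to T lab A0 u B \<longleftrightarrow> B = f C"
    if C: "C \<in> admissible_word_classes p q n" and u: "u \<in> C" for C u B
  proof -
    obtain w where w: "w \<in> words p" "C = word_equiv p q `` {w}" using C class_iff_geodesic by blast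
    have uw: "(exchange p q)\<^sup>*\<^sup>* w u" "u \<in> words p" using u unfolding w(2) word_equiv_def by auto
    have "f C = act A0 u" using fC[OF w(1)] act_exchange_rtrancl[OF uw(1) A0 w(1)] w by simp
    then show ?thesis unfolding word_leads_to_def using path_word_act[OF A0 uw(2)] by metis
  qed
  ultimately show ?thesis by blast
qed

end

theorem theorem1p15:
  fixes p q n :: nat
    and T :: "complex set set"
    and A0 :: "complex set"
    and lab :: "complex set \<Rightarrow> nat"
  assumes "p > 0" and "q > 0"
    and "1 / real p + 1 / real q < 1 / 2"
    and "even q"
    and "hyperbolic_tiling p q T"
    and "A0 \<in> T"
    and "edge_labelling p T A0 lab"
  shows "\<exists>f. bij_betw f (admissible_word_classes p q n) {B \<in> T. tiling_dist T A0 B = n} \<and>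
    (\<forall>C\<in>admissible_word_classes p q n. \<forall>w\<in>C. \<forall>B. word_leads_to T lab A0 w B \<longleftrightarrow> B = f C)"
proof -
  from assms(5) have "\<exists>s \<alpha>. \<forall>A\<in>T. regular_polygon p s \<alpha> A" and ht: "\<Union>T = hplane"
    "\<forall>A\<in>T. \<forall>B\<in>T. A \<noteq> B \<longrightarrow> interior A \<inter> interior B = {}"
    "\<forall>A\<in>T. \<forall>B\<in>T. (A \<inter> B) face_of A \<and> (A \<inter> B) face_of B"
    "\<forall>K. compact K \<and> K \<subseteq> hplane \<longrightarrow> finite {A \<in> T. A \<inter> K \<noteq> {}}"
    "\<forall>A\<in>T. \<forall>x. x extreme_point_of A \<longrightarrow> card {B \<in> T. x \<in> B} = q"
    unfolding hyperbolic_tiling_def by - (elim conjE, assumption)+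
  then obtain s \<alpha> where "\<forall>A\<in>T. regular_polygon p s \<alpha> A" by (elim exE)
  with ht interpret ltiling p q s \<alpha> T A0 lab
    by unfold_locales (use assms(6,7) in simp_all)
  show ?thesis by (rule classes_tiles_bij)
qed

end
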